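(* Let $K$ be a field, $R=K[x_1,\dots,x_d]$, $\mathfrak{m}=(x_1,\dots,x_d)$, and let $I\subset R$ be a Gorenstein ideal of codimension $d$ minimally generated by $\nu(\mathfrak{m}^2)-1$ quadrics. Then there is a set of linearly independent linear forms $\{y_1,\dots,y_d\}$ of $R$ such that $$I=(x_iy_j\ (1\le i,j\le d,\ i\ne j),\ x_1y_1-x_2y_2,\ \dots,\ x_1y_1-x_dy_d).$$ Conversely, any ideal of this form is Gorenstein.
   Context: A quadric is a homogeneous polynomial of degree $2$. $\nu(\cdot)$ denotes the minimal number of generators, so $\nu(\mathfrak{m}^2)=\binom{d+1}{2}$. An ideal $I\subset R$ is called Gorenstein if $R/I$ is a Gorenstein ring.
   Formalization: The converse is stated only for ideals of this form that are minimally generated by ν(m²)−1 quadrics; for arbitrary independent y it fails: d=2, y_1=x_1+x_2, y_2=x_2 gives I=m², which is not Gorenstein. Only I=m² with d≥2 is excluded. *)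

theory Defs
  imports
    "HOL-Algebra.Algebra"
    "HOL-Algebra.Algebraic_Closure_Type"
    "HOL-Library.Poly_Mapping"
    "HOL-Library.Extended_Nat"
begin

section \<open>Modules and injective dimension\<close>

definition ring_as_module :: "'a ring \<Rightarrow> ('a, 'a) module" where
  "ring_as_module A = \<lparr>carrier = carrier A, monoid.mult = monoid.mult A, one = one A,
     ring.zero = ring.zero A, ring.add = ring.add A, module.smult = monoid.mult A\<rparr>"

definition module_homs :: "'a ring \<Rightarrow> ('a, 'b) module \<Rightarrow> ('a, 'c) module \<Rightarrow> ('b \<Rightarrow> 'c) set" where
  "module_homs A M N = {f \<in> hom (add_monoid M) (add_monoid N).
     \<forall>a\<in>carrier A. \<forall>x\<in>carrier M. f (a \<odot>\<^bsub>M\<^esub> x) = a \<odot>\<^bsub>N\<^esub> f x}"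

text \<open>HOL cannot quantify over modules on all types, so injectivity of \<open>E\<close> is tested on
  monomorphisms \<open>M \<rightarrow> N\<close> of modules carried by the same type \<open>'u\<close> as \<open>E\<close>. As soon as \<open>'a\<close>
  embeds into \<open>'u\<close>, these include copies of all inclusions of ideals of \<open>A\<close> into \<open>A\<close>, so that by
  Baer's criterion this is injectivity with respect to all \<open>A\<close>-modules.\<close>

definition injective_module :: "'a ring \<Rightarrow> ('a, 'u) module \<Rightarrow> bool" where
  "injective_module A E \<longleftrightarrow> Module.module A E \<and>
     (\<forall>(M :: ('a, 'u) module) (N :: ('a, 'u) module) f g.
        Module.module A M \<and> Module.module A N \<and>
        f \<in> module_homs A M N \<and> inj_on f (carrier M) \<and> g \<in> module_homs A M E \<longrightarrow>
        (\<exists>h\<in>module_homs A N E. \<forall>x\<in>carrier M. h (f x) = g x))"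

text \<open>An exact sequence \<open>0 \<rightarrow> M \<rightarrow> E 0 \<rightarrow> E 1 \<rightarrow> \<dots>\<close> with all \<open>E i\<close> injective.\<close>

definition injective_resolution ::
  "'a ring \<Rightarrow> ('a, 'b) module \<Rightarrow> (nat \<Rightarrow> ('a, 'u) module) \<Rightarrow> ('b \<Rightarrow> 'u) \<Rightarrow> (nat \<Rightarrow> 'u \<Rightarrow> 'u) \<Rightarrow> bool" where
  "injective_resolution A M E \<epsilon> \<delta> \<longleftrightarrow>
     (\<forall>i. injective_module A (E i)) \<and>
     \<epsilon> \<in> module_homs A M (E 0) \<and> (\<forall>i. \<delta> i \<in> module_homs A (E i) (E (Suc i))) \<and>
     inj_on \<epsilon> (carrier M) \<and>
     \<epsilon> ` carrier M = a_kernel (E 0) (E 1) (\<delta> 0) \<and>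
     (\<forall>i. \<delta> i ` carrier (E i) = a_kernel (E (Suc i)) (E (Suc (Suc i))) (\<delta> (Suc i)))"

text \<open>With \<open>\<kappa> = max |'a| \<aleph>\<^sub>0\<close>, the type \<open>(nat \<times> 'a) set\<close> has cardinality \<open>2\<^sup>\<kappa>\<close>. Every module over
  \<open>A\<close> of cardinality at most \<open>2\<^sup>\<kappa>\<close> embeds into an injective one \<open>Hom\<^sub>\<int>(A, D)\<close>, \<open>D\<close> divisible, that
  is again of cardinality at most \<open>2\<^sup>\<kappa>\<close>. Hence this type is large enough for the injective
  resolutions of \<open>A\<close>, and restricting to it does not affect the injective dimension.\<close>

definition finite_self_injective_dimension :: "'a ring \<Rightarrow> bool" where
  "finite_self_injective_dimension A \<longleftrightarrow>
     (\<exists>(E :: nat \<Rightarrow> ('a, (nat \<times> 'a) set) module) \<epsilon> \<delta> n.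
        injective_resolution A (ring_as_module A) E \<epsilon> \<delta> \<and>
        (\<forall>i>n. carrier (E i) = {\<zero>\<^bsub>E i\<^esub>}))"

section \<open>Localization and Gorenstein rings\<close>

definition localization_rel :: "'a ring \<Rightarrow> 'a set \<Rightarrow> (('a \<times> 'a) \<times> ('a \<times> 'a)) set" where
  "localization_rel A P = {((a, s), (b, t)) | a s b t.
     a \<in> carrier A \<and> b \<in> carrier A \<and> s \<in> carrier A - P \<and> t \<in> carrier A - P \<and>
     (\<exists>u\<in>carrier A - P. u \<otimes>\<^bsub>A\<^esub> (a \<otimes>\<^bsub>A\<^esub> t) = u \<otimes>\<^bsub>A\<^esub> (b \<otimes>\<^bsub>A\<^esub> s))}"

text \<open>The localization of \<open>A\<close> at the prime ideal \<open>P\<close>; the class of \<open>(a, s)\<close> is the fraction \<open>a / s\<close>.\<close>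

definition localization :: "'a ring \<Rightarrow> 'a set \<Rightarrow> ('a \<times> 'a) set ring" where
  "localization A P = \<lparr>
     carrier = (carrier A \<times> (carrier A - P)) // localization_rel A P,
     monoid.mult = (\<lambda>U V. \<Union>(a, s)\<in>U. \<Union>(b, t)\<in>V.
       localization_rel A P `` {(a \<otimes>\<^bsub>A\<^esub> b, s \<otimes>\<^bsub>A\<^esub> t)}),
     one = localization_rel A P `` {(\<one>\<^bsub>A\<^esub>, \<one>\<^bsub>A\<^esub>)},
     ring.zero = localization_rel A P `` {(\<zero>\<^bsub>A\<^esub>, \<one>\<^bsub>A\<^esub>)},
     ring.add = (\<lambda>U V. \<Union>(a, s)\<in>U. \<Union>(b, t)\<in>V.
       localization_rel A P `` {((a \<otimes>\<^bsub>A\<^esub> t) \<oplus>\<^bsub>A\<^esub> (b \<otimes>\<^bsub>A\<^esub> s), s \<otimes>\<^bsub>A\<^esub> t)})\<rparr>"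

text \<open>The localizations of a commutative Noetherian ring at primes are Noetherian local rings, and
  such a ring is Gorenstein if its injective dimension over itself is finite.\<close>

definition gorenstein_ring :: "'a ring \<Rightarrow> bool" where
  "gorenstein_ring A \<longleftrightarrow> cring A \<and> noetherian_ring A \<and>
     (\<forall>P. primeideal P A \<longrightarrow> finite_self_injective_dimension (localization A P))"

definition gorenstein_ideal :: "'a ring \<Rightarrow> 'a set \<Rightarrow> bool" where
  "gorenstein_ideal R I \<longleftrightarrow> ideal I R \<and> gorenstein_ring (R Quot I)"

section \<open>Codimension and numbers of generators\<close>

definition prime_height :: "'a ring \<Rightarrow> 'a set \<Rightarrow> enat" where
  "prime_height R P = Sup {enat n | n. \<exists>C :: nat \<Rightarrow> 'a set.
     (\<forall>i\<le>n. primeideal (C i) R) \<and> (\<forall>i<n. C i \<subset> C (Suc i)) \<and> C n = P}"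

text \<open>The unit ideal has codimension \<open>\<infinity>\<close>.\<close>

definition codimension :: "'a ring \<Rightarrow> 'a set \<Rightarrow> enat" where
  "codimension R I = Inf {prime_height R P | P. primeideal P R \<and> I \<subseteq> P}"

text \<open>The minimal number of generators of a finitely generated ideal.\<close>

definition min_gens :: "'a ring \<Rightarrow> 'a set \<Rightarrow> nat" where
  "min_gens R I = (LEAST n. \<exists>G. G \<subseteq> carrier R \<and> finite G \<and> card G = n \<and> Idl\<^bsub>R\<^esub> G = I)"

definition minimal_generating_set :: "'a ring \<Rightarrow> 'a set \<Rightarrow> 'a set \<Rightarrow> bool" where
  "minimal_generating_set R G I \<longleftrightarrow>
     G \<subseteq> carrier R \<and> Idl\<^bsub>R\<^esub> G = I \<and> (\<forall>H. H \<subset> G \<longrightarrow> Idl\<^bsub>R\<^esub> H \<noteq> I)"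

section \<open>The polynomial ring\<close>

text \<open>Polynomials over \<open>'k\<close> in variables indexed by \<open>'n\<close>: finitely supported functions from
  exponent vectors to coefficients.\<close>

type_synonym ('n, 'k) mpoly = "('n \<Rightarrow>\<^sub>0 nat) \<Rightarrow>\<^sub>0 'k"

abbreviation mpoly_ring :: "('n::finite, 'k::field) mpoly ring" where
  "mpoly_ring \<equiv> ring_of_type_algebra"

definition Const :: "'k \<Rightarrow> ('n::finite, 'k::field) mpoly" where
  "Const c = Poly_Mapping.single 0 c"

definition Var :: "'n \<Rightarrow> ('n::finite, 'k::field) mpoly" where
  "Var i = Poly_Mapping.single (Poly_Mapping.single i 1) 1"

definition homogeneous :: "nat \<Rightarrow> ('n::finite, 'k::field) mpoly \<Rightarrow> bool" where
  "homogeneous n p \<longleftrightarrow> (\<forall>m\<in>Poly_Mapping.keys p. (\<Sum>i\<in>UNIV. Poly_Mapping.lookup m i) = n)"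

definition irrelevant_ideal :: "('n::finite, 'k::field) mpoly set" where
  "irrelevant_ideal = Idl\<^bsub>mpoly_ring\<^esub> (range Var)"

definition minimally_generated_by_quadrics :: "nat \<Rightarrow> ('n::finite, 'k::field) mpoly set \<Rightarrow> bool" where
  "minimally_generated_by_quadrics n I \<longleftrightarrow>
     (\<exists>G. finite G \<and> card G = n \<and> (\<forall>q\<in>G. homogeneous 2 q) \<and> minimal_generating_set mpoly_ring G I)"

definition independent_linear_forms :: "('n \<Rightarrow> ('n::finite, 'k::field) mpoly) \<Rightarrow> bool" where
  "independent_linear_forms y \<longleftrightarrow>
     (\<forall>j. homogeneous 1 (y j)) \<and>
     (\<forall>c :: 'n \<Rightarrow> 'k. (\<Sum>j\<in>UNIV. Const (c j) * y j) = 0 \<longrightarrow> (\<forall>j. c j = 0))"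

text \<open>The index \<open>i1\<close> stands for the first element of the index set.\<close>

definition pairing_ideal ::
  "'n \<Rightarrow> ('n \<Rightarrow> ('n::finite, 'k::field) mpoly) \<Rightarrow> ('n, 'k) mpoly set" where
  "pairing_ideal i1 y = Idl\<^bsub>mpoly_ring\<^esub>
     ({Var i * y j | i j. i \<noteq> j} \<union> {Var i1 * y i1 - Var j * y j | j. j \<noteq> i1})"

end

theory Submission
  imports Defs "HOL-Computational_Algebra.Fraction_Field" "HOL-Computational_Algebra.Polynomial"
begin

text \<open>Minimality makes the generating quadrics span a hyperplane \<open>ker L\<close> in the space of all
  quadrics, and \<open>L\<close> amounts to the symmetric bilinear form \<open>(v, v') \<mapsto> L (v v')\<close> on linear forms.
  If this form is nondegenerate, the basis \<open>y\<close> dual to the variables satisfies \<open>L (x\<^sub>i y\<^sub>j) = \<delta>\<^sub>i\<^sub>j\<close>,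
  which says exactly that the ideal is generated by the claimed quadrics. If it is degenerate (and
  \<open>d \<ge> 2\<close>), then in the localization at the origin the maximal ideal is the direct sum of a copy of
  the residue field \<open>k\<close> and a nonzero ideal; hence \<open>Ext\<^sup>i(k, -)\<close> is a summand of \<open>Ext\<^sup>i\<^sup>+\<^sup>1(k, -)\<close>, so
  finite injective dimension would give \<open>Ext\<^sup>1(k, B) = 0\<close>, which is false.

  Conversely, for \<open>d \<ge> 2\<close> the quotient is a local Frobenius algebra with trace form induced by \<open>L\<close>, hence
  injective over itself by Baer's criterion. For \<open>d = 1\<close> the ideal is zero, and over the localizations
  \<open>B\<close> of \<open>K[x]\<close>, which are principal ideal domains, the divisible modules \<open>F\<close> and \<open>F / B\<close> are injective,
  \<open>F\<close> being the field of fractions of \<open>K[x]\<close>.\<close>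

text \<open>In the converse the number of generators is a genuine condition. Requiring
  \<open>L (x\<^sub>i y\<^sub>j) = \<delta>\<^sub>i\<^sub>j\<close> puts \<open>d\<^sup>2\<close>
  conditions on a functional on a space of dimension \<open>d (d + 1) / 2\<close>, and independence
  of the \<open>y\<^sub>j\<close> does not make them compatible: for \<open>d = 2\<close>,
  \<open>y\<^sub>1 = x\<^sub>1\<close>, \<open>y\<^sub>2 = x\<^sub>1 + x\<^sub>2\<close> the listed
  quadrics generate the square of the irrelevant ideal, whose quotient has a two-dimensional socle.
  Ext never appears as an object. The elements of \<open>E i\<close> killed by the maximal ideal are
  \<open>Hom (k, E i)\<close>, so the vanishing of \<open>Ext\<^sup>i\<^sup>+\<^sup>1(k, B)\<close>
  says that every cocycle of this kind in \<open>E (Suc i)\<close> is the image of an element of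
  this kind in \<open>E i\<close>. The splitting is given by the coefficient at a variable
  \<open>x\<^sub>i\<close> that occurs in a radical form \<open>w\<close>; a second variable
  \<open>x\<^sub>j\<close> lies in the kernel of that coefficient, and this is where
  \<open>d \<ge> 2\<close> enters. Injectivity is tested on one carrier type only, so modules have
  to be copied into it before Baer's criterion can be used in either direction.\<close>

section \<open>Baer's criterion\<close>

text \<open>An extension of \<open>\<phi>\<close> to all of \<open>B\<close> is determined by its
  value at one, so the element \<open>e\<close> stands for the extended map. This form mentions no
  module besides \<open>E\<close> and hence no carrier type for test modules.\<close>

definition baer :: "'a ring \<Rightarrow> ('a, 'b) module \<Rightarrow> bool" where
  "baer B E \<longleftrightarrow> (\<forall>J \<phi>. ideal J B \<and> (\<forall>a\<in>J. \<phi> a \<in> carrier E) \<and>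
     (\<forall>a\<in>J. \<forall>b\<in>J. \<phi> (a \<oplus>\<^bsub>B\<^esub> b) = \<phi> a \<oplus>\<^bsub>E\<^esub> \<phi> b) \<and>
     (\<forall>r\<in>carrier B. \<forall>a\<in>J. \<phi> (r \<otimes>\<^bsub>B\<^esub> a) = r \<odot>\<^bsub>E\<^esub> \<phi> a) \<longrightarrow>
     (\<exists>e\<in>carrier E. \<forall>a\<in>J. \<phi> a = a \<odot>\<^bsub>E\<^esub> e))"

lemma baerI:
  assumes "\<And>J \<phi>. \<lbrakk>ideal J B; \<And>a. a \<in> J \<Longrightarrow> \<phi> a \<in> carrier E;
     \<And>a b. a \<in> J \<Longrightarrow> b \<in> J \<Longrightarrow> \<phi> (a \<oplus>\<^bsub>B\<^esub> b) = \<phi> a \<oplus>\<^bsub>E\<^esub> \<phi> b;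
     \<And>r a. r \<in> carrier B \<Longrightarrow> a \<in> J \<Longrightarrow> \<phi> (r \<otimes>\<^bsub>B\<^esub> a) = r \<odot>\<^bsub>E\<^esub> \<phi> a\<rbrakk>
     \<Longrightarrow> \<exists>e\<in>carrier E. \<forall>a\<in>J. \<phi> a = a \<odot>\<^bsub>E\<^esub> e"
  shows "baer B E"
  unfolding baer_def by (intro allI impI, elim conjE, rule assms) simp_all

lemma baerD:
  assumes "baer B E" "ideal J B" "\<And>a. a \<in> J \<Longrightarrow> \<phi> a \<in> carrier E"
     "\<And>a b. a \<in> J \<Longrightarrow> b \<in> J \<Longrightarrow> \<phi> (a \<oplus>\<^bsub>B\<^esub> b) = \<phi> a \<oplus>\<^bsub>E\<^esub> \<phi> b"
     "\<And>r a. r \<in> carrier B \<Longrightarrow> a \<in> J \<Longrightarrow> \<phi> (r \<otimes>\<^bsub>B\<^esub> a) = r \<odot>\<^bsub>E\<^esub> \<phi> a"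
  shows "\<exists>e\<in>carrier E. \<forall>a\<in>J. \<phi> a = a \<odot>\<^bsub>E\<^esub> e"
  using assms(1)[unfolded baer_def, rule_format, of J \<phi>] assms(2-) by simp

text \<open>The record type \<open>module\<close> extends that of rings; its fields \<open>mult\<close> and \<open>one\<close> are irrelevant
  for modules and filled arbitrarily.\<close>

definition submodule_copy :: "'a ring \<Rightarrow> 'a set \<Rightarrow> ('a \<Rightarrow> 'u) \<Rightarrow> ('a, 'u) module" where
  "submodule_copy B J j = \<lparr>carrier = j ` J,
     monoid.mult = (\<lambda>x y. x), one = j \<zero>\<^bsub>B\<^esub>, ring.zero = j \<zero>\<^bsub>B\<^esub>,
     ring.add = (\<lambda>x y. j (inv_into UNIV j x \<oplus>\<^bsub>B\<^esub> inv_into UNIV j y)),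
     module.smult = (\<lambda>a x. j (a \<otimes>\<^bsub>B\<^esub> inv_into UNIV j x))\<rparr>"

lemma submodule_copy_module:
  assumes "cring B" "ideal J B" "inj j"
  shows "Module.module B (submodule_copy B J j)"
proof -
  interpret cring B by fact
  interpret ideal J B by fact
  have [simp]: "inv_into UNIV j (j x) = x" for x using assms(3) by simp
  have c: "a \<in> J \<Longrightarrow> a \<in> carrier B" for a using a_subset by auto
  show ?thesis
  proof (rule moduleI)
    show "abelian_group (submodule_copy B J j)"
    proof (rule abelian_groupI)
      fix x assume "x \<in> carrier (submodule_copy B J j)"
      then obtain a where a: "x = j a" "a \<in> J" by (auto simp: submodule_copy_def)
      then show "\<exists>y\<in>carrier (submodule_copy B J j). y \<oplus>\<^bsub>submodule_copy B J j\<^esub> x = \<zero>\<^bsub>submodule_copy B J j\<^esub>"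
        by (intro bexI[of _ "j (\<ominus>\<^bsub>B\<^esub> a)"]) (auto simp: submodule_copy_def l_neg c)
    qed (auto simp: submodule_copy_def c a_ac)
  qed (auto simp: submodule_copy_def c I_l_closed l_distr r_distr m_assoc assms(1))
qed

lemma module_homsI:
  assumes "\<And>x. x \<in> carrier M \<Longrightarrow> f x \<in> carrier N"
    "\<And>x y. x \<in> carrier M \<Longrightarrow> y \<in> carrier M \<Longrightarrow> f (x \<oplus>\<^bsub>M\<^esub> y) = f x \<oplus>\<^bsub>N\<^esub> f y"
    "\<And>a x. a \<in> carrier A \<Longrightarrow> x \<in> carrier M \<Longrightarrow> f (a \<odot>\<^bsub>M\<^esub> x) = a \<odot>\<^bsub>N\<^esub> f x"
  shows "f \<in> module_homs A M N"
  using assms by (auto simp: module_homs_def hom_def)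

lemma module_homsD:
  assumes "f \<in> module_homs A M N"
  shows "x \<in> carrier M \<Longrightarrow> f x \<in> carrier N"
    "x \<in> carrier M \<Longrightarrow> y \<in> carrier M \<Longrightarrow> f (x \<oplus>\<^bsub>M\<^esub> y) = f x \<oplus>\<^bsub>N\<^esub> f y"
    "a \<in> carrier A \<Longrightarrow> x \<in> carrier M \<Longrightarrow> f (a \<odot>\<^bsub>M\<^esub> x) = a \<odot>\<^bsub>N\<^esub> f x"
  using assms by (auto simp: module_homs_def hom_def)

text \<open>The injection \<open>j\<close> makes copies of \<open>J\<close> and of \<open>B\<close>
  available as modules on the type of \<open>E\<close>, where the hypothesis applies to the
  inclusion of one copy into the other; \<open>e\<close> is the value of the extension at the copy
  of one.\<close>

lemma injective_module_imp_baer: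
  fixes E :: "('a, 'u) module" and j :: "'a \<Rightarrow> 'u"
  assumes "injective_module B E" "inj j"
  shows "baer B E"
proof (rule baerI)
  fix J \<phi> assume J: "ideal J B" and \<phi>: "\<And>a. a \<in> J \<Longrightarrow> \<phi> a \<in> carrier E"
     "\<And>a b. a \<in> J \<Longrightarrow> b \<in> J \<Longrightarrow> \<phi> (a \<oplus>\<^bsub>B\<^esub> b) = \<phi> a \<oplus>\<^bsub>E\<^esub> \<phi> b"
     "\<And>r a. r \<in> carrier B \<Longrightarrow> a \<in> J \<Longrightarrow> \<phi> (r \<otimes>\<^bsub>B\<^esub> a) = r \<odot>\<^bsub>E\<^esub> \<phi> a"
  from assms(1) have E: "Module.module B E" by (simp add: injective_module_def)
  interpret E: Module.module B E by fact
  interpret J: ideal J B by fact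
  have [simp]: "inv_into UNIV j (j x) = x" for x using assms(2) by simp
  let ?M = "submodule_copy B J j" and ?N = "submodule_copy B (carrier B) j"
  have cc: "a \<in> J \<Longrightarrow> a \<in> carrier B" for a using J.a_subset by auto
  have "Module.module B ?M" "Module.module B ?N"
    using submodule_copy_module E.R.is_cring J E.R.oneideal assms(2) by blast+
  moreover have "id \<in> module_homs B ?M ?N"
    by (rule module_homsI) (auto simp: submodule_copy_def cc)
  moreover have "(\<lambda>x. \<phi> (inv_into UNIV j x)) \<in> module_homs B ?M E"
    by (rule module_homsI) (auto simp: submodule_copy_def \<phi> J.I_l_closed)
  ultimately obtain h where h: "h \<in> module_homs B ?N E"
    "\<forall>x\<in>carrier ?M. h (id x) = \<phi> (inv_into UNIV j x)"
    using assms(1) unfolding injective_module_def by (metis inj_on_id)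
  show "\<exists>e\<in>carrier E. \<forall>a\<in>J. \<phi> a = a \<odot>\<^bsub>E\<^esub> e"
  proof (intro bexI ballI)
    show "h (j \<one>\<^bsub>B\<^esub>) \<in> carrier E"
      by (rule module_homsD(1)[OF h(1)]) (auto simp: submodule_copy_def)
    fix a assume a: "a \<in> J"
    have "h (j a) = h (a \<odot>\<^bsub>?N\<^esub> j \<one>\<^bsub>B\<^esub>)" using a by (simp add: submodule_copy_def cc)
    also have "\<dots> = a \<odot>\<^bsub>E\<^esub> h (j \<one>\<^bsub>B\<^esub>)"
      by (rule module_homsD(3)[OF h(1)]) (use a in \<open>auto simp: submodule_copy_def cc\<close>)
    finally show "\<phi> a = a \<odot>\<^bsub>E\<^esub> h (j \<one>\<^bsub>B\<^esub>)" using h(2) a by (auto simp: submodule_copy_def)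
  qed
qed

text \<open>Zorn's lemma is applied to the graphs of partial extensions.\<close>

lemma baer_imp_injective_module:
  fixes E :: "('a, 'u) module"
  assumes E: "Module.module B E" and baer: "baer B E"
  shows "injective_module B E"
  unfolding injective_module_def
proof (intro conjI allI impI E)
  fix M N :: "('a, 'u) module" and f g
  assume as: "Module.module B M \<and> Module.module B N \<and> f \<in> module_homs B M N \<and>
    inj_on f (carrier M) \<and> g \<in> module_homs B M E"
  interpret E: Module.module B E by fact
  interpret M: Module.module B M using as by blast
  interpret N: Module.module B N using as by blast
  from as have f: "f \<in> module_homs B M N" and g: "g \<in> module_homs B M E"
    and inj: "inj_on f (carrier M)" by auto
  note fD = module_homsD[OF f] and gD = module_homsD[OF g]
  \<comment> \<open>Submodules of \<open>N \<times> E\<close> that contain the partial map given by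
    \<open>g\<close> on the image of \<open>f\<close>. The last condition is single-valuedness at
    zero, which by additivity gives it everywhere and is visibly preserved by unions of
    chains.\<close>
  define Q where "Q = {\<Gamma>. \<Gamma> \<subseteq> carrier N \<times> carrier E \<and> (\<lambda>x. (f x, g x)) ` carrier M \<subseteq> \<Gamma> \<and>
     (\<forall>n u n' u'. (n, u) \<in> \<Gamma> \<longrightarrow> (n', u') \<in> \<Gamma> \<longrightarrow> (n \<oplus>\<^bsub>N\<^esub> n', u \<oplus>\<^bsub>E\<^esub> u') \<in> \<Gamma>) \<and>
     (\<forall>a n u. a \<in> carrier B \<longrightarrow> (n, u) \<in> \<Gamma> \<longrightarrow> (a \<odot>\<^bsub>N\<^esub> n, a \<odot>\<^bsub>E\<^esub> u) \<in> \<Gamma>) \<and>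
     (\<forall>u. (\<zero>\<^bsub>N\<^esub>, u) \<in> \<Gamma> \<longrightarrow> u = \<zero>\<^bsub>E\<^esub>)}"
  have f0: "f \<zero>\<^bsub>M\<^esub> = \<zero>\<^bsub>N\<^esub>" using fD(2)[of "\<zero>\<^bsub>M\<^esub>" "\<zero>\<^bsub>M\<^esub>"] fD(1)[of "\<zero>\<^bsub>M\<^esub>"]
    by simp
  have g0: "g \<zero>\<^bsub>M\<^esub> = \<zero>\<^bsub>E\<^esub>" using gD(2)[of "\<zero>\<^bsub>M\<^esub>" "\<zero>\<^bsub>M\<^esub>"] gD(1)[of "\<zero>\<^bsub>M\<^esub>"]
    by simp
  have base: "(\<lambda>x. (f x, g x)) ` carrier M \<in> Q"
    unfolding Q_def
  proof (intro CollectI conjI allI impI)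
    fix n u n' u' assume "(n, u) \<in> (\<lambda>x. (f x, g x)) ` carrier M" "(n', u') \<in> (\<lambda>x. (f x, g x)) ` carrier M"
    then obtain x y where "n = f x" "u = g x" "n' = f y" "u' = g y" "x \<in> carrier M" "y \<in> carrier M" by auto
    then show "(n \<oplus>\<^bsub>N\<^esub> n', u \<oplus>\<^bsub>E\<^esub> u') \<in> (\<lambda>x. (f x, g x)) ` carrier M"
      by (intro image_eqI[of _ _ "x \<oplus>\<^bsub>M\<^esub> y"]) (simp_all add: fD gD)
  next
    fix a n u assume "a \<in> carrier B" "(n, u) \<in> (\<lambda>x. (f x, g x)) ` carrier M"
    then show "(a \<odot>\<^bsub>N\<^esub> n, a \<odot>\<^bsub>E\<^esub> u) \<in> (\<lambda>x. (f x, g x)) ` carrier M"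
      by (auto simp flip: fD(3) gD(3))
  next
    fix u assume "(\<zero>\<^bsub>N\<^esub>, u) \<in> (\<lambda>x. (f x, g x)) ` carrier M"
    then obtain x where "x \<in> carrier M" "f x = \<zero>\<^bsub>N\<^esub>" "u = g x" by auto
    then show "u = \<zero>\<^bsub>E\<^esub>" using f0 g0 inj_onD[OF inj, of x "\<zero>\<^bsub>M\<^esub>"] by auto
  qed (auto simp: fD gD)
  have "\<exists>\<Gamma>\<in>Q. \<forall>Y\<in>Q. \<Gamma> \<subseteq> Y \<longrightarrow> Y = \<Gamma>"
  proof (rule subset_Zorn_nonempty)
    show "Q \<noteq> {}" using base by auto
    fix C assume C: "C \<noteq> {}" "subset.chain Q C"
    then have CQ: "\<And>Y. Y \<in> C \<Longrightarrow> Y \<in> Q" and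
      lin: "\<And>Y Z. Y \<in> C \<Longrightarrow> Z \<in> C \<Longrightarrow> Y \<subseteq> Z \<or> Z \<subseteq> Y" by (auto simp: subset_chain_def)
    obtain Y0 where Y0: "Y0 \<in> C" using C(1) by blast
    show "\<Union>C \<in> Q"
      unfolding Q_def
    proof (intro CollectI conjI allI impI)
      have "Y \<subseteq> carrier N \<times> carrier E" if "Y \<in> C" for Y using CQ[OF that] unfolding Q_def by blast
      then show "\<Union>C \<subseteq> carrier N \<times> carrier E" by blast
      have "(\<lambda>x. (f x, g x)) ` carrier M \<subseteq> Y0" using CQ[OF Y0] unfolding Q_def by blast
      then show "(\<lambda>x. (f x, g x)) ` carrier M \<subseteq> \<Union>C" using Y0 by blast
      fix n u n' u' assume "(n, u) \<in> \<Union>C" "(n', u') \<in> \<Union>C"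
      then obtain Y where Y: "Y \<in> C" "(n, u) \<in> Y" "(n', u') \<in> Y" using lin by blast
      then have "(n \<oplus>\<^bsub>N\<^esub> n', u \<oplus>\<^bsub>E\<^esub> u') \<in> Y" using CQ[OF Y(1)] unfolding Q_def by blast
      then show "(n \<oplus>\<^bsub>N\<^esub> n', u \<oplus>\<^bsub>E\<^esub> u') \<in> \<Union>C" using Y(1) by blast
    next
      fix a n u assume a: "a \<in> carrier B" and "(n, u) \<in> \<Union>C"
      then obtain Y where Y: "Y \<in> C" "(n, u) \<in> Y" by blast
      then have "(a \<odot>\<^bsub>N\<^esub> n, a \<odot>\<^bsub>E\<^esub> u) \<in> Y" using CQ[OF Y(1)] a unfolding Q_def by blast
      then show "(a \<odot>\<^bsub>N\<^esub> n, a \<odot>\<^bsub>E\<^esub> u) \<in> \<Union>C" using Y(1) by blast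
    next
      fix u assume "(\<zero>\<^bsub>N\<^esub>, u) \<in> \<Union>C"
      then obtain Y where Y: "Y \<in> C" "(\<zero>\<^bsub>N\<^esub>, u) \<in> Y" by blast
      then show "u = \<zero>\<^bsub>E\<^esub>" using CQ[OF Y(1)] unfolding Q_def by blast
    qed
  qed
  then obtain \<Gamma> where "\<Gamma> \<in> Q" and max: "\<And>Y. Y \<in> Q \<Longrightarrow> \<Gamma> \<subseteq> Y \<Longrightarrow> Y = \<Gamma>" by blast
  then have sub: "\<Gamma> \<subseteq> carrier N \<times> carrier E" and ext: "(\<lambda>x. (f x, g x)) ` carrier M \<subseteq> \<Gamma>"
    and add: "\<And>n u n' u'. (n, u) \<in> \<Gamma> \<Longrightarrow> (n', u') \<in> \<Gamma> \<Longrightarrow> (n \<oplus>\<^bsub>N\<^esub> n', u \<oplus>\<^bsub>E\<^esub> u') \<in> \<Gamma>"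
    and smult: "\<And>a n u. a \<in> carrier B \<Longrightarrow> (n, u) \<in> \<Gamma> \<Longrightarrow> (a \<odot>\<^bsub>N\<^esub> n, a \<odot>\<^bsub>E\<^esub> u) \<in> \<Gamma>"
    and zero: "\<And>u. (\<zero>\<^bsub>N\<^esub>, u) \<in> \<Gamma> \<Longrightarrow> u = \<zero>\<^bsub>E\<^esub>"
    by (auto simp: Q_def)
  have neg: "(\<ominus>\<^bsub>N\<^esub> n, \<ominus>\<^bsub>E\<^esub> u) \<in> \<Gamma>" if "(n, u) \<in> \<Gamma>" for n u
    using smult[OF _ that, of "\<ominus>\<^bsub>B\<^esub> \<one>\<^bsub>B\<^esub>"] sub that
    by (auto simp: N.smult_l_minus E.smult_l_minus)
  have uniq: "u = u'" if "(n, u) \<in> \<Gamma>" "(n, u') \<in> \<Gamma>" for n u u'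
  proof -
    have c: "u \<in> carrier E" "u' \<in> carrier E" "n \<in> carrier N" using sub that by auto
    have "(n \<oplus>\<^bsub>N\<^esub> \<ominus>\<^bsub>N\<^esub> n, u \<oplus>\<^bsub>E\<^esub> \<ominus>\<^bsub>E\<^esub> u') \<in> \<Gamma>" using add neg that by blast
    then have "u \<oplus>\<^bsub>E\<^esub> \<ominus>\<^bsub>E\<^esub> u' = \<zero>\<^bsub>E\<^esub>" using zero c by (simp add: N.M.r_neg)
    then show ?thesis using c E.M.add.inv_equality E.M.minus_equality E.M.minus_minus by fastforce
  qed
  have zin: "(\<zero>\<^bsub>N\<^esub>, \<zero>\<^bsub>E\<^esub>) \<in> \<Gamma>" using ext f0 g0 by force
  have dom: "y \<in> fst ` \<Gamma>" if y: "y \<in> carrier N" for y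
  proof -
    \<comment> \<open>The scalars that move \<open>y\<close> into the domain of
      \<open>\<Gamma>\<close>, with the values that \<open>\<Gamma>\<close> forces there. Baer's
      condition turns these values into multiples of a single \<open>e\<close>, the value to be
      assigned to \<open>y\<close>.\<close>
    define J where "J = {a \<in> carrier B. \<exists>u. (a \<odot>\<^bsub>N\<^esub> y, u) \<in> \<Gamma>}"
    define \<phi> where "\<phi> a = (THE u. (a \<odot>\<^bsub>N\<^esub> y, u) \<in> \<Gamma>)" for a
    have \<phi>: "(a \<odot>\<^bsub>N\<^esub> y, \<phi> a) \<in> \<Gamma>" if a: "a \<in> J" for a
    proof -
      obtain u where "(a \<odot>\<^bsub>N\<^esub> y, u) \<in> \<Gamma>" using a by (auto simp: J_def)
      then show ?thesis unfolding \<phi>_def by (rule theI) (use uniq \<open>(a \<odot>\<^bsub>N\<^esub> y, u) \<in> \<Gamma>\<close> in blast)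
    qed
    have \<phi>I: "a \<in> J \<and> \<phi> a = u" if "a \<in> carrier B" "(a \<odot>\<^bsub>N\<^esub> y, u) \<in> \<Gamma>" for a u
      using that \<phi>[of a] uniq by (force simp: J_def)
    have J: "ideal J B"
    proof (rule idealI)
      show "subgroup J (add_monoid B)"
      proof (rule E.R.add.subgroupI)
        show "J \<subseteq> carrier B" by (auto simp: J_def)
        show "J \<noteq> {}" using \<phi>I[of "\<zero>\<^bsub>B\<^esub>" "\<zero>\<^bsub>E\<^esub>"] zin y by auto
      next
        fix a assume a: "a \<in> J"
        show "\<ominus>\<^bsub>B\<^esub> a \<in> J" using neg[OF \<phi>[OF a]] a y \<phi>I[of "\<ominus>\<^bsub>B\<^esub> a"]
          by (auto simp: N.smult_l_minus J_def)
      next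
        fix a b assume a: "a \<in> J" and b: "b \<in> J"
        then show "a \<oplus>\<^bsub>B\<^esub> b \<in> J"
          using add[OF \<phi>[OF a] \<phi>[OF b]] y \<phi>I[of "a \<oplus>\<^bsub>B\<^esub> b"] by (auto simp: N.smult_l_distr J_def)
      qed
      fix a x assume a: "a \<in> J" and x: "x \<in> carrier B"
      show "x \<otimes>\<^bsub>B\<^esub> a \<in> J" using smult[OF x \<phi>[OF a]] a x y \<phi>I[of "x \<otimes>\<^bsub>B\<^esub> a"]
        by (auto simp: N.smult_assoc1 J_def)
      then show "a \<otimes>\<^bsub>B\<^esub> x \<in> J" using a x by (simp add: J_def E.R.m_comm)
    qed (rule E.R.ring_axioms)
    have Jc: "a \<in> J \<Longrightarrow> a \<in> carrier B" for a by (simp add: J_def)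
    have "\<exists>e\<in>carrier E. \<forall>a\<in>J. \<phi> a = a \<odot>\<^bsub>E\<^esub> e"
    proof (rule baerD[OF baer J])
      show "\<phi> a \<in> carrier E" if "a \<in> J" for a using \<phi>[OF that] sub by auto
      show "\<phi> (a \<oplus>\<^bsub>B\<^esub> b) = \<phi> a \<oplus>\<^bsub>E\<^esub> \<phi> b" if "a \<in> J" "b \<in> J" for a b
        using add[OF \<phi>[OF that(1)] \<phi>[OF that(2)]] that y \<phi>I[of "a \<oplus>\<^bsub>B\<^esub> b"]
        by (auto simp: N.smult_l_distr J_def)
      show "\<phi> (r \<otimes>\<^bsub>B\<^esub> a) = r \<odot>\<^bsub>E\<^esub> \<phi> a" if "r \<in> carrier B" "a \<in> J" for r a
        using smult[OF that(1) \<phi>[OF that(2)]] that y \<phi>I[of "r \<otimes>\<^bsub>B\<^esub> a"]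
        by (auto simp: N.smult_assoc1 J_def)
    qed
    then obtain e where e: "e \<in> carrier E" "\<And>a. a \<in> J \<Longrightarrow> \<phi> a = a \<odot>\<^bsub>E\<^esub> e" by blast
    define \<Gamma>' where "\<Gamma>' = {(n \<oplus>\<^bsub>N\<^esub> a \<odot>\<^bsub>N\<^esub> y, u \<oplus>\<^bsub>E\<^esub> a \<odot>\<^bsub>E\<^esub> e) | n u a. (n, u) \<in> \<Gamma> \<and> a \<in> carrier B}"
    have \<Gamma>'I: "(n \<oplus>\<^bsub>N\<^esub> a \<odot>\<^bsub>N\<^esub> y, u \<oplus>\<^bsub>E\<^esub> a \<odot>\<^bsub>E\<^esub> e) \<in> \<Gamma>'" if "(n, u) \<in> \<Gamma>" "a \<in> carrier B" for n u a
      using that by (auto simp: \<Gamma>'_def)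
    have le: "\<Gamma> \<subseteq> \<Gamma>'"
    proof
      fix x assume "x \<in> \<Gamma>"
      then show "x \<in> \<Gamma>'" using \<Gamma>'I[of "fst x" "snd x" "\<zero>\<^bsub>B\<^esub>"] sub y e by (auto simp: mem_Times_iff)
    qed
    have "\<Gamma>' \<in> Q"
      unfolding Q_def
    proof (intro CollectI conjI allI impI)
      show "\<Gamma>' \<subseteq> carrier N \<times> carrier E" using sub y e by (force simp: \<Gamma>'_def)
      show "(\<lambda>x. (f x, g x)) ` carrier M \<subseteq> \<Gamma>'" using le ext by blast
    next
      fix n u n' u' assume "(n, u) \<in> \<Gamma>'" "(n', u') \<in> \<Gamma>'"
      then obtain n1 u1 a1 n2 u2 a2 where 1: "(n1, u1) \<in> \<Gamma>" "(n2, u2) \<in> \<Gamma>" "a1 \<in> carrier B" "a2 \<in> carrier B"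
        "n = n1 \<oplus>\<^bsub>N\<^esub> a1 \<odot>\<^bsub>N\<^esub> y" "u = u1 \<oplus>\<^bsub>E\<^esub> a1 \<odot>\<^bsub>E\<^esub> e" "n' = n2 \<oplus>\<^bsub>N\<^esub> a2 \<odot>\<^bsub>N\<^esub> y" "u' = u2 \<oplus>\<^bsub>E\<^esub> a2 \<odot>\<^bsub>E\<^esub> e"
        by (auto simp: \<Gamma>'_def)
      then have c: "n1 \<in> carrier N" "n2 \<in> carrier N" "u1 \<in> carrier E" "u2 \<in> carrier E" using sub by auto
      have "n \<oplus>\<^bsub>N\<^esub> n' = (n1 \<oplus>\<^bsub>N\<^esub> n2) \<oplus>\<^bsub>N\<^esub> (a1 \<oplus>\<^bsub>B\<^esub> a2) \<odot>\<^bsub>N\<^esub> y"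
        using 1 c y by (simp add: N.smult_l_distr N.M.a_ac)
      moreover have "u \<oplus>\<^bsub>E\<^esub> u' = (u1 \<oplus>\<^bsub>E\<^esub> u2) \<oplus>\<^bsub>E\<^esub> (a1 \<oplus>\<^bsub>B\<^esub> a2) \<odot>\<^bsub>E\<^esub> e"
        using 1 c e by (simp add: E.smult_l_distr E.M.a_ac)
      ultimately show "(n \<oplus>\<^bsub>N\<^esub> n', u \<oplus>\<^bsub>E\<^esub> u') \<in> \<Gamma>'"
        using \<Gamma>'I[OF add[OF 1(1,2)], of "a1 \<oplus>\<^bsub>B\<^esub> a2"] 1 by auto
    next
      fix r n u assume r: "r \<in> carrier B" and "(n, u) \<in> \<Gamma>'"
      then obtain n1 u1 a1 where 1: "(n1, u1) \<in> \<Gamma>" "a1 \<in> carrier B"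
        "n = n1 \<oplus>\<^bsub>N\<^esub> a1 \<odot>\<^bsub>N\<^esub> y" "u = u1 \<oplus>\<^bsub>E\<^esub> a1 \<odot>\<^bsub>E\<^esub> e"
        by (auto simp: \<Gamma>'_def)
      then have c: "n1 \<in> carrier N" "u1 \<in> carrier E" using sub by auto
      show "(r \<odot>\<^bsub>N\<^esub> n, r \<odot>\<^bsub>E\<^esub> u) \<in> \<Gamma>'"
        using \<Gamma>'I[OF smult[OF r 1(1)], of "r \<otimes>\<^bsub>B\<^esub> a1"] 1 r c y e
        by (simp add: N.smult_r_distr E.smult_r_distr N.smult_assoc1 E.smult_assoc1)
    next
      fix u assume "(\<zero>\<^bsub>N\<^esub>, u) \<in> \<Gamma>'"
      then obtain n1 u1 a1 where 1: "(n1, u1) \<in> \<Gamma>" "a1 \<in> carrier B"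
        "\<zero>\<^bsub>N\<^esub> = n1 \<oplus>\<^bsub>N\<^esub> a1 \<odot>\<^bsub>N\<^esub> y" "u = u1 \<oplus>\<^bsub>E\<^esub> a1 \<odot>\<^bsub>E\<^esub> e"
        by (auto simp: \<Gamma>'_def)
      then have c: "n1 \<in> carrier N" "u1 \<in> carrier E" using sub by auto
      \<comment> \<open>The extension to the domain enlarged by \<open>B y\<close> is well defined:
        a relation between \<open>n1\<close> and \<open>a1 \<odot> y\<close> puts \<open>a1\<close>
        into \<open>J\<close>, where the multiple of \<open>e\<close> is the value already forced by
        \<open>\<Gamma>\<close>.\<close>
      then have "a1 \<odot>\<^bsub>N\<^esub> y = \<ominus>\<^bsub>N\<^esub> n1" using 1 y
        by (metis N.M.a_comm N.M.minus_equality N.smult_closed)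
      then have "(a1 \<odot>\<^bsub>N\<^esub> y, \<ominus>\<^bsub>E\<^esub> u1) \<in> \<Gamma>" using neg[OF 1(1)] by simp
      then have "a1 \<odot>\<^bsub>E\<^esub> e = \<ominus>\<^bsub>E\<^esub> u1" using \<phi>I[OF 1(2)] e(2)[of a1] by metis
      then show "u = \<zero>\<^bsub>E\<^esub>" using 1 c by (simp add: E.M.r_neg)
    qed
    then have "\<Gamma>' = \<Gamma>" using max le by blast
    moreover have "(y, e) \<in> \<Gamma>'" using \<Gamma>'I[OF zin, of "\<one>\<^bsub>B\<^esub>"] y e by simp
    ultimately show ?thesis by force
  qed
  define h where "h n = (THE u. (n, u) \<in> \<Gamma>)" for n
  have h: "(n, h n) \<in> \<Gamma>" if n: "n \<in> carrier N" for n
  proof -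
    obtain u where "(n, u) \<in> \<Gamma>" using dom[OF n] by auto
    then show ?thesis unfolding h_def by (rule theI) (use uniq \<open>(n, u) \<in> \<Gamma>\<close> in blast)
  qed
  have hI: "h n = u" if "(n, u) \<in> \<Gamma>" for n u using that h[of n] uniq sub by blast
  show "\<exists>h\<in>module_homs B N E. \<forall>x\<in>carrier M. h (f x) = g x"
  proof (rule bexI[of _ h])
    show "\<forall>x\<in>carrier M. h (f x) = g x" using ext hI by force
    show "h \<in> module_homs B N E"
    proof (rule module_homsI)
      show "h x \<in> carrier E" if "x \<in> carrier N" for x using h[OF that] sub by blast
      show "h (x \<oplus>\<^bsub>N\<^esub> y) = h x \<oplus>\<^bsub>E\<^esub> h y" if "x \<in> carrier N" "y \<in> carrier N" for x y
        by (rule hI[OF add[OF h[OF that(1)] h[OF that(2)]]])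
      show "h (a \<odot>\<^bsub>N\<^esub> x) = a \<odot>\<^bsub>E\<^esub> h x" if "a \<in> carrier B" "x \<in> carrier N" for a x
        by (rule hI[OF smult[OF that(1) h[OF that(2)]]])
    qed
  qed
qed

section \<open>Finite injective dimension\<close>

definition mk_module :: "'b set \<Rightarrow> 'b \<Rightarrow> ('b \<Rightarrow> 'b \<Rightarrow> 'b) \<Rightarrow> ('a \<Rightarrow> 'b \<Rightarrow> 'b) \<Rightarrow> ('a, 'b) module" where
  "mk_module C z p s = \<lparr>carrier = C, monoid.mult = (\<lambda>x y. x), one = z, ring.zero = z,
     ring.add = p, module.smult = s\<rparr>"

lemma module_homs_zero:
  assumes "Module.module A M" "Module.module A N" "f \<in> module_homs A M N"
  shows "f \<zero>\<^bsub>M\<^esub> = \<zero>\<^bsub>N\<^esub>"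
proof -
  interpret M: Module.module A M by fact
  interpret N: Module.module A N by fact
  show ?thesis
    using module_homsD(2)[OF assms(3), of "\<zero>\<^bsub>M\<^esub>" "\<zero>\<^bsub>M\<^esub>"] module_homsD(1)[OF assms(3), of "\<zero>\<^bsub>M\<^esub>"] by simp
qed

lemma module_homs_minus:
  assumes "Module.module A M" "Module.module A N" "f \<in> module_homs A M N"
    and x: "x \<in> carrier M" and y: "y \<in> carrier M"
  shows "f (x \<ominus>\<^bsub>M\<^esub> y) = f x \<ominus>\<^bsub>N\<^esub> f y"
proof -
  interpret M: Module.module A M by fact
  interpret N: Module.module A N by fact
  note fD = module_homsD[OF assms(3)]
  have "f (\<ominus>\<^bsub>M\<^esub> y) = f ((\<ominus>\<^bsub>A\<^esub> \<one>\<^bsub>A\<^esub>) \<odot>\<^bsub>M\<^esub> y)" using y by (simp add: M.smult_l_minus)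
  also have "\<dots> = \<ominus>\<^bsub>N\<^esub> f y" using y fD(1) by (simp add: fD(3) N.smult_l_minus)
  finally show ?thesis using x y by (simp add: a_minus_def fD(2))
qed

lemma a_kernel_iff: "x \<in> a_kernel M N f \<longleftrightarrow> x \<in> carrier M \<and> f x = \<zero>\<^bsub>N\<^esub>"
  by (simp add: a_kernel_def kernel_def)

lemma ring_as_module_simps [simp]:
  "carrier (ring_as_module B) = carrier B"
  "\<zero>\<^bsub>ring_as_module B\<^esub> = \<zero>\<^bsub>B\<^esub>"
  "x \<oplus>\<^bsub>ring_as_module B\<^esub> y = x \<oplus>\<^bsub>B\<^esub> y"
  "x \<odot>\<^bsub>ring_as_module B\<^esub> y = x \<otimes>\<^bsub>B\<^esub> y"
  by (simp_all add: ring_as_module_def)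

text \<open>A self-injective ring is its own injective resolution, of length zero. The map
  \<open>j\<close> merely transports it, followed by zero modules, to the type prescribed for
  resolutions.\<close>

lemma baer_self_imp_finite_self_injective_dimension:
  fixes B :: "'a ring"
  assumes B: "cring B" and baer: "baer B (ring_as_module B)"
  shows "finite_self_injective_dimension B"
proof -
  interpret cring B by fact
  define j :: "'a \<Rightarrow> (nat \<times> 'a) set" where "j x = {(0, x)}" for x
  have inj: "inj j" by (auto simp: j_def inj_on_def)
  then have [simp]: "inv_into UNIV j (j x) = x" for x by simp
  define E where "E i = submodule_copy B (if i = 0 then carrier B else {\<zero>\<^bsub>B\<^esub>}) j" for i :: nat
  have mod: "Module.module B (E i)" for i
    unfolding E_def using submodule_copy_module[OF B _ inj] oneideal zeroideal by simp
  have "baer B (E 0)"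
  proof (rule baerI)
    fix J \<phi> assume J: "ideal J B" and \<phi>: "\<And>a. a \<in> J \<Longrightarrow> \<phi> a \<in> carrier (E 0)"
     "\<And>a b. a \<in> J \<Longrightarrow> b \<in> J \<Longrightarrow> \<phi> (a \<oplus>\<^bsub>B\<^esub> b) = \<phi> a \<oplus>\<^bsub>E 0\<^esub> \<phi> b"
     "\<And>r a. r \<in> carrier B \<Longrightarrow> a \<in> J \<Longrightarrow> \<phi> (r \<otimes>\<^bsub>B\<^esub> a) = r \<odot>\<^bsub>E 0\<^esub> \<phi> a"
    have ex: "\<exists>x\<in>carrier B. \<phi> a = j x" if "a \<in> J" for a
      using \<phi>(1)[OF that] by (auto simp: E_def submodule_copy_def)
    define \<psi> where "\<psi> a = inv_into UNIV j (\<phi> a)" for a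
    have \<psi>: "\<psi> a \<in> carrier B" "\<phi> a = j (\<psi> a)" if a: "a \<in> J" for a
    proof -
      obtain x where "x \<in> carrier B" "\<phi> a = j x" using ex[OF a] by blast
      then show "\<psi> a \<in> carrier B" "\<phi> a = j (\<psi> a)" by (simp_all add: \<psi>_def)
    qed
    have "\<exists>e\<in>carrier (ring_as_module B). \<forall>a\<in>J. \<psi> a = a \<odot>\<^bsub>ring_as_module B\<^esub> e"
    proof (rule baerD[OF baer J])
      show "\<psi> a \<in> carrier (ring_as_module B)" if "a \<in> J" for a using \<psi>[OF that] by simp
      show "\<psi> (a \<oplus>\<^bsub>B\<^esub> b) = \<psi> a \<oplus>\<^bsub>ring_as_module B\<^esub> \<psi> b" if "a \<in> J" "b \<in> J" for a b
        using \<phi>(2)[OF that] \<psi>[OF that(1)] \<psi>[OF that(2)]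
        by (simp add: \<psi>_def[of "a \<oplus>\<^bsub>B\<^esub> b"] E_def submodule_copy_def)
      show "\<psi> (r \<otimes>\<^bsub>B\<^esub> a) = r \<odot>\<^bsub>ring_as_module B\<^esub> \<psi> a" if "r \<in> carrier B" "a \<in> J" for r a
        using \<phi>(3)[OF that] \<psi>[OF that(2)]
        by (simp add: \<psi>_def[of "r \<otimes>\<^bsub>B\<^esub> a"] E_def submodule_copy_def)
    qed
    then obtain e where e: "e \<in> carrier B" "\<And>a. a \<in> J \<Longrightarrow> \<psi> a = a \<otimes>\<^bsub>B\<^esub> e" by auto
    have "\<phi> a = a \<odot>\<^bsub>E 0\<^esub> j e" if "a \<in> J" for a
      unfolding \<psi>(2)[OF that] e(2)[OF that] by (simp add: E_def submodule_copy_def)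
    then show "\<exists>e\<in>carrier (E 0). \<forall>a\<in>J. \<phi> a = a \<odot>\<^bsub>E 0\<^esub> e"
      using e(1) by (intro bexI[of _ "j e"]) (auto simp: E_def submodule_copy_def)
  qed
  moreover have "baer B (E i)" if "i \<noteq> 0" for i
  proof (rule baerI)
    fix J \<phi> assume J: "ideal J B" and \<phi>: "\<And>a. a \<in> J \<Longrightarrow> \<phi> a \<in> carrier (E i)"
    interpret J: ideal J B by fact
    show "\<exists>e\<in>carrier (E i). \<forall>a\<in>J. \<phi> a = a \<odot>\<^bsub>E i\<^esub> e"
      using \<phi> J.a_subset that by (intro bexI[of _ "j \<zero>\<^bsub>B\<^esub>"]) (auto simp: E_def submodule_copy_def subset_iff)
  qed
  ultimately have injm: "injective_module B (E i)" for i
    using baer_imp_injective_module[OF mod] by (cases "i = 0") auto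
  have "injective_resolution B (ring_as_module B) E j (\<lambda>_ _. j \<zero>\<^bsub>B\<^esub>)"
    unfolding injective_resolution_def
  proof (intro conjI allI injm)
    show "j \<in> module_homs B (ring_as_module B) (E 0)"
      by (rule module_homsI) (auto simp: E_def submodule_copy_def)
    show "(\<lambda>_. j \<zero>\<^bsub>B\<^esub>) \<in> module_homs B (E i) (E (Suc i))" for i
      by (rule module_homsI) (auto simp: E_def submodule_copy_def)
    show "inj_on j (carrier (ring_as_module B))" using inj inj_on_subset by blast
    show "j ` carrier (ring_as_module B) = a_kernel (E 0) (E 1) (\<lambda>_. j \<zero>\<^bsub>B\<^esub>)"
      by (simp add: a_kernel_def' E_def submodule_copy_def)
    have "carrier B \<noteq> {}" using zero_closed by blast
    then show "(\<lambda>_. j \<zero>\<^bsub>B\<^esub>) ` carrier (E i) = a_kernel (E (Suc i)) (E (Suc (Suc i))) (\<lambda>_. j \<zero>\<^bsub>B\<^esub>)" for i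
      by (simp add: a_kernel_def' E_def submodule_copy_def image_image image_constant_conv)
  qed
  moreover have "\<forall>i>0. carrier (E i) = {\<zero>\<^bsub>E i\<^esub>}" by (auto simp: E_def submodule_copy_def)
  ultimately show ?thesis unfolding finite_self_injective_dimension_def by blast
qed

text \<open>The hypotheses on \<open>\<kappa>\<close> say that it induces a homomorphism from the ideal \<open>m\<close> to \<open>B / m\<close> with
  \<open>w \<mapsto> 1\<close>. As \<open>m w = 0\<close>, it exhibits \<open>B / m\<close> as a direct summand of its own first syzygy \<open>m\<close>, so the
  vanishing of \<open>Ext\<^sup>i\<^sup>+\<^sup>1(B / m, B)\<close> forces that of \<open>Ext\<^sup>i(B / m, B)\<close>, down to \<open>i = 1\<close>.\<close>

lemma finite_self_injective_dimension_extends_socle_map: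
  fixes B :: "'a ring"
  assumes fin: "finite_self_injective_dimension B" and m: "ideal m B" and w: "w \<in> m"
    and mw: "\<And>a. a \<in> m \<Longrightarrow> a \<otimes>\<^bsub>B\<^esub> w = \<zero>\<^bsub>B\<^esub>"
    and \<kappa>: "\<And>a. a \<in> m \<Longrightarrow> \<kappa> a \<in> carrier B"
    and \<kappa>_add: "\<And>a b. a \<in> m \<Longrightarrow> b \<in> m \<Longrightarrow> \<kappa> (a \<oplus>\<^bsub>B\<^esub> b) \<ominus>\<^bsub>B\<^esub> (\<kappa> a \<oplus>\<^bsub>B\<^esub> \<kappa> b) \<in> m"
    and \<kappa>_mult: "\<And>r a. r \<in> carrier B \<Longrightarrow> a \<in> m \<Longrightarrow> \<kappa> (r \<otimes>\<^bsub>B\<^esub> a) \<ominus>\<^bsub>B\<^esub> (r \<otimes>\<^bsub>B\<^esub> \<kappa> a) \<in> m"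
    and \<kappa>_w: "\<kappa> w \<ominus>\<^bsub>B\<^esub> \<one>\<^bsub>B\<^esub> \<in> m"
  shows "\<exists>b\<in>carrier B. \<forall>a\<in>m. a \<otimes>\<^bsub>B\<^esub> b = \<kappa> a \<otimes>\<^bsub>B\<^esub> w"
proof -
  obtain E :: "nat \<Rightarrow> ('a, (nat \<times> 'a) set) module" and \<epsilon> \<delta> n where
    res: "injective_resolution B (ring_as_module B) E \<epsilon> \<delta>" and
    van: "\<And>i. i > n \<Longrightarrow> carrier (E i) = {\<zero>\<^bsub>E i\<^esub>}"
    using fin unfolding finite_self_injective_dimension_def by blast
  have injm: "injective_module B (E i)" and \<epsilon>: "\<epsilon> \<in> module_homs B (ring_as_module B) (E 0)"
    and \<delta>: "\<delta> i \<in> module_homs B (E i) (E (Suc i))" and inj: "inj_on \<epsilon> (carrier B)"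
    and ex0: "\<epsilon> ` carrier B = a_kernel (E 0) (E 1) (\<delta> 0)"
    and ex: "\<delta> i ` carrier (E i) = a_kernel (E (Suc i)) (E (Suc (Suc i))) (\<delta> (Suc i))" for i
    using res by (auto simp: injective_resolution_def)
  have mod: "Module.module B (E i)" for i using injm[of i] by (simp add: injective_module_def)
  have baer: "baer B (E i)" for i
    by (rule injective_module_imp_baer[OF injm, where j = "\<lambda>x. {(0, x)}"]) (auto simp: inj_on_def)
  interpret E: Module.module B "E i" for i by (rule mod)
  interpret m: ideal m B by (rule m)
  have mc: "a \<in> m \<Longrightarrow> a \<in> carrier B" for a using m.a_subset by auto
  \<comment> \<open>On elements killed by \<open>m\<close> scalars matter only modulo
    \<open>m\<close>. This is why it suffices that \<open>\<kappa>\<close> be additive and linear up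
    to \<open>m\<close>.\<close>
  have cong: "c \<odot>\<^bsub>E i\<^esub> z = d \<odot>\<^bsub>E i\<^esub> z"
    if z: "z \<in> carrier (E i)" and soc: "\<And>a. a \<in> m \<Longrightarrow> a \<odot>\<^bsub>E i\<^esub> z = \<zero>\<^bsub>E i\<^esub>" and c: "c \<in> carrier B" and d: "d \<in> carrier B"
      and cd: "c \<ominus>\<^bsub>B\<^esub> d \<in> m" for i c d z
  proof -
    have "c = (c \<ominus>\<^bsub>B\<^esub> d) \<oplus>\<^bsub>B\<^esub> d" using c d by algebra
    then have "c \<odot>\<^bsub>E i\<^esub> z = ((c \<ominus>\<^bsub>B\<^esub> d) \<oplus>\<^bsub>B\<^esub> d) \<odot>\<^bsub>E i\<^esub> z" by simp
    also have "\<dots> = d \<odot>\<^bsub>E i\<^esub> z"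
      using z c d soc[OF cd] by (simp add: E.smult_l_distr)
    finally show ?thesis .
  qed
  have extend: "\<exists>e\<in>carrier (E i). \<forall>a\<in>m. \<kappa> a \<odot>\<^bsub>E i\<^esub> z = a \<odot>\<^bsub>E i\<^esub> e"
    if z: "z \<in> carrier (E i)" and soc: "\<And>a. a \<in> m \<Longrightarrow> a \<odot>\<^bsub>E i\<^esub> z = \<zero>\<^bsub>E i\<^esub>" for i z
  proof (rule baerD[OF baer m])
    show "\<kappa> a \<odot>\<^bsub>E i\<^esub> z \<in> carrier (E i)" if "a \<in> m" for a using \<kappa>[OF that] z by simp
    show "\<kappa> (a \<oplus>\<^bsub>B\<^esub> b) \<odot>\<^bsub>E i\<^esub> z = \<kappa> a \<odot>\<^bsub>E i\<^esub> z \<oplus>\<^bsub>E i\<^esub> \<kappa> b \<odot>\<^bsub>E i\<^esub> z" if "a \<in> m" "b \<in> m" for a b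
      using cong[OF z soc _ _ \<kappa>_add[OF that]] \<kappa> that z by (simp add: E.smult_l_distr)
    show "\<kappa> (r \<otimes>\<^bsub>B\<^esub> a) \<odot>\<^bsub>E i\<^esub> z = r \<odot>\<^bsub>E i\<^esub> (\<kappa> a \<odot>\<^bsub>E i\<^esub> z)" if "r \<in> carrier B" "a \<in> m" for r a
      using cong[OF z soc _ _ \<kappa>_mult[OF that]] \<kappa> that z by (simp add: E.smult_assoc1 m.I_l_closed)
  qed
  note \<delta>D = module_homsD[OF \<delta>]
  \<comment> \<open>\<open>P i\<close> expresses that
    \<open>Ext\<^sup>i\<^sup>+\<^sup>1(B / m, B)\<close> vanishes, computed from the complex of the
    submodules killed by \<open>m\<close>.\<close>
  define P where "P i \<longleftrightarrow> (\<forall>z\<in>carrier (E (Suc i)). \<delta> (Suc i) z = \<zero>\<^bsub>E (Suc (Suc i))\<^esub> \<longrightarrow>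
    (\<forall>a\<in>m. a \<odot>\<^bsub>E (Suc i)\<^esub> z = \<zero>\<^bsub>E (Suc i)\<^esub>) \<longrightarrow>
    (\<exists>f\<in>carrier (E i). (\<forall>a\<in>m. a \<odot>\<^bsub>E i\<^esub> f = \<zero>\<^bsub>E i\<^esub>) \<and> \<delta> i f = z))" for i
  \<comment> \<open>Injectivity gives some \<open>e\<close> that represents
    \<open>a \<mapsto> \<kappa> a \<odot> z\<close>. Its coboundary is a cocycle killed by
    \<open>m\<close>, so \<open>P i\<close> provides a correction \<open>e'\<close> that is itself
    killed by \<open>m\<close>; subtracting it makes \<open>e\<close> a cocycle without changing its
    products with \<open>m\<close>.\<close>
  have correct: "\<exists>e\<in>carrier (E i). \<delta> i e = \<zero>\<^bsub>E (Suc i)\<^esub> \<and> (\<forall>a\<in>m. \<kappa> a \<odot>\<^bsub>E i\<^esub> z = a \<odot>\<^bsub>E i\<^esub> e)"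
    if z: "z \<in> carrier (E i)" and dz: "\<delta> i z = \<zero>\<^bsub>E (Suc i)\<^esub>"
      and soc: "\<And>a. a \<in> m \<Longrightarrow> a \<odot>\<^bsub>E i\<^esub> z = \<zero>\<^bsub>E i\<^esub>" and P: "P i" for i z
  proof -
    obtain e where e: "e \<in> carrier (E i)" "\<And>a. a \<in> m \<Longrightarrow> \<kappa> a \<odot>\<^bsub>E i\<^esub> z = a \<odot>\<^bsub>E i\<^esub> e"
      using extend[OF z soc] by blast
    have 1: "\<delta> i e \<in> carrier (E (Suc i))" using \<delta>D(1) e(1) by blast
    have 2: "\<delta> (Suc i) (\<delta> i e) = \<zero>\<^bsub>E (Suc (Suc i))\<^esub>"
      using imageI[OF e(1), of "\<delta> i"] unfolding ex a_kernel_iff by (rule conjunct2)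
    have 3: "a \<odot>\<^bsub>E (Suc i)\<^esub> \<delta> i e = \<zero>\<^bsub>E (Suc i)\<^esub>" if "a \<in> m" for a
    proof -
      have "a \<odot>\<^bsub>E (Suc i)\<^esub> \<delta> i e = \<delta> i (\<kappa> a \<odot>\<^bsub>E i\<^esub> z)" using e that mc by (simp add: \<delta>D)
      then show ?thesis using z \<kappa>[OF that] by (simp add: \<delta>D dz)
    qed
    have "\<exists>f\<in>carrier (E i). (\<forall>a\<in>m. a \<odot>\<^bsub>E i\<^esub> f = \<zero>\<^bsub>E i\<^esub>) \<and> \<delta> i f = \<delta> i e"
      using P[unfolded P_def, THEN bspec, OF 1, THEN mp, OF 2, THEN mp] 3 by simp
    then obtain e' where e': "e' \<in> carrier (E i)" "\<And>a. a \<in> m \<Longrightarrow> a \<odot>\<^bsub>E i\<^esub> e' = \<zero>\<^bsub>E i\<^esub>" "\<delta> i e' = \<delta> i e"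
      by blast
    show ?thesis
    proof (intro bexI conjI ballI)
      show "e \<ominus>\<^bsub>E i\<^esub> e' \<in> carrier (E i)" using e e' by simp
      show "\<delta> i (e \<ominus>\<^bsub>E i\<^esub> e') = \<zero>\<^bsub>E (Suc i)\<^esub>"
        using module_homs_minus[OF mod mod \<delta>, of e i e'] e(1) e' 1 by (simp add: a_minus_def E.M.r_neg)
      show "\<kappa> a \<odot>\<^bsub>E i\<^esub> z = a \<odot>\<^bsub>E i\<^esub> (e \<ominus>\<^bsub>E i\<^esub> e')" if "a \<in> m" for a
        using e e' that mc by (simp add: a_minus_def E.smult_r_distr E.smult_r_minus)
    qed
  qed
  have im: "e \<in> \<delta> i ` carrier (E i)" if "e \<in> carrier (E (Suc i))" "\<delta> (Suc i) e = \<zero>\<^bsub>E (Suc (Suc i))\<^esub>" for e i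
    using that by (simp add: ex a_kernel_iff)
  have step: "P i" if P: "P (Suc i)" for i
    unfolding P_def
  proof (intro ballI impI)
    fix z assume z: "z \<in> carrier (E (Suc i))" and dz: "\<delta> (Suc i) z = \<zero>\<^bsub>E (Suc (Suc i))\<^esub>"
      and soc: "\<forall>a\<in>m. a \<odot>\<^bsub>E (Suc i)\<^esub> z = \<zero>\<^bsub>E (Suc i)\<^esub>"
    obtain e where e: "e \<in> carrier (E (Suc i))" "\<delta> (Suc i) e = \<zero>\<^bsub>E (Suc (Suc i))\<^esub>"
      "\<And>a. a \<in> m \<Longrightarrow> \<kappa> a \<odot>\<^bsub>E (Suc i)\<^esub> z = a \<odot>\<^bsub>E (Suc i)\<^esub> e"
      using correct[OF z dz _ P] soc by blast
    \<comment> \<open>Now the summand generated by \<open>w\<close> is used: by exactness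
      \<open>e\<close> is the coboundary of \<open>f\<close>, the element \<open>w \<odot> f\<close>
      is killed by \<open>m\<close> because \<open>m w = 0\<close>, and its coboundary is
      \<open>w \<odot> e = \<kappa> w \<odot> z = z\<close>.\<close>
    then obtain f where f: "f \<in> carrier (E i)" "\<delta> i f = e"
      using im[of e i] by blast
    show "\<exists>f\<in>carrier (E i). (\<forall>a\<in>m. a \<odot>\<^bsub>E i\<^esub> f = \<zero>\<^bsub>E i\<^esub>) \<and> \<delta> i f = z"
    proof (intro bexI conjI ballI)
      show "w \<odot>\<^bsub>E i\<^esub> f \<in> carrier (E i)" using f w mc by simp
      show "a \<odot>\<^bsub>E i\<^esub> (w \<odot>\<^bsub>E i\<^esub> f) = \<zero>\<^bsub>E i\<^esub>" if "a \<in> m" for a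
        using E.smult_assoc1[of a w f i] f w mc that mw by simp
      have "\<delta> i (w \<odot>\<^bsub>E i\<^esub> f) = \<kappa> w \<odot>\<^bsub>E (Suc i)\<^esub> z" using f w mc e by (simp add: \<delta>D)
      also have "\<dots> = \<one>\<^bsub>B\<^esub> \<odot>\<^bsub>E (Suc i)\<^esub> z" using cong[OF z _ _ _ \<kappa>_w] soc \<kappa>[OF w] by simp
      finally show "\<delta> i (w \<odot>\<^bsub>E i\<^esub> f) = z" using z by simp
    qed
  qed
  have "P n"
    unfolding P_def
  proof (intro ballI impI)
    fix z assume "z \<in> carrier (E (Suc n))"
    then have "z = \<zero>\<^bsub>E (Suc n)\<^esub>" using van[of "Suc n"] by auto
    then show "\<exists>f\<in>carrier (E n). (\<forall>a\<in>m. a \<odot>\<^bsub>E n\<^esub> f = \<zero>\<^bsub>E n\<^esub>) \<and> \<delta> n f = z"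
      using module_homs_zero[OF mod mod \<delta>] mc by (intro bexI[of _ "\<zero>\<^bsub>E n\<^esub>"]) auto
  qed
  then have P0: "P 0" by (rule inc_induct[of 0 n P, OF le0]) (rule step)
  note \<epsilon>D = module_homsD[OF \<epsilon>, simplified]
  have ker0: "e \<in> \<epsilon> ` carrier B \<longleftrightarrow> e \<in> carrier (E 0) \<and> \<delta> 0 e = \<zero>\<^bsub>E (Suc 0)\<^esub>" for e
    using ex0 by (simp add: a_kernel_iff)
  have \<epsilon>0: "\<epsilon> \<zero>\<^bsub>B\<^esub> = \<zero>\<^bsub>E 0\<^esub>" using \<epsilon>D(2)[of "\<zero>\<^bsub>B\<^esub>" "\<zero>\<^bsub>B\<^esub>"] \<epsilon>D(1)[of "\<zero>\<^bsub>B\<^esub>"] by simp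
  \<comment> \<open>The same correction at the start of the resolution, for the class of
    \<open>a \<mapsto> \<kappa> a \<otimes> w\<close>: a cocycle in \<open>E 0\<close> comes from an
    element of \<open>B\<close>, which is the desired \<open>b\<close>.\<close>
  have "\<exists>e\<in>carrier (E 0). \<delta> 0 e = \<zero>\<^bsub>E (Suc 0)\<^esub> \<and> (\<forall>a\<in>m. \<kappa> a \<odot>\<^bsub>E 0\<^esub> \<epsilon> w = a \<odot>\<^bsub>E 0\<^esub> e)"
  proof (rule correct[OF _ _ _ P0])
    show "\<epsilon> w \<in> carrier (E 0)" using \<epsilon>D(1) w mc by blast
    show "\<delta> 0 (\<epsilon> w) = \<zero>\<^bsub>E (Suc 0)\<^esub>" using ker0 w mc by blast
    show "a \<odot>\<^bsub>E 0\<^esub> \<epsilon> w = \<zero>\<^bsub>E 0\<^esub>" if "a \<in> m" for a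
      using \<epsilon>D(3)[of a w] that w mc mw \<epsilon>0 by simp
  qed
  then obtain e where e: "e \<in> carrier (E 0)" "\<delta> 0 e = \<zero>\<^bsub>E (Suc 0)\<^esub>" "\<And>a. a \<in> m \<Longrightarrow> \<kappa> a \<odot>\<^bsub>E 0\<^esub> \<epsilon> w = a \<odot>\<^bsub>E 0\<^esub> e"
    by blast
  then obtain b where b: "b \<in> carrier B" "e = \<epsilon> b" using ker0 by blast
  have "a \<otimes>\<^bsub>B\<^esub> b = \<kappa> a \<otimes>\<^bsub>B\<^esub> w" if "a \<in> m" for a
  proof (rule inj_onD[OF inj])
    show "\<epsilon> (a \<otimes>\<^bsub>B\<^esub> b) = \<epsilon> (\<kappa> a \<otimes>\<^bsub>B\<^esub> w)"
      using e(3)[OF that] b \<kappa>[OF that] w mc that by (simp add: \<epsilon>D)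
  qed (use that b w mc \<kappa> in auto)
  then show ?thesis using b by blast
qed

text \<open>The resolution is \<open>B \<rightarrow> F \<rightarrow> F / B \<rightarrow> 0\<close>
  with \<open>F\<close> the field \<open>'f\<close>. Since ideals are principal, Baer's condition
  for a quotient of \<open>F\<close> only asks to divide one value by the image of a generator. The
  injection \<open>j\<close> lets cosets of subgroups of \<open>F\<close> be represented as sets
  over \<open>nat \<times> 'a\<close>.\<close>

lemma finite_self_injective_dimension_in_field:
  fixes B :: "'a ring" and \<theta> :: "'a \<Rightarrow> 'f::field" and j :: "'f \<Rightarrow> 'a"
  assumes B: "cring B" and "inj j" and inj: "inj_on \<theta> (carrier B)"
    and \<theta>_add: "\<And>a b. a \<in> carrier B \<Longrightarrow> b \<in> carrier B \<Longrightarrow> \<theta> (a \<oplus>\<^bsub>B\<^esub> b) = \<theta> a + \<theta> b"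
    and \<theta>_mult: "\<And>a b. a \<in> carrier B \<Longrightarrow> b \<in> carrier B \<Longrightarrow> \<theta> (a \<otimes>\<^bsub>B\<^esub> b) = \<theta> a * \<theta> b"
    and \<theta>_one: "\<theta> \<one>\<^bsub>B\<^esub> = 1"
    and principal: "\<And>J. ideal J B \<Longrightarrow> \<exists>b\<in>J. \<forall>a\<in>J. \<exists>r\<in>carrier B. a = r \<otimes>\<^bsub>B\<^esub> b"
  shows "finite_self_injective_dimension B"
proof -
  interpret cring B by fact
  have \<theta>0: "\<theta> \<zero>\<^bsub>B\<^esub> = 0" using \<theta>_add[of "\<zero>\<^bsub>B\<^esub>" "\<zero>\<^bsub>B\<^esub>"]
    by (metis add_cancel_right_right l_zero zero_closed)
  have \<theta>neg: "\<theta> (\<ominus>\<^bsub>B\<^esub> \<one>\<^bsub>B\<^esub>) = - 1"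
    using \<theta>_add[of "\<ominus>\<^bsub>B\<^esub> \<one>\<^bsub>B\<^esub>" "\<one>\<^bsub>B\<^esub>"] by (simp add: \<theta>_one \<theta>0 l_neg eq_neg_iff_add_eq_0)
  \<comment> \<open>The submodules to be divided out, so that \<open>E i\<close> is
    \<open>F / U i\<close>: successively \<open>F\<close>, \<open>F / B\<close> and zero modules.
    \<open>q i\<close> is the coset map and \<open>r i\<close> selects a representative.\<close>
  define U where "U i = (if i = 0 then {0} else if i = 1 then \<theta> ` carrier B else UNIV)" for i :: nat
  have U0: "0 \<in> U i" for i using \<theta>0 by (auto simp: U_def image_iff intro!: bexI[of _ "\<zero>\<^bsub>B\<^esub>"])
  have U_add: "x + y \<in> U i" if "x \<in> U i" "y \<in> U i" for x y i
    using that by (auto simp: U_def simp flip: \<theta>_add split: if_splits)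
  have U_mult: "\<theta> a * x \<in> U i" if "a \<in> carrier B" "x \<in> U i" for a x i
    using that by (auto simp: U_def simp flip: \<theta>_mult split: if_splits)
  have U_minus: "- x \<in> U i" if "x \<in> U i" for x i using U_mult[OF _ that, of "\<ominus>\<^bsub>B\<^esub> \<one>\<^bsub>B\<^esub>"] \<theta>neg by simp
  define q :: "nat \<Rightarrow> 'f \<Rightarrow> (nat \<times> 'a) set" where "q i f = (\<lambda>g. (0, j g)) ` {g. g - f \<in> U i}" for i f
  have q_eq: "q i f = q i g \<longleftrightarrow> f - g \<in> U i" for i f g
  proof
    assume "q i f = q i g"
    then have "{h. h - f \<in> U i} = {h. h - g \<in> U i}"
      unfolding q_def using \<open>inj j\<close> by (subst (asm) inj_image_eq_iff) (auto simp: inj_on_def)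
    moreover have "f - f \<in> U i" using U0[of i] by simp
    ultimately show "f - g \<in> U i" by blast
  next
    assume fg: "f - g \<in> U i"
    have "h - f \<in> U i \<longleftrightarrow> h - g \<in> U i" for h
      using U_add[OF _ fg, of "h - f"] U_add[OF _ U_minus[OF fg], of "h - g"] by (auto simp: algebra_simps)
    then show "q i f = q i g" by (simp add: q_def)
  qed
  define r where "r i Y = (SOME f. q i f = Y)" for i Y
  have r: "r i (q i f) - f \<in> U i" for i f
    using someI[of "\<lambda>g. q i g = q i f" f] q_eq unfolding r_def by blast
  define E :: "nat \<Rightarrow> ('a, (nat \<times> 'a) set) module" where
    "E i = mk_module (range (q i)) (q i 0) (\<lambda>x y. q i (r i x + r i y)) (\<lambda>a x. q i (\<theta> a * r i x))" for i
  have add: "q i f \<oplus>\<^bsub>E i\<^esub> q i g = q i (f + g)" for i f g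
    using U_add[OF r r, of i f g] by (simp add: E_def mk_module_def q_eq algebra_simps)
  have smult: "a \<odot>\<^bsub>E i\<^esub> q i f = q i (\<theta> a * f)" if "a \<in> carrier B" for i a f
    using U_mult[OF that r, of i f] by (simp add: E_def mk_module_def q_eq algebra_simps)
  have zero: "\<zero>\<^bsub>E i\<^esub> = q i 0" and carr: "carrier (E i) = range (q i)" for i by (simp_all add: E_def mk_module_def)
  have mod: "Module.module B (E i)" for i
  proof (rule moduleI)
    show "abelian_group (E i)"
    proof (rule abelian_groupI)
      fix x assume "x \<in> carrier (E i)"
      then obtain f where "x = q i f" by (auto simp: carr)
      then show "\<exists>y\<in>carrier (E i). y \<oplus>\<^bsub>E i\<^esub> x = \<zero>\<^bsub>E i\<^esub>"
        by (intro bexI[of _ "q i (- f)"]) (simp_all add: add zero carr)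
    qed (auto simp: carr add zero algebra_simps)
  qed (auto simp: carr add zero smult \<theta>_add \<theta>_mult \<theta>_one algebra_simps B)
  have baer: "baer B (E i)" for i
  proof (rule baerI)
    fix J \<phi> assume J: "ideal J B" and \<phi>: "\<And>a. a \<in> J \<Longrightarrow> \<phi> a \<in> carrier (E i)"
     "\<And>r a. r \<in> carrier B \<Longrightarrow> a \<in> J \<Longrightarrow> \<phi> (r \<otimes>\<^bsub>B\<^esub> a) = r \<odot>\<^bsub>E i\<^esub> \<phi> a"
    interpret J: ideal J B by fact
    obtain b where b: "b \<in> J" "\<And>a. a \<in> J \<Longrightarrow> \<exists>r\<in>carrier B. a = r \<otimes>\<^bsub>B\<^esub> b" using principal[OF J] by blast
    have bc: "b \<in> carrier B" using b(1) J.a_subset by blast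
    obtain c where c: "\<phi> b = q i c" using \<phi>(1)[OF b(1)] by (auto simp: carr)
    show "\<exists>e\<in>carrier (E i). \<forall>a\<in>J. \<phi> a = a \<odot>\<^bsub>E i\<^esub> e"
    proof (intro bexI ballI)
      show "q i (c / \<theta> b) \<in> carrier (E i)" by (simp add: carr)
      fix a assume "a \<in> J"
      then obtain s where s: "s \<in> carrier B" "a = s \<otimes>\<^bsub>B\<^esub> b" using b(2) by blast
      show "\<phi> a = a \<odot>\<^bsub>E i\<^esub> q i (c / \<theta> b)"
      proof (cases "\<theta> b = 0")
        case True
        then have b0: "b = \<zero>\<^bsub>B\<^esub>" using inj_onD[OF inj, of b "\<zero>\<^bsub>B\<^esub>"] \<theta>0 bc by simp
        have "\<phi> (\<zero>\<^bsub>B\<^esub> \<otimes>\<^bsub>B\<^esub> b) = \<zero>\<^bsub>B\<^esub> \<odot>\<^bsub>E i\<^esub> \<phi> b" by (rule \<phi>(2)) (simp_all add: b)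
        then have "\<phi> \<zero>\<^bsub>B\<^esub> = q i 0" using b0 c by (simp add: smult \<theta>0)
        then show ?thesis using s b0 by (simp add: smult \<theta>0)
      next
        case False
        then show ?thesis using s b(1) bc c by (simp add: \<phi>(2) smult \<theta>_mult)
      qed
    qed
  qed
  define \<delta> :: "nat \<Rightarrow> (nat \<times> 'a) set \<Rightarrow> (nat \<times> 'a) set" where "\<delta> i Y = q (Suc i) (r i Y)" for i Y
  have \<delta>: "\<delta> i (q i f) = q (Suc i) f" for i f
  proof -
    have "U i \<subseteq> U (Suc i)" using U0[of "Suc i"] by (auto simp: U_def)
    then show ?thesis using r[of i f] by (auto simp: \<delta>_def q_eq)
  qed
  have inj0: "q 0 (\<theta> a) = q 0 (\<theta> b) \<longleftrightarrow> a = b" if "a \<in> carrier B" "b \<in> carrier B" for a b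
    using inj_on_eq_iff[OF inj that] by (simp add: q_eq U_def)
  have top: "q (Suc (Suc i)) f = q (Suc (Suc i)) g" for i f g by (simp add: q_eq U_def)
  have "injective_resolution B (ring_as_module B) E (\<lambda>b. q 0 (\<theta> b)) \<delta>"
    unfolding injective_resolution_def
  proof (intro conjI allI)
    show "injective_module B (E i)" for i by (rule baer_imp_injective_module[OF mod baer])
    show "(\<lambda>b. q 0 (\<theta> b)) \<in> module_homs B (ring_as_module B) (E 0)"
      by (rule module_homsI) (auto simp: carr add smult \<theta>_add \<theta>_mult)
    show "\<delta> i \<in> module_homs B (E i) (E (Suc i))" for i
      by (rule module_homsI) (auto simp: carr add smult \<delta>)
    show "inj_on (\<lambda>b. q 0 (\<theta> b)) (carrier (ring_as_module B))" by (auto intro!: inj_onI simp: inj0)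
    \<comment> \<open>The projection from \<open>F / U i\<close> to \<open>F / U (Suc i)\<close> has
      kernel \<open>U (Suc i) / U i\<close>. For \<open>i = 0\<close> this is the image of
      \<open>B\<close>; for larger \<open>i\<close> it is the whole module, matching the
      surjectivity of the preceding projection.\<close>
    have ker: "a_kernel (E i) (E (Suc i)) (\<delta> i) = q i ` U (Suc i)" for i
    proof -
      have "{x \<in> range (q i). \<delta> i x = q (Suc i) 0} = q i ` {f. \<delta> i (q i f) = q (Suc i) 0}" by blast
      then show ?thesis by (simp add: a_kernel_def' carr zero \<delta> q_eq)
    qed
    show "(\<lambda>b. q 0 (\<theta> b)) ` carrier (ring_as_module B) = a_kernel (E 0) (E 1) (\<delta> 0)"
      using ker[of 0] by (simp add: U_def image_image)
    show "\<delta> i ` carrier (E i) = a_kernel (E (Suc i)) (E (Suc (Suc i))) (\<delta> (Suc i))" for i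
      unfolding ker by (simp add: U_def carr image_image \<delta>)
  qed
  moreover have "\<forall>i>1. carrier (E i) = {\<zero>\<^bsub>E i\<^esub>}"
  proof (intro allI impI)
    fix i :: nat assume "i > 1"
    then have const: "q i f = q i 0" for f by (simp add: q_eq U_def)
    have "range (q i) = range (\<lambda>_::'f. q i 0)" by (intro image_cong refl const)
    then show "carrier (E i) = {\<zero>\<^bsub>E i\<^esub>}" by (simp add: carr zero)
  qed
  ultimately show ?thesis
    unfolding finite_self_injective_dimension_def by (intro exI conjI)
qed

section \<open>Localization at a prime\<close>

context
  fixes A :: "'a ring" and P :: "'a set"
  assumes A: "cring A" and P: "primeideal P A"
begin

interpretation cring A by (rule A)
interpretation P: primeideal P A by (rule P)

definition fraction :: "'a \<Rightarrow> 'a \<Rightarrow> ('a \<times> 'a) set" where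
  "fraction a s = localization_rel A P `` {(a, s)}"

lemma compl_one: "\<one>\<^bsub>A\<^esub> \<in> carrier A - P"
  using P.one_imp_carrier P.I_notcarr by auto

lemma compl_mult: "s \<in> carrier A - P \<Longrightarrow> t \<in> carrier A - P \<Longrightarrow> s \<otimes>\<^bsub>A\<^esub> t \<in> carrier A - P"
  using P.I_prime by auto

lemma compl_carrier: "s \<in> carrier A - P \<Longrightarrow> s \<in> carrier A" by simp

lemma localization_rel_iff:
  "((a, s), (b, t)) \<in> localization_rel A P \<longleftrightarrow> a \<in> carrier A \<and> b \<in> carrier A \<and>
     s \<in> carrier A - P \<and> t \<in> carrier A - P \<and>
     (\<exists>u\<in>carrier A - P. u \<otimes>\<^bsub>A\<^esub> (a \<otimes>\<^bsub>A\<^esub> t) = u \<otimes>\<^bsub>A\<^esub> (b \<otimes>\<^bsub>A\<^esub> s))"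
  by (auto simp: localization_rel_def)

lemma equiv_localization_rel: "equiv (carrier A \<times> (carrier A - P)) (localization_rel A P)"
proof (rule equivI)
  show "localization_rel A P \<subseteq> (carrier A \<times> (carrier A - P)) \<times> carrier A \<times> (carrier A - P)"
    by (auto simp: localization_rel_def)
  show "refl_on (carrier A \<times> (carrier A - P)) (localization_rel A P)"
    using compl_one by (auto simp: refl_on_def localization_rel_iff)
  show "sym (localization_rel A P)"
    by (rule symI) (auto simp: localization_rel_iff, metis DiffI)
  show "trans (localization_rel A P)"
  proof (rule transI)
    fix x y z assume xy: "(x, y) \<in> localization_rel A P" and yz: "(y, z) \<in> localization_rel A P"
    obtain a s b t c r where eq: "x = (a, s)" "y = (b, t)" "z = (c, r)" by (metis surj_pair)
    from xy eq obtain u where 1: "a \<in> carrier A" "b \<in> carrier A" "s \<in> carrier A - P" "t \<in> carrier A - P"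
      "u \<in> carrier A - P" "u \<otimes>\<^bsub>A\<^esub> (a \<otimes>\<^bsub>A\<^esub> t) = u \<otimes>\<^bsub>A\<^esub> (b \<otimes>\<^bsub>A\<^esub> s)"
      by (auto simp: localization_rel_iff)
    from yz eq obtain v where 2: "c \<in> carrier A" "r \<in> carrier A - P"
      "v \<in> carrier A - P" "v \<otimes>\<^bsub>A\<^esub> (b \<otimes>\<^bsub>A\<^esub> r) = v \<otimes>\<^bsub>A\<^esub> (c \<otimes>\<^bsub>A\<^esub> t)"
      by (auto simp: localization_rel_iff)
    note cc = 1(1,2) 2(1) 1(3,4,5)[THEN compl_carrier] 2(2,3)[THEN compl_carrier]
    \<comment> \<open>The multiplier for the composed relation is \<open>u v t\<close>: besides both
      given multipliers it contains the middle denominator, which cannot be cancelled when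
      \<open>A\<close> has zero divisors.\<close>
    have "(u \<otimes>\<^bsub>A\<^esub> v \<otimes>\<^bsub>A\<^esub> t) \<otimes>\<^bsub>A\<^esub> (a \<otimes>\<^bsub>A\<^esub> r) = v \<otimes>\<^bsub>A\<^esub> r \<otimes>\<^bsub>A\<^esub> (u \<otimes>\<^bsub>A\<^esub> (a \<otimes>\<^bsub>A\<^esub> t))"
      using cc by (simp add: m_ac)
    also have "\<dots> = u \<otimes>\<^bsub>A\<^esub> s \<otimes>\<^bsub>A\<^esub> (v \<otimes>\<^bsub>A\<^esub> (b \<otimes>\<^bsub>A\<^esub> r))" unfolding 1(6) using cc by (simp add: m_ac)
    also have "\<dots> = (u \<otimes>\<^bsub>A\<^esub> v \<otimes>\<^bsub>A\<^esub> t) \<otimes>\<^bsub>A\<^esub> (c \<otimes>\<^bsub>A\<^esub> s)" unfolding 2(4) using cc by (simp add: m_ac)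
    finally show "(x, z) \<in> localization_rel A P"
      using 1 2 compl_mult[OF compl_mult[OF 1(5) 2(3)] 1(4)] unfolding eq localization_rel_iff by blast
  qed
qed

lemma fraction_eq_iff:
  assumes "a \<in> carrier A" "b \<in> carrier A" "s \<in> carrier A - P" "t \<in> carrier A - P"
  shows "fraction a s = fraction b t \<longleftrightarrow> (\<exists>u\<in>carrier A - P. u \<otimes>\<^bsub>A\<^esub> (a \<otimes>\<^bsub>A\<^esub> t) = u \<otimes>\<^bsub>A\<^esub> (b \<otimes>\<^bsub>A\<^esub> s))"
  unfolding fraction_def using eq_equiv_class_iff[OF equiv_localization_rel, of "(a, s)" "(b, t)"] assms
  by (simp add: localization_rel_iff)

lemma fraction_eqI:
  assumes "a \<in> carrier A" "b \<in> carrier A" "s \<in> carrier A - P" "t \<in> carrier A - P" "a \<otimes>\<^bsub>A\<^esub> t = b \<otimes>\<^bsub>A\<^esub> s"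
  shows "fraction a s = fraction b t"
  using assms compl_one by (subst fraction_eq_iff) auto

lemma fraction_self: "s \<in> carrier A - P \<Longrightarrow> fraction s s = fraction \<one>\<^bsub>A\<^esub> \<one>\<^bsub>A\<^esub>"
  by (rule fraction_eqI) (use compl_one in auto)

lemma localization_carrier: "carrier (localization A P) = {fraction a s | a s. a \<in> carrier A \<and> s \<in> carrier A - P}"
  by (auto simp: localization_def fraction_def quotient_def)

lemma mem_fraction:
  assumes "a \<in> carrier A" "s \<in> carrier A - P"
  shows "(b, t) \<in> fraction a s \<longleftrightarrow> b \<in> carrier A \<and> t \<in> carrier A - P \<and> fraction b t = fraction a s"
proof -
  have "(b, t) \<in> fraction a s \<longleftrightarrow> ((a, s), (b, t)) \<in> localization_rel A P" by (simp add: fraction_def)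
  also have "\<dots> \<longleftrightarrow> b \<in> carrier A \<and> t \<in> carrier A - P \<and> fraction a s = fraction b t"
    unfolding localization_rel_iff using assms fraction_eq_iff[of a b s t] by blast
  finally show ?thesis by (simp add: eq_commute)
qed

text \<open>The operations of the localization are unions over all representatives. Once the summand
  is independent of the representatives, such a union collapses to its value at one pair; sums and
  products of fractions are then computed by checking that independence.\<close>

lemma fraction_UN:
  assumes "a \<in> carrier A" "s \<in> carrier A - P" "b \<in> carrier A" "t \<in> carrier A - P"
    and "\<And>a' s' b' t'. \<lbrakk>a' \<in> carrier A; s' \<in> carrier A - P; b' \<in> carrier A; t' \<in> carrier A - P;
      fraction a' s' = fraction a s; fraction b' t' = fraction b t\<rbrakk> \<Longrightarrow> F a' s' b' t' = F a s b t"
  shows "(\<Union>(a, s)\<in>fraction a s. \<Union>(b, t)\<in>fraction b t. F a s b t) = F a s b t"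
proof -
  have mem: "(a, s) \<in> fraction a s" "(b, t) \<in> fraction b t" using assms by (simp_all add: mem_fraction)
  show ?thesis
  proof (rule UN_constant_eq[OF mem(1)], rule ballI)
    fix y assume y: "y \<in> fraction a s"
    obtain a' s' where y': "y = (a', s')" by (cases y)
    have "(\<Union>(b, t)\<in>fraction b t. F a' s' b t) = F a s b t"
    proof (rule UN_constant_eq[OF mem(2)], rule ballI)
      fix z assume z: "z \<in> fraction b t"
      obtain b' t' where z': "z = (b', t')" by (cases z)
      show "(case z of (b, t) \<Rightarrow> F a' s' b t) = F a s b t"
        unfolding z' prod.case
        by (rule assms(5)) (use y y' z z' assms in \<open>simp_all add: mem_fraction\<close>)
    qed
    then show "(case y of (a, s) \<Rightarrow> \<Union>(b, t)\<in>fraction b t. F a s b t) = F a s b t" by (simp add: y')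
  qed
qed

lemma fraction_mult:
  assumes "a \<in> carrier A" "s \<in> carrier A - P" "b \<in> carrier A" "t \<in> carrier A - P"
  shows "fraction a s \<otimes>\<^bsub>localization A P\<^esub> fraction b t = fraction (a \<otimes>\<^bsub>A\<^esub> b) (s \<otimes>\<^bsub>A\<^esub> t)"
proof -
  have "(\<Union>(a, s)\<in>fraction a s. \<Union>(b, t)\<in>fraction b t. fraction (a \<otimes>\<^bsub>A\<^esub> b) (s \<otimes>\<^bsub>A\<^esub> t)) = fraction (a \<otimes>\<^bsub>A\<^esub> b) (s \<otimes>\<^bsub>A\<^esub> t)"
  proof (rule fraction_UN[OF assms])
    fix a' s' b' t'
    assume as: "a' \<in> carrier A" "s' \<in> carrier A - P" "b' \<in> carrier A" "t' \<in> carrier A - P"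
      "fraction a' s' = fraction a s" "fraction b' t' = fraction b t"
    obtain u where u: "u \<in> carrier A - P" "u \<otimes>\<^bsub>A\<^esub> (a' \<otimes>\<^bsub>A\<^esub> s) = u \<otimes>\<^bsub>A\<^esub> (a \<otimes>\<^bsub>A\<^esub> s')"
      using as(5) fraction_eq_iff as assms by auto
    obtain v where v: "v \<in> carrier A - P" "v \<otimes>\<^bsub>A\<^esub> (b' \<otimes>\<^bsub>A\<^esub> t) = v \<otimes>\<^bsub>A\<^esub> (b \<otimes>\<^bsub>A\<^esub> t')"
      using as(6) fraction_eq_iff as assms by auto
    note cc = as(1,3) assms(1,3) as(2,4)[THEN compl_carrier] assms(2,4)[THEN compl_carrier] u(1)[THEN compl_carrier] v(1)[THEN compl_carrier]
    have "u \<otimes>\<^bsub>A\<^esub> v \<otimes>\<^bsub>A\<^esub> ((a' \<otimes>\<^bsub>A\<^esub> b') \<otimes>\<^bsub>A\<^esub> (s \<otimes>\<^bsub>A\<^esub> t)) =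
        (u \<otimes>\<^bsub>A\<^esub> (a' \<otimes>\<^bsub>A\<^esub> s)) \<otimes>\<^bsub>A\<^esub> (v \<otimes>\<^bsub>A\<^esub> (b' \<otimes>\<^bsub>A\<^esub> t))" using cc by (simp add: m_ac)
    also have "\<dots> = u \<otimes>\<^bsub>A\<^esub> v \<otimes>\<^bsub>A\<^esub> ((a \<otimes>\<^bsub>A\<^esub> b) \<otimes>\<^bsub>A\<^esub> (s' \<otimes>\<^bsub>A\<^esub> t'))"
      unfolding u(2) v(2) using cc by (simp add: m_ac)
    finally show "fraction (a' \<otimes>\<^bsub>A\<^esub> b') (s' \<otimes>\<^bsub>A\<^esub> t') = fraction (a \<otimes>\<^bsub>A\<^esub> b) (s \<otimes>\<^bsub>A\<^esub> t)"
      using fraction_eq_iff[of "a' \<otimes>\<^bsub>A\<^esub> b'" "a \<otimes>\<^bsub>A\<^esub> b" "s' \<otimes>\<^bsub>A\<^esub> t'" "s \<otimes>\<^bsub>A\<^esub> t"] cc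
        compl_mult[OF as(2,4)] compl_mult[OF assms(2,4)] compl_mult[OF u(1) v(1)] by blast
  qed
  then show ?thesis by (simp add: localization_def fraction_def)
qed

lemma fraction_add:
  assumes "a \<in> carrier A" "s \<in> carrier A - P" "b \<in> carrier A" "t \<in> carrier A - P"
  shows "fraction a s \<oplus>\<^bsub>localization A P\<^esub> fraction b t = fraction (a \<otimes>\<^bsub>A\<^esub> t \<oplus>\<^bsub>A\<^esub> b \<otimes>\<^bsub>A\<^esub> s) (s \<otimes>\<^bsub>A\<^esub> t)"
proof -
  have "(\<Union>(a, s)\<in>fraction a s. \<Union>(b, t)\<in>fraction b t. fraction (a \<otimes>\<^bsub>A\<^esub> t \<oplus>\<^bsub>A\<^esub> b \<otimes>\<^bsub>A\<^esub> s) (s \<otimes>\<^bsub>A\<^esub> t)) =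
      fraction (a \<otimes>\<^bsub>A\<^esub> t \<oplus>\<^bsub>A\<^esub> b \<otimes>\<^bsub>A\<^esub> s) (s \<otimes>\<^bsub>A\<^esub> t)"
  proof (rule fraction_UN[OF assms])
    fix a' s' b' t'
    assume as: "a' \<in> carrier A" "s' \<in> carrier A - P" "b' \<in> carrier A" "t' \<in> carrier A - P"
      "fraction a' s' = fraction a s" "fraction b' t' = fraction b t"
    obtain u where u: "u \<in> carrier A - P" "u \<otimes>\<^bsub>A\<^esub> (a' \<otimes>\<^bsub>A\<^esub> s) = u \<otimes>\<^bsub>A\<^esub> (a \<otimes>\<^bsub>A\<^esub> s')"
      using as(5) fraction_eq_iff as assms by auto
    obtain v where v: "v \<in> carrier A - P" "v \<otimes>\<^bsub>A\<^esub> (b' \<otimes>\<^bsub>A\<^esub> t) = v \<otimes>\<^bsub>A\<^esub> (b \<otimes>\<^bsub>A\<^esub> t')"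
      using as(6) fraction_eq_iff as assms by auto
    note cc = as(1,3) assms(1,3) as(2,4)[THEN compl_carrier] assms(2,4)[THEN compl_carrier] u(1)[THEN compl_carrier] v(1)[THEN compl_carrier]
    have "u \<otimes>\<^bsub>A\<^esub> v \<otimes>\<^bsub>A\<^esub> ((a' \<otimes>\<^bsub>A\<^esub> t' \<oplus>\<^bsub>A\<^esub> b' \<otimes>\<^bsub>A\<^esub> s') \<otimes>\<^bsub>A\<^esub> (s \<otimes>\<^bsub>A\<^esub> t)) =
        (u \<otimes>\<^bsub>A\<^esub> (a' \<otimes>\<^bsub>A\<^esub> s)) \<otimes>\<^bsub>A\<^esub> (v \<otimes>\<^bsub>A\<^esub> t \<otimes>\<^bsub>A\<^esub> t') \<oplus>\<^bsub>A\<^esub> (v \<otimes>\<^bsub>A\<^esub> (b' \<otimes>\<^bsub>A\<^esub> t)) \<otimes>\<^bsub>A\<^esub> (u \<otimes>\<^bsub>A\<^esub> s \<otimes>\<^bsub>A\<^esub> s')"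
      using cc by (simp add: m_ac l_distr r_distr)
    also have "\<dots> = u \<otimes>\<^bsub>A\<^esub> v \<otimes>\<^bsub>A\<^esub> ((a \<otimes>\<^bsub>A\<^esub> t \<oplus>\<^bsub>A\<^esub> b \<otimes>\<^bsub>A\<^esub> s) \<otimes>\<^bsub>A\<^esub> (s' \<otimes>\<^bsub>A\<^esub> t'))"
      unfolding u(2) v(2) using cc by (simp add: m_ac l_distr r_distr)
    finally show "fraction (a' \<otimes>\<^bsub>A\<^esub> t' \<oplus>\<^bsub>A\<^esub> b' \<otimes>\<^bsub>A\<^esub> s') (s' \<otimes>\<^bsub>A\<^esub> t') = fraction (a \<otimes>\<^bsub>A\<^esub> t \<oplus>\<^bsub>A\<^esub> b \<otimes>\<^bsub>A\<^esub> s) (s \<otimes>\<^bsub>A\<^esub> t)"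
      using fraction_eq_iff[of "a' \<otimes>\<^bsub>A\<^esub> t' \<oplus>\<^bsub>A\<^esub> b' \<otimes>\<^bsub>A\<^esub> s'" "a \<otimes>\<^bsub>A\<^esub> t \<oplus>\<^bsub>A\<^esub> b \<otimes>\<^bsub>A\<^esub> s" "s' \<otimes>\<^bsub>A\<^esub> t'" "s \<otimes>\<^bsub>A\<^esub> t"] cc
        compl_mult[OF as(2,4)] compl_mult[OF assms(2,4)] compl_mult[OF u(1) v(1)] by blast
  qed
  then show ?thesis by (simp add: localization_def fraction_def)
qed

lemma localization_zero: "\<zero>\<^bsub>localization A P\<^esub> = fraction \<zero>\<^bsub>A\<^esub> \<one>\<^bsub>A\<^esub>"
  and localization_one: "\<one>\<^bsub>localization A P\<^esub> = fraction \<one>\<^bsub>A\<^esub> \<one>\<^bsub>A\<^esub>"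
  by (simp_all add: localization_def fraction_def)

lemma localization_cases:
  assumes "x \<in> carrier (localization A P)"
  obtains a s where "x = fraction a s" "a \<in> carrier A" "s \<in> carrier A - P"
  using assms by (auto simp: localization_carrier)

lemma fraction_closed:
  "a \<in> carrier A \<Longrightarrow> s \<in> carrier A - P \<Longrightarrow> fraction a s \<in> carrier (localization A P)"
  by (auto simp: localization_carrier)

lemma fraction_zero: "s \<in> carrier A - P \<Longrightarrow> fraction \<zero>\<^bsub>A\<^esub> s = \<zero>\<^bsub>localization A P\<^esub>"
  unfolding localization_zero by (rule fraction_eqI) (use compl_one in auto)

lemma cring_localization: "cring (localization A P)"
proof (rule cringI)
  show "abelian_group (localization A P)"
  proof (rule abelian_groupI)
    fix x y assume "x \<in> carrier (localization A P)" "y \<in> carrier (localization A P)"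
    then obtain a s b t where xy: "x = fraction a s" "y = fraction b t"
      and c: "a \<in> carrier A" "s \<in> carrier A - P" "b \<in> carrier A" "t \<in> carrier A - P"
      by (auto elim!: localization_cases)
    show "x \<oplus>\<^bsub>localization A P\<^esub> y \<in> carrier (localization A P)"
      unfolding xy fraction_add[OF c] by (rule fraction_closed) (use c compl_mult[OF c(2,4)] in auto)
    show "x \<oplus>\<^bsub>localization A P\<^esub> y = y \<oplus>\<^bsub>localization A P\<^esub> x"
      unfolding xy fraction_add[OF c] fraction_add[OF c(3,4,1,2)] using c compl_carrier by (simp add: a_comm m_comm)
    fix z assume "z \<in> carrier (localization A P)"
    then obtain d r where z: "z = fraction d r" and d: "d \<in> carrier A" "r \<in> carrier A - P"
      by (auto elim!: localization_cases)
    show "(x \<oplus>\<^bsub>localization A P\<^esub> y) \<oplus>\<^bsub>localization A P\<^esub> z = x \<oplus>\<^bsub>localization A P\<^esub> (y \<oplus>\<^bsub>localization A P\<^esub> z)"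
      unfolding xy z fraction_add[OF c] fraction_add[OF c(3,4) d]
      using c d compl_mult[OF c(2,4)] compl_mult[OF c(4) d(2)] compl_mult[OF c(2) compl_mult[OF c(4) d(2)]]
      by (subst (1 2) fraction_add) (simp_all add: l_distr r_distr m_ac a_ac)
  next
    fix x assume "x \<in> carrier (localization A P)"
    then obtain a s where x: "x = fraction a s" and c: "a \<in> carrier A" "s \<in> carrier A - P"
      by (auto elim!: localization_cases)
    show "\<zero>\<^bsub>localization A P\<^esub> \<oplus>\<^bsub>localization A P\<^esub> x = x"
      unfolding x localization_zero using c compl_one by (subst fraction_add) auto
    have 1: "\<ominus>\<^bsub>A\<^esub> a \<otimes>\<^bsub>A\<^esub> s \<oplus>\<^bsub>A\<^esub> a \<otimes>\<^bsub>A\<^esub> s = \<zero>\<^bsub>A\<^esub>" using c by (simp add: l_minus l_neg)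
    show "\<exists>y\<in>carrier (localization A P). y \<oplus>\<^bsub>localization A P\<^esub> x = \<zero>\<^bsub>localization A P\<^esub>"
    proof (intro bexI)
      show "fraction (\<ominus>\<^bsub>A\<^esub> a) s \<oplus>\<^bsub>localization A P\<^esub> x = \<zero>\<^bsub>localization A P\<^esub>"
        unfolding x using c compl_mult[OF c(2,2)] by (subst fraction_add) (simp_all add: 1 fraction_zero)
    qed (use c in \<open>auto intro!: fraction_closed\<close>)
  qed (auto simp: localization_zero intro!: fraction_closed compl_one)
  show "comm_monoid (localization A P)"
  proof (rule comm_monoidI)
    fix x y assume "x \<in> carrier (localization A P)" "y \<in> carrier (localization A P)"
    then obtain a s b t where xy: "x = fraction a s" "y = fraction b t"
      and c: "a \<in> carrier A" "s \<in> carrier A - P" "b \<in> carrier A" "t \<in> carrier A - P"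
      by (auto elim!: localization_cases)
    show "x \<otimes>\<^bsub>localization A P\<^esub> y \<in> carrier (localization A P)"
      unfolding xy fraction_mult[OF c] by (rule fraction_closed) (use c compl_mult[OF c(2,4)] in auto)
    show "x \<otimes>\<^bsub>localization A P\<^esub> y = y \<otimes>\<^bsub>localization A P\<^esub> x"
      unfolding xy fraction_mult[OF c] fraction_mult[OF c(3,4,1,2)] using c compl_carrier by (simp add: m_comm)
    fix z assume "z \<in> carrier (localization A P)"
    then obtain d r where z: "z = fraction d r" and d: "d \<in> carrier A" "r \<in> carrier A - P"
      by (auto elim!: localization_cases)
    show "(x \<otimes>\<^bsub>localization A P\<^esub> y) \<otimes>\<^bsub>localization A P\<^esub> z = x \<otimes>\<^bsub>localization A P\<^esub> (y \<otimes>\<^bsub>localization A P\<^esub> z)"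
      unfolding xy z fraction_mult[OF c] fraction_mult[OF c(3,4) d]
      using c d compl_mult[OF c(2,4)] compl_mult[OF c(4) d(2)]
      by (subst (1 2) fraction_mult) (simp_all add: m_ac)
  next
    fix x assume "x \<in> carrier (localization A P)"
    then obtain a s where x: "x = fraction a s" and c: "a \<in> carrier A" "s \<in> carrier A - P"
      by (auto elim!: localization_cases)
    show "\<one>\<^bsub>localization A P\<^esub> \<otimes>\<^bsub>localization A P\<^esub> x = x"
      unfolding x localization_one using c compl_one by (subst fraction_mult) auto
  qed (auto simp: localization_one intro!: fraction_closed compl_one)
  fix x y z assume "x \<in> carrier (localization A P)" "y \<in> carrier (localization A P)" "z \<in> carrier (localization A P)"
  then obtain a s b t d r where xy: "x = fraction a s" "y = fraction b t" "z = fraction d r"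
    and c: "a \<in> carrier A" "s \<in> carrier A - P" "b \<in> carrier A" "t \<in> carrier A - P" "d \<in> carrier A" "r \<in> carrier A - P"
    by (auto elim!: localization_cases)
  note S = compl_mult[OF c(2,4)] compl_mult[OF compl_mult[OF c(2,4)] c(6)] compl_mult[OF c(2,6)] compl_mult[OF c(4,6)]
     compl_mult[OF compl_mult[OF c(2,6)] compl_mult[OF c(4,6)]]
  have 1: "(x \<oplus>\<^bsub>localization A P\<^esub> y) \<otimes>\<^bsub>localization A P\<^esub> z =
      fraction ((a \<otimes>\<^bsub>A\<^esub> t \<oplus>\<^bsub>A\<^esub> b \<otimes>\<^bsub>A\<^esub> s) \<otimes>\<^bsub>A\<^esub> d) (s \<otimes>\<^bsub>A\<^esub> t \<otimes>\<^bsub>A\<^esub> r)"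
    unfolding xy fraction_add[OF c(1-4)] by (rule fraction_mult) (use c S in auto)
  have 2: "x \<otimes>\<^bsub>localization A P\<^esub> z \<oplus>\<^bsub>localization A P\<^esub> y \<otimes>\<^bsub>localization A P\<^esub> z =
      fraction (a \<otimes>\<^bsub>A\<^esub> d \<otimes>\<^bsub>A\<^esub> (t \<otimes>\<^bsub>A\<^esub> r) \<oplus>\<^bsub>A\<^esub> b \<otimes>\<^bsub>A\<^esub> d \<otimes>\<^bsub>A\<^esub> (s \<otimes>\<^bsub>A\<^esub> r)) (s \<otimes>\<^bsub>A\<^esub> r \<otimes>\<^bsub>A\<^esub> (t \<otimes>\<^bsub>A\<^esub> r))"
    unfolding xy fraction_mult[OF c(1,2,5,6)] fraction_mult[OF c(3,4,5,6)] by (rule fraction_add) (use c S in auto)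
  show "(x \<oplus>\<^bsub>localization A P\<^esub> y) \<otimes>\<^bsub>localization A P\<^esub> z =
      x \<otimes>\<^bsub>localization A P\<^esub> z \<oplus>\<^bsub>localization A P\<^esub> y \<otimes>\<^bsub>localization A P\<^esub> z"
    unfolding 1 2 by (rule fraction_eqI) (use c S in \<open>simp_all add: l_distr r_distr m_ac\<close>)
qed

definition to_frac :: "'a \<Rightarrow> ('a \<times> 'a) set" where "to_frac a = fraction a \<one>\<^bsub>A\<^esub>"

lemma to_frac_ring_hom: "to_frac \<in> ring_hom A (localization A P)"
  by (rule ring_hom_memI)
    (simp_all add: to_frac_def fraction_closed compl_one[simplified] fraction_mult fraction_add localization_one)

lemma to_frac_eq_zero_iff:
  assumes "a \<in> carrier A"
  shows "to_frac a = \<zero>\<^bsub>localization A P\<^esub> \<longleftrightarrow> (\<exists>u\<in>carrier A - P. u \<otimes>\<^bsub>A\<^esub> a = \<zero>\<^bsub>A\<^esub>)"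
  unfolding to_frac_def localization_zero using assms compl_one by (subst fraction_eq_iff) auto

lemma to_frac_Units:
  assumes "s \<in> carrier A - P"
  shows "to_frac s \<in> Units (localization A P)"
proof -
  have "fraction \<one>\<^bsub>A\<^esub> s \<otimes>\<^bsub>localization A P\<^esub> to_frac s = \<one>\<^bsub>localization A P\<^esub>"
    unfolding to_frac_def localization_one using assms compl_one by (simp add: fraction_mult fraction_self[OF assms])
  moreover have "to_frac s \<otimes>\<^bsub>localization A P\<^esub> fraction \<one>\<^bsub>A\<^esub> s = \<one>\<^bsub>localization A P\<^esub>"
    unfolding to_frac_def localization_one using assms compl_one by (simp add: fraction_mult fraction_self[OF assms])
  ultimately show ?thesis
    using assms compl_one unfolding Units_def to_frac_def by (blast intro: fraction_closed compl_carrier)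
qed

text \<open>Elements of the localization are later handled through an equation
  \<open>x s = a\<close> between images of ring elements, which avoids computing with
  fractions.\<close>

lemma to_frac_surj:
  assumes "x \<in> carrier (localization A P)"
  shows "\<exists>a\<in>carrier A. \<exists>s\<in>carrier A - P. x \<otimes>\<^bsub>localization A P\<^esub> to_frac s = to_frac a"
proof -
  obtain a s where x: "x = fraction a s" and c: "a \<in> carrier A" "s \<in> carrier A - P"
    using assms by (rule localization_cases)
  have "x \<otimes>\<^bsub>localization A P\<^esub> to_frac s = to_frac a"
    unfolding x to_frac_def fraction_mult[OF c compl_carrier[OF c(2)] compl_one]
    by (rule fraction_eqI) (use c compl_one in \<open>auto simp: m_ac\<close>)
  then show ?thesis using c by blast
qed

end

section \<open>Quadrics in the polynomial ring\<close>

lemma mpoly_ring_simps [simp]: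
  "carrier mpoly_ring = UNIV"
  "x \<otimes>\<^bsub>mpoly_ring\<^esub> y = x * y"
  "x \<oplus>\<^bsub>mpoly_ring\<^esub> y = x + y"
  "\<one>\<^bsub>mpoly_ring\<^esub> = 1"
  "\<zero>\<^bsub>mpoly_ring\<^esub> = 0"
  by (simp_all add: ring_of_type_algebra_def)

lemma cring_mpoly_ring: "cring (mpoly_ring :: ('n::finite, 'k::field) mpoly ring)"
  by (rule cring_from_type_algebra)

interpretation mpr: cring "mpoly_ring :: ('n::finite, 'k::field) mpoly ring"
  by (rule cring_mpoly_ring)

interpretation rm: Modules.module "(*) :: ('n::finite, 'k::field) mpoly \<Rightarrow> _"
  by unfold_locales (simp_all add: algebra_simps)

declare rm.scale_scale [simp del]

lemma mpoly_ring_uminus [simp]: "\<ominus>\<^bsub>mpoly_ring\<^esub> (x :: ('n::finite, 'k::field) mpoly) = - x"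
  by (rule mpr.minus_equality) simp_all

lemma mpoly_ring_minus [simp]: "(x :: ('n::finite, 'k::field) mpoly) \<ominus>\<^bsub>mpoly_ring\<^esub> y = x - y"
  by (simp add: a_minus_def)

text \<open>Two linear structures live on the same type: for \<open>rm\<close>, with polynomial
  scalars, subspaces are ideals and spans are generated ideals; for \<open>mp\<close>, with constant
  scalars, they are the vector spaces over the field.\<close>

lemma ideal_mpoly_ring_iff: "ideal I mpoly_ring \<longleftrightarrow> rm.subspace I"
proof
  assume "ideal I mpoly_ring"
  then interpret ideal I mpoly_ring .
  show "rm.subspace I"
    using additive_subgroup.zero_closed[OF additive_subgroup_axioms] a_closed I_l_closed
    by (intro rm.subspaceI) auto
next
  assume I: "rm.subspace I"
  show "ideal I mpoly_ring"
  proof (rule idealI[OF mpr.ring_axioms])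
    show "subgroup I (add_monoid mpoly_ring)"
      by (rule mpr.add.subgroupI) (use rm.subspace_0[OF I] rm.subspace_neg[OF I] rm.subspace_add[OF I] in auto)
  qed (use rm.subspace_scale[OF I] in \<open>auto simp: mult.commute\<close>)
qed

lemma genideal_mpoly_ring: "Idl\<^bsub>mpoly_ring\<^esub> S = rm.span S"
  unfolding genideal_def ideal_mpoly_ring_iff rm.span_def hull_def ..

lemma Const_add: "Const (a + b) = Const a + Const b"
  by (simp add: Const_def single_add)

lemma Const_mult: "Const (a * b) = Const a * Const b"
  by (simp add: Const_def mult_single)

lemma Const_1 [simp]: "Const 1 = 1"
  by (simp add: Const_def)

lemma Const_0 [simp]: "Const 0 = 0"
  by (simp add: Const_def)

interpretation mp: vector_space "\<lambda>c (p :: ('n::finite, 'k::field) mpoly). Const c * p"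
  by unfold_locales (simp_all add: algebra_simps Const_add Const_mult)

interpretation vk: vector_space "(*) :: 'k::field \<Rightarrow> 'k \<Rightarrow> 'k"
  by unfold_locales (simp_all add: algebra_simps)

declare vk.scale_scale [simp del]

interpretation mpk: vector_space_pair "\<lambda>c (p :: ('n::finite, 'k::field) mpoly). Const c * p" "(*) :: 'k \<Rightarrow> 'k \<Rightarrow> 'k"
  ..

abbreviation mpoly_functional :: "(('n::finite, 'k::field) mpoly \<Rightarrow> 'k) \<Rightarrow> bool" where
  "mpoly_functional L \<equiv> Vector_Spaces.linear (\<lambda>c p. Const c * p) (*) L"

lemma mpoly_functionalD:
  assumes "mpoly_functional L"
  shows "L (p + q) = L p + L q" "L (Const c * p) = c * L p" "L 0 = 0" "L (- p) = - L p" "L (p - q) = L p - L q"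
    "L (sum f S) = (\<Sum>x\<in>S. L (f x))"
  using mpk.linear_add[OF assms] mpk.linear_scale[OF assms] mpk.linear_0[OF assms] mpk.linear_neg[OF assms]
    mpk.linear_diff[OF assms] mpk.linear_sum[OF assms] by auto

lemma subspace_if_ideal: "rm.subspace I \<Longrightarrow> mp.subspace I"
  using rm.subspace_0 rm.subspace_add rm.subspace_scale by (intro mp.subspaceI) auto

lemma span_le_genideal: "mp.span S \<subseteq> rm.span S"
  by (rule mp.span_minimal) (auto intro: rm.span_base subspace_if_ideal)

lemma mpoly_sum_single: "p = (\<Sum>m\<in>Poly_Mapping.keys p. Poly_Mapping.single m (Poly_Mapping.lookup p m))"
proof (rule poly_mapping_eqI)
  fix k
  have "Poly_Mapping.lookup (\<Sum>m\<in>Poly_Mapping.keys p. Poly_Mapping.single m (Poly_Mapping.lookup p m)) k =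
     (\<Sum>m\<in>Poly_Mapping.keys p. if m = k then Poly_Mapping.lookup p k else 0)"
    unfolding lookup_sum by (rule sum.cong) (auto simp: lookup_single when_def)
  then show "Poly_Mapping.lookup p k = Poly_Mapping.lookup (\<Sum>m\<in>Poly_Mapping.keys p. Poly_Mapping.single m (Poly_Mapping.lookup p m)) k"
    by (simp add: in_keys_iff)
qed

lemma mpoly_induct [case_names zero add single]:
  fixes p :: "('n::finite, 'k::field) mpoly"
  assumes "P 0" "\<And>p q. P p \<Longrightarrow> P q \<Longrightarrow> P (p + q)" "\<And>m c. P (Poly_Mapping.single m c)"
  shows "P p"
proof -
  have "P (\<Sum>m\<in>A. Poly_Mapping.single m (Poly_Mapping.lookup p m))" if "finite A" for A
    using that by induction (auto intro: assms)
  then show ?thesis using mpoly_sum_single[of p] by (metis finite_keys)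
qed

section \<open>Degrees and homogeneous components\<close>

definition mdeg :: "('n::finite \<Rightarrow>\<^sub>0 nat) \<Rightarrow> nat" where
  "mdeg m = (\<Sum>i\<in>UNIV. Poly_Mapping.lookup m i)"

lemma mdeg_add: "mdeg (m + m') = mdeg m + mdeg m'"
  by (simp add: mdeg_def lookup_add sum.distrib)

lemma mdeg_0 [simp]: "mdeg 0 = 0"
  by (simp add: mdeg_def)

lemma mdeg_single [simp]: "mdeg (Poly_Mapping.single i n) = n"
  by (simp add: mdeg_def lookup_single when_def)

lemma mdeg_eq_0_iff [simp]: "mdeg m = 0 \<longleftrightarrow> m = 0"
  by (auto simp: mdeg_def intro!: poly_mapping_eqI)

lemma mdeg_SucE:
  assumes "mdeg m = Suc n"
  obtains i m' where "m = Poly_Mapping.single i 1 + m'" "mdeg m' = n"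
proof -
  have "\<exists>i. Poly_Mapping.lookup m i \<noteq> 0" using assms unfolding mdeg_def by (metis nat.distinct(1) sum.neutral)
  then obtain i where i: "Poly_Mapping.lookup m i \<noteq> 0" ..
  define m' where "m' = m - Poly_Mapping.single i 1"
  have "m = Poly_Mapping.single i 1 + m'"
    by (rule poly_mapping_eqI) (use i in \<open>auto simp: m'_def lookup_add lookup_minus lookup_single when_def\<close>)
  moreover from this have "mdeg m' = n" using assms by (metis mdeg_add mdeg_single add_left_cancel plus_1_eq_Suc)
  ultimately show ?thesis using that by blast
qed

text \<open>The homogeneous component of degree \<open>n\<close>.\<close>

definition hc :: "nat \<Rightarrow> ('n::finite, 'k::field) mpoly \<Rightarrow> ('n, 'k) mpoly" where
  "hc n p = (\<Sum>m\<in>{m\<in>Poly_Mapping.keys p. mdeg m = n}. Poly_Mapping.single m (Poly_Mapping.lookup p m))"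

lemma lookup_hc: "Poly_Mapping.lookup (hc n p) k = (if mdeg k = n then Poly_Mapping.lookup p k else 0)"
proof -
  have "Poly_Mapping.lookup (hc n p) k =
     (\<Sum>m\<in>{m\<in>Poly_Mapping.keys p. mdeg m = n}. if m = k then Poly_Mapping.lookup p k else 0)"
    unfolding hc_def lookup_sum by (rule sum.cong) (auto simp: lookup_single when_def)
  then show ?thesis by (auto simp: in_keys_iff)
qed

lemma hc_zero [simp]: "hc n 0 = 0"
  and hc_add: "hc n (p + q) = hc n p + hc n q"
  and hc_uminus: "hc n (- p) = - hc n p"
  and hc_diff: "hc n (p - q) = hc n p - hc n q"
  by (auto intro!: poly_mapping_eqI simp: lookup_hc lookup_add lookup_minus)

lemma hc_single: "hc n (Poly_Mapping.single m c) = (if mdeg m = n then Poly_Mapping.single m c else 0)"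
  by (auto intro!: poly_mapping_eqI simp: lookup_hc lookup_single when_def)

lemma hc_mult: "hc n (p * q) = (\<Sum>k\<le>n. hc k p * hc (n - k) q)"
proof (induction p rule: mpoly_induct)
  case (add p p')
  then show ?case by (simp add: hc_add distrib_right sum.distrib)
next
  case (single m a)
  show ?case
  proof (induction q rule: mpoly_induct)
    case (add q q')
    then show ?case by (simp add: hc_add distrib_left sum.distrib)
  next
    case (single m' b)
    have "(\<Sum>k\<le>n. hc k (Poly_Mapping.single m a) * hc (n - k) (Poly_Mapping.single m' b)) =
       (\<Sum>k\<le>n. if k = mdeg m then (if mdeg m + mdeg m' = n then Poly_Mapping.single (m + m') (a * b) else 0) else 0)"
      by (rule sum.cong) (auto simp: hc_single mult_single)
    then show ?case by (auto simp: hc_single mult_single mdeg_add)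
  qed simp
qed simp

lemma hc_0: "hc 0 p = Const (Poly_Mapping.lookup p 0)"
  by (auto intro!: poly_mapping_eqI simp: lookup_hc Const_def lookup_single when_def)

lemma hc_0_mult: "hc 0 (p * q) = hc 0 p * hc 0 q"
  by (simp add: hc_mult)

lemma hc_1_mult: "hc 1 (p * q) = hc 0 p * hc 1 q + hc 1 p * hc 0 q"
  by (simp add: hc_mult atMost_Suc)

lemma hc_2_mult: "hc 2 (p * q) = hc 0 p * hc 2 q + hc 1 p * hc 1 q + hc 2 p * hc 0 q"
  by (simp add: hc_mult atMost_Suc numeral_2_eq_2)

lemma homogeneous_iff_hc: "homogeneous n p \<longleftrightarrow> hc n p = p"
proof -
  have "hc n p = p \<longleftrightarrow> (\<forall>m. mdeg m \<noteq> n \<longrightarrow> Poly_Mapping.lookup p m = 0)"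
    by (auto simp: poly_mapping_eq_iff lookup_hc fun_eq_iff)
  then show ?thesis by (auto simp: homogeneous_def mdeg_def in_keys_iff)
qed

lemma hc_hc: "hc k (hc n p) = (if k = n then hc n p else 0)"
  by (auto intro!: poly_mapping_eqI simp: lookup_hc)

lemma homogeneous_hc [simp]: "homogeneous n (hc n p)"
  by (simp add: homogeneous_iff_hc hc_hc)

lemma hc_homogeneous: "homogeneous n p \<Longrightarrow> hc k p = (if k = n then p else 0)"
  by (metis hc_hc homogeneous_iff_hc)

lemma homogeneous_0 [simp]: "homogeneous n 0"
  by (simp add: homogeneous_iff_hc)

lemma homogeneous_add: "homogeneous n p \<Longrightarrow> homogeneous n q \<Longrightarrow> homogeneous n (p + q)"
  and homogeneous_diff: "homogeneous n p \<Longrightarrow> homogeneous n q \<Longrightarrow> homogeneous n (p - q)"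
  by (simp_all add: homogeneous_iff_hc hc_add hc_diff)

lemma homogeneous_sum: "(\<And>i. i \<in> S \<Longrightarrow> homogeneous n (f i)) \<Longrightarrow> homogeneous n (sum f S)"
  by (induction S rule: infinite_finite_induct) (auto intro: homogeneous_add)

lemma homogeneous_Const_mult: "homogeneous n p \<Longrightarrow> homogeneous n (Const c * p)"
  and homogeneous_mult: "homogeneous n p \<Longrightarrow> homogeneous k q \<Longrightarrow> homogeneous (n + k) (p * q)"
proof -
  have *: "homogeneous (n + k) (p * q)" if "homogeneous n p" "homogeneous k q" for n k and p q :: "('n::finite, 'k::field) mpoly"
  proof -
    have "hc (n + k) (p * q) = (\<Sum>i\<le>n+k. if i = n then p * q else 0)"
      unfolding hc_mult by (rule sum.cong) (auto simp: hc_homogeneous[OF that(1)] hc_homogeneous[OF that(2)])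
    then show ?thesis by (simp add: homogeneous_iff_hc)
  qed
  show "homogeneous n p \<Longrightarrow> homogeneous k q \<Longrightarrow> homogeneous (n + k) (p * q)" by (rule *)
  have "homogeneous 0 (Const c)" by (simp add: homogeneous_iff_hc hc_0) (simp add: Const_def)
  then show "homogeneous n p \<Longrightarrow> homogeneous n (Const c * p)" using *[of 0 "Const c" n p] by simp
qed

lemma homogeneous_Var [simp]: "homogeneous (Suc 0) (Var i)"
  by (simp add: homogeneous_iff_hc Var_def hc_single)

lemma homogeneous_1_Var_mult: "homogeneous 1 p \<Longrightarrow> homogeneous 2 (Var i * p)"
  using homogeneous_mult[OF homogeneous_Var, of "Suc 0" p i] by (simp add: numeral_2_eq_2)

lemma single_eq_Const_mult: "Poly_Mapping.single m c = Const c * Poly_Mapping.single m 1"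
  by (simp add: Const_def mult_single)

lemma single_add_Var: "Poly_Mapping.single (Poly_Mapping.single i 1 + m) c = Var i * Poly_Mapping.single m c"
  by (simp add: Var_def mult_single)

abbreviation lincoeff :: "'n \<Rightarrow> ('n::finite, 'k::field) mpoly \<Rightarrow> 'k" where
  "lincoeff i p \<equiv> Poly_Mapping.lookup p (Poly_Mapping.single i 1)"

lemma hc_1: "hc 1 p = (\<Sum>i\<in>UNIV. Const (lincoeff i p) * Var i)"
proof (rule poly_mapping_eqI)
  fix m
  have eq: "Poly_Mapping.lookup (\<Sum>i\<in>UNIV. Const (lincoeff i p) * Var i) m =
     (\<Sum>i\<in>UNIV. if m = Poly_Mapping.single i 1 then lincoeff i p else 0)"
    unfolding lookup_sum by (rule sum.cong) (auto simp: Const_def Var_def mult_single lookup_single when_def)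
  show "Poly_Mapping.lookup (hc 1 p) m = Poly_Mapping.lookup (\<Sum>i\<in>UNIV. Const (lincoeff i p) * Var i) m"
  proof (cases "mdeg m = 1")
    case True
    then obtain i where i: "m = Poly_Mapping.single i 1"
      by (metis One_nat_def mdeg_SucE mdeg_eq_0_iff add.right_neutral)
    have "Poly_Mapping.single i (1::nat) = Poly_Mapping.single j 1 \<longleftrightarrow> i = j" for j
      by (metis lookup_single_eq lookup_single_not_eq one_neq_zero)
    then show ?thesis unfolding eq by (simp add: i lookup_hc)
  next
    case False
    then have "m \<noteq> Poly_Mapping.single i 1" for i by auto
    then show ?thesis unfolding eq using False by (simp add: lookup_hc)
  qed
qed

lemma homogeneous_1_eq: "homogeneous 1 p \<Longrightarrow> p = (\<Sum>i\<in>UNIV. Const (lincoeff i p) * Var i)"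
  using hc_1[of p] by (simp add: homogeneous_iff_hc)

lemma lookup_Const_mult: "Poly_Mapping.lookup (Const c * (r :: ('n::finite, 'k::field) mpoly)) m = c * Poly_Mapping.lookup r m"
  by (induction r rule: mpoly_induct)
    (auto simp: Const_def mult_single lookup_add distrib_left lookup_single when_def)

text \<open>The Leibniz rule at the origin: \<open>lincoeff i\<close> is the partial derivative in
  direction \<open>i\<close> evaluated there.\<close>

lemma lincoeff_mult:
  fixes p q :: "('n::finite, 'k::field) mpoly"
  shows "lincoeff i (p * q) = Poly_Mapping.lookup p 0 * lincoeff i q + lincoeff i p * Poly_Mapping.lookup q 0"
proof -
  have "lincoeff i (p * q) = lincoeff i (hc 1 (p * q))" by (simp add: lookup_hc)
  also have "\<dots> = lincoeff i (hc 0 p * hc 1 q) + lincoeff i (hc 1 p * hc 0 q)"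
    by (simp only: hc_1_mult lookup_add)
  also have "\<dots> = Poly_Mapping.lookup p 0 * lincoeff i q + lincoeff i p * Poly_Mapping.lookup q 0"
    by (simp add: hc_0 lookup_hc lookup_Const_mult mult.commute[of _ "Const _"])
  finally show ?thesis .
qed

lemma lookup_0_mult: "Poly_Mapping.lookup (p * q) 0 = Poly_Mapping.lookup p 0 * Poly_Mapping.lookup (q :: ('n::finite, 'k::field) mpoly) 0"
proof -
  have "Const (Poly_Mapping.lookup (p * q) 0) = (Const (Poly_Mapping.lookup p 0 * Poly_Mapping.lookup q 0) :: ('n, 'k) mpoly)"
    using hc_0_mult[of p q] by (simp add: hc_0 Const_mult)
  then show ?thesis unfolding Const_def by (metis lookup_single_eq)
qed

lemma homogeneous_2_span:
  "homogeneous 2 p \<Longrightarrow> p \<in> mp.span {Var i * Var j | i j. True}"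
proof -
  assume p: "homogeneous 2 p"
  have "Poly_Mapping.single m (Poly_Mapping.lookup p m) \<in> mp.span {Var i * Var j | i j. True}"
    if m: "m \<in> Poly_Mapping.keys p" for m
  proof -
    have "mdeg m = Suc 1" using p m by (auto simp: homogeneous_def mdeg_def)
    then obtain i m' where 1: "m = Poly_Mapping.single i 1 + m'" "mdeg m' = Suc 0" by (auto elim: mdeg_SucE)
    from 1(2) obtain j where 2: "m' = Poly_Mapping.single j 1" by (auto elim: mdeg_SucE)
    have "Poly_Mapping.single m (Poly_Mapping.lookup p m) = Const (Poly_Mapping.lookup p m) * (Var i * Var j)"
      by (subst single_eq_Const_mult) (simp add: 1 2 Var_def mult_single)
    then show ?thesis by (simp only:) (rule mp.span_scale, rule mp.span_base, blast)
  qed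
  then show ?thesis by (subst mpoly_sum_single) (rule mp.span_sum)
qed

lemma subspace_homogeneous: "mp.subspace {p. homogeneous n p}"
  by (rule mp.subspaceI) (auto intro: homogeneous_add homogeneous_Const_mult)

section \<open>Ideals generated by quadrics\<close>

lemma irrelevant_ideal_iff: "p \<in> irrelevant_ideal \<longleftrightarrow> Poly_Mapping.lookup p 0 = 0"
proof
  assume "p \<in> irrelevant_ideal"
  then have "p \<in> rm.span (range Var)" by (simp add: irrelevant_ideal_def genideal_mpoly_ring)
  then show "Poly_Mapping.lookup p 0 = 0"
  proof (induction rule: rm.span_induct_alt)
    case (step c x y)
    have "Poly_Mapping.single i (1::nat) \<noteq> 0" for i :: 'a by (metis mdeg_0 mdeg_single zero_neq_one)
    then show ?case using step by (auto simp: lookup_add lookup_0_mult Var_def lookup_single when_def)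
  qed simp
next
  assume p: "Poly_Mapping.lookup p 0 = 0"
  have "Poly_Mapping.single m (Poly_Mapping.lookup p m) \<in> rm.span (range Var)"
    if m: "m \<in> Poly_Mapping.keys p" for m
  proof -
    have "m \<noteq> 0" using p m by (auto simp: in_keys_iff)
    then obtain n where "mdeg m = Suc n" by (metis mdeg_eq_0_iff not0_implies_Suc)
    then obtain i m' where 1: "m = Poly_Mapping.single i 1 + m'" by (rule mdeg_SucE)
    show ?thesis unfolding 1 single_add_Var
      by (subst mult.commute) (auto intro: rm.span_scale rm.span_base)
  qed
  then have "p \<in> rm.span (range Var)" by (subst mpoly_sum_single) (rule rm.span_sum)
  then show "p \<in> irrelevant_ideal" by (simp add: irrelevant_ideal_def genideal_mpoly_ring)
qed

text \<open>For \<open>p\<close> of order at least two, the quadratic part of \<open>r * p\<close>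
  is the constant term of \<open>r\<close> times the quadratic part of \<open>p\<close>. So any
  linear space of possible quadratic parts, with no restriction in higher degree, gives an ideal.
  Comparison with such ideals bounds the quadratic parts occurring in a generated ideal.\<close>

lemma ideal_of_quadric_subspace:
  assumes V: "mp.subspace V"
  shows "rm.subspace {p. hc 0 p = 0 \<and> hc 1 p = 0 \<and> hc 2 p \<in> V}"
proof (rule rm.subspaceI)
  show "0 \<in> {p. hc 0 p = 0 \<and> hc 1 p = 0 \<and> hc 2 p \<in> V}" using mp.subspace_0[OF V] by simp
  fix p q assume "p \<in> {p. hc 0 p = 0 \<and> hc 1 p = 0 \<and> hc 2 p \<in> V}" "q \<in> {p. hc 0 p = 0 \<and> hc 1 p = 0 \<and> hc 2 p \<in> V}"
  then show "p + q \<in> {p. hc 0 p = 0 \<and> hc 1 p = 0 \<and> hc 2 p \<in> V}" using mp.subspace_add[OF V] by (simp add: hc_add)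
next
  fix r p assume "p \<in> {p. hc 0 p = 0 \<and> hc 1 p = 0 \<and> hc 2 p \<in> V}"
  then show "r * p \<in> {p. hc 0 p = 0 \<and> hc 1 p = 0 \<and> hc 2 p \<in> V}"
    unfolding mem_Collect_eq hc_0_mult hc_1_mult hc_2_mult using mp.subspace_scale[OF V] by (simp add: hc_0)
qed

lemma genideal_quadrics_le:
  assumes "\<And>q. q \<in> S \<Longrightarrow> homogeneous 2 q" and "p \<in> rm.span S"
  shows "hc 0 p = 0 \<and> hc 1 p = 0 \<and> hc 2 p \<in> mp.span S"
proof -
  have "rm.span S \<subseteq> {p. hc 0 p = 0 \<and> hc 1 p = 0 \<and> hc 2 p \<in> mp.span S}"
  proof (rule rm.span_minimal)
    show "rm.subspace {p. hc 0 p = 0 \<and> hc 1 p = 0 \<and> hc 2 p \<in> mp.span S}"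
      by (rule ideal_of_quadric_subspace) simp
    show "S \<subseteq> {p. hc 0 p = 0 \<and> hc 1 p = 0 \<and> hc 2 p \<in> mp.span S}"
      using hc_homogeneous[OF assms(1)] by (auto intro: mp.span_base)
  qed
  then show ?thesis using assms(2) by blast
qed

abbreviation (input) irrelevant_square :: "('n::finite, 'k::field) mpoly set" where
  "irrelevant_square \<equiv> irrelevant_ideal \<cdot>\<^bsub>mpoly_ring\<^esub> irrelevant_ideal"

lemma ideal_irrelevant_ideal: "ideal irrelevant_ideal (mpoly_ring :: ('n::finite, 'k::field) mpoly ring)"
  unfolding irrelevant_ideal_def by (rule mpr.genideal_ideal) simp

text \<open>Rewrites the product ideal as one generated by quadrics, so that the bound on quadratic
  parts applies to it.\<close>

lemma irrelevant_square_eq: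
  "(irrelevant_square :: ('n::finite, 'k::field) mpoly set) = rm.span {p. homogeneous 2 p}"
proof
  have Var_in: "Var i * Var j \<in> (irrelevant_square :: ('n, 'k) mpoly set)" for i j
    using ideal_prod.prod[of "Var i" irrelevant_ideal "Var j" irrelevant_ideal mpoly_ring]
    by (simp add: irrelevant_ideal_def genideal_mpoly_ring rm.span_base)
  have sub: "rm.subspace (irrelevant_square :: ('n, 'k) mpoly set)"
    using mpr.ideal_prod_is_ideal[OF ideal_irrelevant_ideal ideal_irrelevant_ideal]
    by (simp add: ideal_mpoly_ring_iff)
  have "mp.span {Var i * Var j | i j. True} \<subseteq> (irrelevant_square :: ('n, 'k) mpoly set)"
    by (rule mp.span_minimal) (use Var_in subspace_if_ideal[OF sub] in auto)
  then show "rm.span {p. homogeneous 2 p} \<subseteq> (irrelevant_square :: ('n, 'k) mpoly set)"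
    using homogeneous_2_span sub by (intro rm.span_minimal) blast+
  have VV: "Var i * Var j \<in> rm.span {p :: ('n, 'k) mpoly. homogeneous 2 p}" for i j
    by (rule rm.span_base) (simp add: homogeneous_1_Var_mult)
  have VI: "Var i * q \<in> rm.span {p :: ('n, 'k) mpoly. homogeneous 2 p}" if "q \<in> rm.span (range Var)" for i q
    using that
  proof (induction rule: rm.span_induct_alt)
    case (step c x y)
    then obtain j where "x = Var j" by auto
    then have "Var i * (c * x + y) = c * (Var i * Var j) + Var i * y" by (simp add: algebra_simps)
    then show ?case using step VV by (metis rm.span_add rm.span_scale)
  qed (simp add: rm.span_zero)
  show "irrelevant_square \<subseteq> rm.span {p :: ('n, 'k) mpoly. homogeneous 2 p}"
  proof
    fix s :: "('n, 'k) mpoly" assume "s \<in> irrelevant_square"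
    then show "s \<in> rm.span {p :: ('n, 'k) mpoly. homogeneous 2 p}"
    proof (induction rule: ideal_prod.induct)
      case (prod p q)
      then have p: "p \<in> rm.span (range Var)" and q: "q \<in> rm.span (range Var)"
        by (simp_all add: irrelevant_ideal_def genideal_mpoly_ring)
      from p show ?case unfolding mpoly_ring_simps
      proof (induction rule: rm.span_induct_alt)
        case (step c x y)
        then obtain j where "x = Var j" by auto
        then have "(c * x + y) * q = c * (Var j * q) + y * q" by (simp add: algebra_simps)
        then show ?case using step VI[OF q] by (metis rm.span_add rm.span_scale)
      qed (simp add: rm.span_zero)
    qed (auto intro: rm.span_add)
  qed
qed

section \<open>Numbers of generators as dimensions\<close>

lemma finite_Var_products: "finite {Var i * Var j :: ('n::finite, 'k::field) mpoly | i j. True}"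
proof -
  have "{Var i * Var j :: ('n, 'k) mpoly | i j. True} = (\<lambda>(i, j). Var i * Var j) ` UNIV" by auto
  then show ?thesis by (simp only: finite_imageI finite)
qed

lemma quadric_basis:
  "\<exists>B :: ('n::finite, 'k::field) mpoly set. finite B \<and> (\<forall>q\<in>B. homogeneous 2 q) \<and>
    mp.independent B \<and> mp.span B = {p. homogeneous 2 p} \<and> card B = mp.dim {p :: ('n, 'k) mpoly. homogeneous 2 p}"
proof -
  obtain B :: "('n, 'k) mpoly set" where B: "B \<subseteq> {p. homogeneous 2 p}" "mp.independent B" "{p. homogeneous 2 p} \<subseteq> mp.span B"
    "card B = mp.dim {p :: ('n, 'k) mpoly. homogeneous 2 p}"
    using mp.basis_exists by blast
  have "finite B"
    using mp.independent_span_bound[OF finite_Var_products B(2)] B(1) homogeneous_2_span by blast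
  moreover have "mp.span B = {p. homogeneous 2 p}"
    using mp.span_subspace[OF B(1) B(3) subspace_homogeneous] .
  ultimately show ?thesis using B by (intro exI[of _ B]) auto
qed

text \<open>A basis of the quadrics generates. Conversely the generators counted by
  \<open>min_gens\<close> may be inhomogeneous, but the ideal has nothing below degree two, so the
  quadratic parts of any generating set span all quadrics.\<close>

lemma min_gens_irrelevant_square:
  "min_gens mpoly_ring (irrelevant_square :: ('n::finite, 'k::field) mpoly set) = mp.dim {p :: ('n, 'k) mpoly. homogeneous 2 p}"
  unfolding min_gens_def
proof (rule Least_equality)
  obtain B :: "('n, 'k) mpoly set" where B: "finite B" "\<And>q. q \<in> B \<Longrightarrow> homogeneous 2 q"
    "mp.independent B" "mp.span B = {p. homogeneous 2 p}" "card B = mp.dim {p :: ('n, 'k) mpoly. homogeneous 2 p}"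
    using quadric_basis[where 'n = 'n and 'k = 'k] by (elim exE conjE) blast
  have "rm.span B = irrelevant_square"
    unfolding irrelevant_square_eq
  proof (rule subset_antisym)
    show "rm.span B \<subseteq> rm.span {p. homogeneous 2 p}" using B(2) by (intro rm.span_mono) auto
    show "rm.span {p. homogeneous 2 p} \<subseteq> rm.span B"
      using span_le_genideal[of B] by (intro rm.span_minimal) (simp_all add: B(4))
  qed
  then show "\<exists>G. G \<subseteq> carrier mpoly_ring \<and> finite G \<and> card G = mp.dim {p :: ('n, 'k) mpoly. homogeneous 2 p} \<and>
      Idl\<^bsub>mpoly_ring\<^esub> G = (irrelevant_square :: ('n, 'k) mpoly set)"
    using B by (auto simp: genideal_mpoly_ring)
next
  fix n assume "\<exists>G. G \<subseteq> carrier mpoly_ring \<and> finite G \<and> card G = n \<and>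
      Idl\<^bsub>mpoly_ring\<^esub> G = (irrelevant_square :: ('n, 'k) mpoly set)"
  then obtain G :: "('n, 'k) mpoly set" where G: "finite G" "card G = n" "rm.span G = rm.span {p. homogeneous 2 p}"
    by (auto simp: genideal_mpoly_ring irrelevant_square_eq)
  have low: "hc 0 p = 0 \<and> hc 1 p = 0" if "p \<in> rm.span G" for p
    using genideal_quadrics_le[of "{p. homogeneous 2 p}" p] that G(3) by auto
  have "rm.span G \<subseteq> {p. hc 0 p = 0 \<and> hc 1 p = 0 \<and> hc 2 p \<in> mp.span (hc 2 ` G)}"
  proof (rule rm.span_minimal)
    show "G \<subseteq> {p. hc 0 p = 0 \<and> hc 1 p = 0 \<and> hc 2 p \<in> mp.span (hc 2 ` G)}"
      using low[OF rm.span_base] by (auto intro: mp.span_base)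
    show "rm.subspace {p. hc 0 p = 0 \<and> hc 1 p = 0 \<and> hc 2 p \<in> mp.span (hc 2 ` G)}"
      by (rule ideal_of_quadric_subspace) (rule mp.subspace_span)
  qed
  then have "{p. homogeneous 2 p} \<subseteq> mp.span (hc 2 ` G)"
    unfolding G(3) using rm.span_base[of _ "{p. homogeneous 2 p}"] by (force simp: hc_homogeneous)
  then have "mp.dim {p :: ('n, 'k) mpoly. homogeneous 2 p} \<le> card (hc 2 ` G)"
    using mp.dim_le_card G(1) by blast
  also have "\<dots> \<le> n" using card_image_le[OF G(1)] G(2) by blast
  finally show "mp.dim {p :: ('n, 'k) mpoly. homogeneous 2 p} \<le> n" .
qed

lemma Var_sq_nonzero: "Var i * Var i \<noteq> (0 :: ('n::finite, 'k::field) mpoly)"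
  by (simp add: Var_def mult_single) (metis lookup_single_eq lookup_zero zero_neq_one)

text \<open>A dimension count: an element outside the span of \<open>S\<close> would extend
  \<open>S\<close> to an independent set in the span of \<open>B\<close> with more than
  \<open>card B\<close> elements.\<close>

lemma independent_spans:
  fixes S :: "('n::finite, 'k::field) mpoly set"
  assumes "mp.independent S" "S \<subseteq> mp.span B" "finite B" "card B \<le> card S"
  shows "mp.span B \<subseteq> mp.span S"
proof
  fix x assume x: "x \<in> mp.span B"
  have fS: "finite S" using mp.independent_span_bound[OF assms(3,1,2)] by blast
  show "x \<in> mp.span S"
  proof (rule ccontr)
    assume n: "x \<notin> mp.span S"
    then have "x \<notin> S" using mp.span_base by blast
    moreover have "card (insert x S) \<le> card B"
      using mp.independent_span_bound[OF assms(3) mp.independent_insertI[OF n assms(1)]] x assms(2) by blast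
    ultimately show False using assms(4) fS by simp
  qed
qed

text \<open>Minimality makes the generating quadrics linearly independent, so they span a hyperplane
  in the space of all quadrics.\<close>

lemma hyperplane_of_quadrics:
  fixes I :: "('n::finite, 'k::field) mpoly set"
  assumes "minimally_generated_by_quadrics
     (min_gens mpoly_ring (irrelevant_square :: ('n, 'k) mpoly set) - 1) I"
  shows "\<exists>L. mpoly_functional L \<and> (\<exists>p. homogeneous 2 p \<and> L p \<noteq> 0) \<and>
     I = rm.span {p. homogeneous 2 p \<and> L p = 0}"
proof -
  let ?R2 = "{p :: ('n, 'k) mpoly. homogeneous 2 p}"
  from assms obtain G where G: "finite G" "card G = mp.dim ?R2 - 1" "\<And>q. q \<in> G \<Longrightarrow> homogeneous 2 q"
    "rm.span G = I" and min: "\<And>H. H \<subset> G \<Longrightarrow> rm.span H \<noteq> I"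
    by (auto simp: minimally_generated_by_quadrics_def minimal_generating_set_def genideal_mpoly_ring
        min_gens_irrelevant_square)
  have GR2: "mp.span G \<subseteq> ?R2" by (rule mp.span_minimal[OF _ subspace_homogeneous]) (use G(3) in auto)
  have ind: "mp.independent G"
  proof
    assume "mp.dependent G"
    then obtain g where g: "g \<in> G" "g \<in> mp.span (G - {g})" by (auto simp: mp.dependent_def)
    then have "g \<in> rm.span (G - {g})" using span_le_genideal by blast
    then have "rm.span G \<subseteq> rm.span (G - {g})"
      by (intro rm.span_minimal) (auto intro: rm.span_base)
    then have "rm.span (G - {g}) = I" using G(4) rm.span_mono[of "G - {g}" G] by blast
    then show False using min[of "G - {g}"] g(1) by blast
  qed
  obtain B :: "('n, 'k) mpoly set" where "finite B \<and> (\<forall>q\<in>B. homogeneous 2 q) \<and>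
    mp.independent B \<and> mp.span B = ?R2 \<and> card B = mp.dim ?R2"
    using quadric_basis ..
  then have B: "finite B" "\<And>q. q \<in> B \<Longrightarrow> homogeneous 2 q"
    "mp.independent B" "mp.span B = ?R2" "card B = mp.dim ?R2"
    by simp_all
  \<comment> \<open>The square of an arbitrary variable is a nonzero quadric. Hence the dimension is
    positive and the truncated subtraction of one is a true one.\<close>
  have "Var undefined * Var undefined \<in> mp.span B" by (simp add: B(4) homogeneous_1_Var_mult)
  then have "B \<noteq> {}" by (auto simp: Var_sq_nonzero)
  then have dim: "card B > 0" using B(1) by (simp add: card_gt_0_iff)
  have "\<not> ?R2 \<subseteq> mp.span G" using mp.dim_le_card[of ?R2 G] G(1,2) dim B(5) by linarith
  then obtain b where b: "homogeneous 2 b" "b \<notin> mp.span G" by blast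
  have ind2: "mp.independent (insert b G)" by (rule mp.independent_insertI[OF b(2) ind])
  have "b \<notin> G" using b(2) mp.span_base by blast
  then have "card (insert b G) = card B" using G(1,2) dim B(5) by simp
  then have sp: "?R2 \<subseteq> mp.span (insert b G)"
    using independent_spans[OF ind2, of B] B(1,4) b(1) G(3) by auto
  \<comment> \<open>\<open>b\<close> completes \<open>G\<close> to a basis of the quadrics, and
    \<open>L\<close> restricts there to the coordinate of \<open>b\<close>.\<close>
  obtain L where L: "mpoly_functional L" "\<And>v. v \<in> insert b G \<Longrightarrow> L v = (if v = b then 1 else 0)"
    using mpk.linear_independent_extend[OF ind2, of "\<lambda>v. if v = b then 1 else 0"] by blast
  have L0: "L p = 0" if "p \<in> mp.span G" for p
    using that
  proof (induction rule: mp.span_induct_alt)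
    case (step c x y)
    then show ?case using L(2)[of x] \<open>b \<notin> G\<close> by (auto simp: mpoly_functionalD[OF L(1)])
  qed (simp add: mpoly_functionalD[OF L(1)])
  have eq: "{p. homogeneous 2 p \<and> L p = 0} = mp.span G"
  proof
    show "mp.span G \<subseteq> {p. homogeneous 2 p \<and> L p = 0}" using GR2 L0 by blast
    show "{p. homogeneous 2 p \<and> L p = 0} \<subseteq> mp.span G"
    proof safe
      fix p assume p: "homogeneous 2 p" "L p = 0"
      then obtain k where k: "p - Const k * b \<in> mp.span G" using sp mp.span_breakdown_eq by blast
      then have "L (p - Const k * b) = 0" by (rule L0)
      then have "k = 0" using p(2) L(2)[of b] by (simp add: mpoly_functionalD[OF L(1)])
      then show "p \<in> mp.span G" using k by simp
    qed
  qed
  have "rm.span (mp.span G) = rm.span G"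
  proof (rule subset_antisym)
    show "rm.span (mp.span G) \<subseteq> rm.span G"
      by (rule rm.span_minimal[OF span_le_genideal]) (rule rm.subspace_span)
    show "rm.span G \<subseteq> rm.span (mp.span G)" by (rule rm.span_mono) (rule mp.span_superset)
  qed
  then show ?thesis using L(1) L(2)[of b] b(1) eq G(4) by (intro exI[of _ L]) auto
qed

section \<open>Degenerate forms\<close>

lemma coset_eq_iff:
  assumes "rm.subspace I"
  shows "I +>\<^bsub>mpoly_ring\<^esub> p = I +>\<^bsub>mpoly_ring\<^esub> q \<longleftrightarrow> p - q \<in> I"
  using mpr.quotient_eq_iff_same_a_r_cos[of I p q] assms by (simp add: ideal_mpoly_ring_iff)

lemma carrier_mpoly_quotient: "carrier (mpoly_ring Quot I) = range (\<lambda>p. I +>\<^bsub>mpoly_ring\<^esub> p)"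
  by (auto simp: FactRing_def A_RCOSETS_def')

lemma mpoly_quotient_simps:
  assumes "rm.subspace I"
  shows "(I +>\<^bsub>mpoly_ring\<^esub> p) \<otimes>\<^bsub>mpoly_ring Quot I\<^esub> (I +>\<^bsub>mpoly_ring\<^esub> q) = I +>\<^bsub>mpoly_ring\<^esub> (p * q)"
    "(I +>\<^bsub>mpoly_ring\<^esub> p) \<oplus>\<^bsub>mpoly_ring Quot I\<^esub> (I +>\<^bsub>mpoly_ring\<^esub> q) = I +>\<^bsub>mpoly_ring\<^esub> (p + q)"
    "\<one>\<^bsub>mpoly_ring Quot I\<^esub> = I +>\<^bsub>mpoly_ring\<^esub> 1"
    "\<zero>\<^bsub>mpoly_ring Quot I\<^esub> = I +>\<^bsub>mpoly_ring\<^esub> 0"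
proof -
  interpret ideal I mpoly_ring using assms by (simp add: ideal_mpoly_ring_iff)
  show "(I +>\<^bsub>mpoly_ring\<^esub> p) \<otimes>\<^bsub>mpoly_ring Quot I\<^esub> (I +>\<^bsub>mpoly_ring\<^esub> q) = I +>\<^bsub>mpoly_ring\<^esub> (p * q)"
    using ring_hom_mult[OF rcos_ring_hom, of p q] by simp
  show "(I +>\<^bsub>mpoly_ring\<^esub> p) \<oplus>\<^bsub>mpoly_ring Quot I\<^esub> (I +>\<^bsub>mpoly_ring\<^esub> q) = I +>\<^bsub>mpoly_ring\<^esub> (p + q)"
    using ring_hom_add[OF rcos_ring_hom, of p q] by simp
  show "\<one>\<^bsub>mpoly_ring Quot I\<^esub> = I +>\<^bsub>mpoly_ring\<^esub> 1"
    using ring_hom_one[OF rcos_ring_hom] by simp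
  show "\<zero>\<^bsub>mpoly_ring Quot I\<^esub> = I +>\<^bsub>mpoly_ring\<^esub> 0"
    using ring_hom_zero[OF rcos_ring_hom mpr.ring_axioms quotient_is_ring] by simp
qed

lemma cring_mpoly_quotient: "rm.subspace I \<Longrightarrow> cring (mpoly_ring Quot I)"
  using ideal.quotient_is_cring cring_mpoly_ring ideal_mpoly_ring_iff by blast

text \<open>Keeps all computations on polynomials: \<open>h\<close> is the composite of the quotient
  map and the localization map, and \<open>outside s\<close> says that \<open>s\<close> becomes an
  admissible denominator. By \<open>h_fraction\<close> and \<open>h_eq_iff\<close>, elements and
  equalities of the localization reduce to polynomials and membership in \<open>I\<close>.\<close>

locale mpoly_quotient_localization =
  fixes I :: "('n::finite, 'k::field) mpoly set" and P :: "('n, 'k) mpoly set set"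
  assumes I: "rm.subspace I" and P: "primeideal P (mpoly_ring Quot I)"
begin

abbreviation B where "B \<equiv> localization (mpoly_ring Quot I) P"

definition h :: "('n, 'k) mpoly \<Rightarrow> (('n, 'k) mpoly set \<times> ('n, 'k) mpoly set) set" where
  "h p = to_frac (mpoly_ring Quot I) P (I +>\<^bsub>mpoly_ring\<^esub> p)"

definition outside :: "('n, 'k) mpoly \<Rightarrow> bool" where
  "outside p \<longleftrightarrow> I +>\<^bsub>mpoly_ring\<^esub> p \<notin> P"

lemma cring_quotient: "cring (mpoly_ring Quot I)" by (rule cring_mpoly_quotient[OF I])

sublocale B: cring B by (rule cring_localization[OF cring_quotient P])

lemma coset_in_carrier: "I +>\<^bsub>mpoly_ring\<^esub> p \<in> carrier (mpoly_ring Quot I)"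
  by (auto simp: carrier_mpoly_quotient)

lemma h_closed [simp]: "h p \<in> carrier B"
  and h_mult: "h (p * q) = h p \<otimes>\<^bsub>B\<^esub> h q"
  and h_add: "h (p + q) = h p \<oplus>\<^bsub>B\<^esub> h q"
  and h_1: "h 1 = \<one>\<^bsub>B\<^esub>"
  and h_0: "h 0 = \<zero>\<^bsub>B\<^esub>"
proof -
  note hom = to_frac_ring_hom[OF cring_quotient P]
  show "h p \<in> carrier B" unfolding h_def by (rule ring_hom_closed[OF hom coset_in_carrier])
  show "h (p * q) = h p \<otimes>\<^bsub>B\<^esub> h q" unfolding h_def mpoly_quotient_simps(1)[OF I, symmetric]
    by (rule ring_hom_mult[OF hom coset_in_carrier coset_in_carrier])
  show "h (p + q) = h p \<oplus>\<^bsub>B\<^esub> h q" unfolding h_def mpoly_quotient_simps(2)[OF I, symmetric]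
    by (rule ring_hom_add[OF hom coset_in_carrier coset_in_carrier])
  show "h 1 = \<one>\<^bsub>B\<^esub>" unfolding h_def mpoly_quotient_simps(3)[OF I, symmetric]
    by (rule ring_hom_one[OF hom])
  show "h 0 = \<zero>\<^bsub>B\<^esub>" unfolding h_def mpoly_quotient_simps(4)[OF I, symmetric]
    by (rule ring_hom_zero[OF hom cring.axioms(1)[OF cring_quotient] B.ring_axioms])
qed

lemma h_diff: "h (p - q) = h p \<ominus>\<^bsub>B\<^esub> h q"
proof -
  have "h (p - q) \<oplus>\<^bsub>B\<^esub> h q = h p" by (simp flip: h_add)
  moreover have "h (p - q) = (h (p - q) \<oplus>\<^bsub>B\<^esub> h q) \<ominus>\<^bsub>B\<^esub> h q"
    using h_closed[of "p - q"] h_closed[of q] by algebra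
  ultimately show ?thesis by simp
qed

lemma h_Units: "outside s \<Longrightarrow> h s \<in> Units B"
  unfolding h_def outside_def by (rule to_frac_Units[OF cring_quotient P]) (simp add: coset_in_carrier)

lemma h_fraction:
  assumes "b \<in> carrier B"
  shows "\<exists>p s. outside s \<and> b \<otimes>\<^bsub>B\<^esub> h s = h p"
  using to_frac_surj[OF cring_quotient P assms] by (auto simp: carrier_mpoly_quotient h_def outside_def)

lemma h_eq_0_iff: "h p = \<zero>\<^bsub>B\<^esub> \<longleftrightarrow> (\<exists>u. outside u \<and> u * p \<in> I)"
proof -
  have "(\<exists>u\<in>carrier (mpoly_ring Quot I) - P. u \<otimes>\<^bsub>mpoly_ring Quot I\<^esub> (I +>\<^bsub>mpoly_ring\<^esub> p) = \<zero>\<^bsub>mpoly_ring Quot I\<^esub>) \<longleftrightarrow>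
      (\<exists>u. outside u \<and> (I +>\<^bsub>mpoly_ring\<^esub> u) \<otimes>\<^bsub>mpoly_ring Quot I\<^esub> (I +>\<^bsub>mpoly_ring\<^esub> p) = \<zero>\<^bsub>mpoly_ring Quot I\<^esub>)"
    unfolding carrier_mpoly_quotient outside_def by blast
  also have "\<dots> \<longleftrightarrow> (\<exists>u. outside u \<and> u * p \<in> I)"
    by (simp add: mpoly_quotient_simps[OF I] coset_eq_iff[OF I])
  finally show ?thesis unfolding h_def to_frac_eq_zero_iff[OF cring_quotient P coset_in_carrier] .
qed

lemma h_eq_iff: "h p = h q \<longleftrightarrow> (\<exists>u. outside u \<and> u * (p - q) \<in> I)"
  by (simp add: h_diff B.r_right_minus_eq flip: h_eq_0_iff)

end

text \<open>The origin as a point of the quotient: the constant term descends to cosets because it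
  vanishes on \<open>I\<close>, and its zero set is prime because constant terms multiply.\<close>

lemma primeideal_augmentation:
  fixes I :: "('n::finite, 'k::field) mpoly set"
  assumes I: "rm.subspace I" and I0: "\<And>p. p \<in> I \<Longrightarrow> Poly_Mapping.lookup p 0 = 0"
  defines "P \<equiv> {I +>\<^bsub>mpoly_ring\<^esub> p | p. Poly_Mapping.lookup p 0 = 0}"
  shows "primeideal P (mpoly_ring Quot I)" and "I +>\<^bsub>mpoly_ring\<^esub> p \<in> P \<longleftrightarrow> Poly_Mapping.lookup p 0 = 0"
proof -
  have mem: "I +>\<^bsub>mpoly_ring\<^esub> p \<in> P \<longleftrightarrow> Poly_Mapping.lookup p 0 = 0" for p
  proof
    assume "I +>\<^bsub>mpoly_ring\<^esub> p \<in> P"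
    then obtain q where "p - q \<in> I" "Poly_Mapping.lookup q 0 = 0" by (auto simp: P_def coset_eq_iff[OF I])
    then show "Poly_Mapping.lookup p 0 = 0" using I0[of "p - q"] by (simp add: lookup_minus)
  qed (auto simp: P_def)
  then show "I +>\<^bsub>mpoly_ring\<^esub> p \<in> P \<longleftrightarrow> Poly_Mapping.lookup p 0 = 0" .
  interpret A: cring "mpoly_ring Quot I" by (rule cring_mpoly_quotient[OF I])
  have PA: "x \<in> P \<Longrightarrow> \<exists>p. x = I +>\<^bsub>mpoly_ring\<^esub> p \<and> Poly_Mapping.lookup p 0 = 0" for x by (auto simp: P_def)
  have AA: "x \<in> carrier (mpoly_ring Quot I) \<Longrightarrow> \<exists>p. x = I +>\<^bsub>mpoly_ring\<^esub> p" for x by (auto simp: carrier_mpoly_quotient)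
  note simps = mpoly_quotient_simps[OF I]
  show "primeideal P (mpoly_ring Quot I)"
  proof (rule primeidealI)
    show "ideal P (mpoly_ring Quot I)"
    proof (rule idealI[OF A.ring_axioms])
      show "subgroup P (add_monoid (mpoly_ring Quot I))"
      proof (rule A.add.subgroupI)
        show "P \<subseteq> carrier (mpoly_ring Quot I)" by (auto simp: P_def carrier_mpoly_quotient)
        have "I +>\<^bsub>mpoly_ring\<^esub> 0 \<in> P" by (simp add: mem)
        then show "P \<noteq> {}" by blast
        fix x assume "x \<in> P"
        then obtain p where p: "x = I +>\<^bsub>mpoly_ring\<^esub> p" "Poly_Mapping.lookup p 0 = 0" using PA by blast
        have "\<ominus>\<^bsub>mpoly_ring Quot I\<^esub> x = I +>\<^bsub>mpoly_ring\<^esub> (- p)"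
          by (rule A.minus_equality) (auto simp: p simps carrier_mpoly_quotient)
        then show "\<ominus>\<^bsub>mpoly_ring Quot I\<^esub> x \<in> P" using p by (simp add: mem)
      next
        fix x y assume "x \<in> P" "y \<in> P"
        then show "x \<oplus>\<^bsub>mpoly_ring Quot I\<^esub> y \<in> P" by (auto dest!: PA simp: simps mem lookup_add)
      qed
      fix x y assume "x \<in> P" "y \<in> carrier (mpoly_ring Quot I)"
      then show "y \<otimes>\<^bsub>mpoly_ring Quot I\<^esub> x \<in> P" "x \<otimes>\<^bsub>mpoly_ring Quot I\<^esub> y \<in> P"
        by (auto dest!: PA AA simp: simps mem lookup_0_mult)
    qed
    have "I +>\<^bsub>mpoly_ring\<^esub> 1 \<notin> P" by (simp add: mem)
    then show "carrier (mpoly_ring Quot I) \<noteq> P" by (auto simp: carrier_mpoly_quotient)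
  qed (auto dest!: AA simp: simps mem lookup_0_mult A.cring_axioms intro: A.is_cring)
qed

lemma lookup_Const_0 [simp]: "Poly_Mapping.lookup (Const c :: ('n::finite, 'k::field) mpoly) 0 = c"
  by (simp add: Const_def)

lemma lookup_Var_0 [simp]: "Poly_Mapping.lookup (Var i :: ('n::finite, 'k::field) mpoly) 0 = 0"
  using irrelevant_ideal_iff[of "Var i"] by (simp add: irrelevant_ideal_def genideal_mpoly_ring rm.span_base)

lemma single_1_eq_iff [simp]: "Poly_Mapping.single i (Suc 0) = Poly_Mapping.single j (Suc 0) \<longleftrightarrow> i = j"
  by (metis lookup_single_eq lookup_single_not_eq nat.distinct(1))

lemma lincoeff_Var: "lincoeff i (Var j :: ('n::finite, 'k::field) mpoly) = (if i = j then 1 else 0)"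
  by (simp add: Var_def lookup_single when_def)

text \<open>If the symmetric form \<open>(v, v') \<mapsto> L (v * v')\<close> on linear forms is degenerate, a form \<open>w\<close> in its
  radical generates a copy of the residue field that splits off the maximal ideal.\<close>

lemma degenerate_not_gorenstein:
  fixes I :: "('n::finite, 'k::field) mpoly set"
  assumes I: "I = rm.span {p. homogeneous 2 p \<and> L p = 0}"
    and w: "homogeneous 1 w" and wi: "lincoeff i w \<noteq> 0" and ij: "i \<noteq> j"
    and rad: "\<And>k. L (Var k * w) = 0"
  shows "\<not> gorenstein_ideal mpoly_ring I"
proof
  assume G: "gorenstein_ideal mpoly_ring I"
  note Idef = I
  have sI: "rm.subspace I" by (simp add: I)
  have low: "Poly_Mapping.lookup p 0 = 0" "lincoeff l p = 0" if "p \<in> I" for p l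
  proof -
    have "hc 0 p = 0 \<and> hc 1 p = 0"
      using genideal_quadrics_le[of "{p. homogeneous 2 p \<and> L p = 0}" p] that by (auto simp: I)
    then have "Poly_Mapping.lookup (hc 0 p) 0 = 0" "lincoeff l (hc 1 p) = 0" by simp_all
    then show "Poly_Mapping.lookup p 0 = 0" "lincoeff l p = 0" by (simp_all add: lookup_hc)
  qed
  define P where "P = {I +>\<^bsub>mpoly_ring\<^esub> p | p. Poly_Mapping.lookup p 0 = 0}"
  note prime = primeideal_augmentation[OF sI low(1), folded P_def]
  interpret mpoly_quotient_localization I P
    by (intro mpoly_quotient_localization.intro sI prime(1))
  have out: "outside s \<longleftrightarrow> Poly_Mapping.lookup s 0 \<noteq> 0" for s by (simp add: outside_def prime)
  have fin: "finite_self_injective_dimension B"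
    using G prime(1) by (auto simp: gorenstein_ideal_def gorenstein_ring_def)
  have kill: "p * w \<in> I" if "Poly_Mapping.lookup p 0 = 0" for p
  proof -
    have "p \<in> rm.span (range Var)" using that irrelevant_ideal_iff[of p]
      by (simp add: irrelevant_ideal_def genideal_mpoly_ring)
    then show ?thesis
    proof (induction rule: rm.span_induct_alt)
      case (step c x y)
      then obtain k where "x = Var k" by auto
      have "Var k * w \<in> I" unfolding Idef by (rule rm.span_base) (use rad homogeneous_1_Var_mult[OF w] in auto)
      then show ?case using step \<open>x = Var k\<close> rm.subspace_add[OF sI] rm.subspace_scale[OF sI, of "Var k * w" c]
        by (simp add: algebra_simps)
    qed (simp add: rm.subspace_0[OF sI])
  qed
  have w0: "Poly_Mapping.lookup w 0 = 0" using lookup_hc[of 1 w 0] w by (simp add: homogeneous_iff_hc)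
  \<comment> \<open>Taking the annihilator of \<open>w\<close> as definition gives the relation
    \<open>m w = 0\<close> at once. By \<open>m_iff\<close> it consists of the fractions whose
    numerator vanishes at the origin, so it is the maximal ideal.\<close>
  define m where "m = {b \<in> carrier B. b \<otimes>\<^bsub>B\<^esub> h w = \<zero>\<^bsub>B\<^esub>}"
  have m_iff: "b \<in> m \<longleftrightarrow> Poly_Mapping.lookup p 0 = 0"
    if b: "b \<in> carrier B" and s: "outside s" and eq: "b \<otimes>\<^bsub>B\<^esub> h s = h p" for b p s
  proof -
    have "b \<in> m \<longleftrightarrow> h s \<otimes>\<^bsub>B\<^esub> (b \<otimes>\<^bsub>B\<^esub> h w) = h s \<otimes>\<^bsub>B\<^esub> \<zero>\<^bsub>B\<^esub>"
      using B.Units_l_cancel[OF h_Units[OF s], of "b \<otimes>\<^bsub>B\<^esub> h w" "\<zero>\<^bsub>B\<^esub>"] b by (simp add: m_def)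
    also have "h s \<otimes>\<^bsub>B\<^esub> (b \<otimes>\<^bsub>B\<^esub> h w) = h (p * w)"
      using b by (simp add: h_mult B.m_ac flip: eq)
    also have "h (p * w) = h s \<otimes>\<^bsub>B\<^esub> \<zero>\<^bsub>B\<^esub> \<longleftrightarrow> (\<exists>u. outside u \<and> u * (p * w) \<in> I)"
      by (simp add: h_eq_0_iff)
    also have "\<dots> \<longleftrightarrow> Poly_Mapping.lookup p 0 = 0"
    proof
      assume "\<exists>u. outside u \<and> u * (p * w) \<in> I"
      then obtain u where "outside u" "u * (p * w) \<in> I" by blast
      \<comment> \<open>The coefficient of \<open>u * (p * w)\<close> at \<open>x\<^sub>i\<close> is
        the product of the constant terms of \<open>u\<close> and \<open>p\<close> with that of
        \<open>w\<close> at \<open>x\<^sub>i\<close>, and elements of \<open>I\<close> have no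
        linear part.\<close>
      then show "Poly_Mapping.lookup p 0 = 0" using low(2)[of "u * (p * w)" i] wi
        unfolding lincoeff_mult lookup_0_mult out w0 by simp
    next
      assume "Poly_Mapping.lookup p 0 = 0"
      then have "1 * (p * w) \<in> I" using kill by simp
      moreover have "outside 1" by (simp add: out)
      ultimately show "\<exists>u. outside u \<and> u * (p * w) \<in> I" by blast
    qed
    finally show ?thesis .
  qed
  have m_h: "h p \<in> m \<longleftrightarrow> Poly_Mapping.lookup p 0 = 0" for p
    by (rule m_iff[of _ 1]) (simp_all add: out h_1)
  have mB: "a \<in> m \<Longrightarrow> a \<in> carrier B" for a by (simp add: m_def)
  have ideal_m: "ideal m B"
  proof (rule idealI[OF B.ring_axioms])
    show "subgroup m (add_monoid B)"
      by (rule B.add.subgroupI) (auto simp: m_def B.l_distr B.l_minus intro!: exI[of _ "\<zero>\<^bsub>B\<^esub>"])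
    fix a x assume a: "a \<in> m" and x: "x \<in> carrier B"
    then show "x \<otimes>\<^bsub>B\<^esub> a \<in> m" by (simp add: m_def B.m_assoc)
    then show "a \<otimes>\<^bsub>B\<^esub> x \<in> m" using B.m_comm[OF mB[OF a] x] by simp
  qed
  \<comment> \<open>The coefficient of the fraction \<open>p / s\<close> at
    \<open>x\<^sub>i\<close>, scaled to take the value one at \<open>w\<close>. It depends only on
    the fraction because numerators of elements of \<open>m\<close> vanish at the origin and
    \<open>I\<close> has no linear part.\<close>
  define t where "t b = (SOME c. \<exists>p s. outside s \<and> b \<otimes>\<^bsub>B\<^esub> h s = h p \<and>
     c = lincoeff i p / (Poly_Mapping.lookup s 0 * lincoeff i w))" for b
  have t: "t b = lincoeff i p / (Poly_Mapping.lookup s 0 * lincoeff i w)"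
    if b: "b \<in> m" and s: "outside s" and eq: "b \<otimes>\<^bsub>B\<^esub> h s = h p" for b p s
    unfolding t_def
  proof (rule some_equality)
    show "\<exists>p' s'. outside s' \<and> b \<otimes>\<^bsub>B\<^esub> h s' = h p' \<and>
      lincoeff i p / (Poly_Mapping.lookup s 0 * lincoeff i w) = lincoeff i p' / (Poly_Mapping.lookup s' 0 * lincoeff i w)"
      using s eq by blast
    fix c assume "\<exists>p' s'. outside s' \<and> b \<otimes>\<^bsub>B\<^esub> h s' = h p' \<and> c = lincoeff i p' / (Poly_Mapping.lookup s' 0 * lincoeff i w)"
    then obtain p' s' where s': "outside s'" and eq': "b \<otimes>\<^bsub>B\<^esub> h s' = h p'"
      and c: "c = lincoeff i p' / (Poly_Mapping.lookup s' 0 * lincoeff i w)" by blast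
    have p0: "Poly_Mapping.lookup p 0 = 0" using m_iff[OF mB[OF b] s eq] b by simp
    have p0': "Poly_Mapping.lookup p' 0 = 0" using m_iff[OF mB[OF b] s' eq'] b by simp
    have "h (p * s') = h (p' * s)"
      using mB[OF b] by (simp add: h_mult B.m_ac flip: eq eq')
    then obtain u where u: "outside u" "u * (p * s' - p' * s) \<in> I" by (auto simp: h_eq_iff)
    have "lincoeff i (p * s' - p' * s) = 0"
      using low(2)[OF u(2), of i] u(1) unfolding lincoeff_mult lookup_0_mult lookup_minus out p0 p0' by simp
    then show "c = lincoeff i p / (Poly_Mapping.lookup s 0 * lincoeff i w)"
      using s s' wi unfolding c lookup_minus lincoeff_mult out p0 p0' by (simp add: field_simps)
  qed
  define \<kappa> where "\<kappa> b = h (Const (t b))" for b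
  have "\<exists>b\<in>carrier B. \<forall>a\<in>m. a \<otimes>\<^bsub>B\<^esub> b = \<kappa> a \<otimes>\<^bsub>B\<^esub> h w"
  proof (rule finite_self_injective_dimension_extends_socle_map[OF fin ideal_m])
    show hw: "h w \<in> m" by (simp add: m_h w0)
    show "a \<otimes>\<^bsub>B\<^esub> h w = \<zero>\<^bsub>B\<^esub>" if "a \<in> m" for a using that by (simp add: m_def)
    show "\<kappa> a \<in> carrier B" for a by (simp add: \<kappa>_def)
    have "t (h w) = 1" using t[OF hw, of 1 w] wi by (simp add: out h_1)
    then show "\<kappa> (h w) \<ominus>\<^bsub>B\<^esub> \<one>\<^bsub>B\<^esub> \<in> m"
      using m_h[of 0] by (simp add: \<kappa>_def h_1 h_0 a_minus_def B.r_neg)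
    show "\<kappa> (a \<oplus>\<^bsub>B\<^esub> b) \<ominus>\<^bsub>B\<^esub> (\<kappa> a \<oplus>\<^bsub>B\<^esub> \<kappa> b) \<in> m" if a: "a \<in> m" and b: "b \<in> m" for a b
    proof -
      obtain p s where ps: "outside s" "a \<otimes>\<^bsub>B\<^esub> h s = h p" using h_fraction[OF mB[OF a]] by blast
      obtain q r where qr: "outside r" "b \<otimes>\<^bsub>B\<^esub> h r = h q" using h_fraction[OF mB[OF b]] by blast
      have p0: "Poly_Mapping.lookup p 0 = 0" using m_iff[OF mB[OF a] ps] a by simp
      have q0: "Poly_Mapping.lookup q 0 = 0" using m_iff[OF mB[OF b] qr] b by simp
      have ab: "a \<oplus>\<^bsub>B\<^esub> b \<in> m" using a b by (simp add: m_def B.l_distr)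
      have o: "outside (s * r)" using ps qr by (simp add: out lookup_0_mult)
      have eq: "(a \<oplus>\<^bsub>B\<^esub> b) \<otimes>\<^bsub>B\<^esub> h (s * r) = h (p * r + q * s)"
        using mB[OF a] mB[OF b] by (simp add: h_mult h_add B.l_distr B.r_distr B.m_ac flip: ps(2) qr(2))
      have "t (a \<oplus>\<^bsub>B\<^esub> b) = t a + t b"
        using ps(1) qr(1) wi unfolding t[OF a ps] t[OF b qr] t[OF ab o eq] out lincoeff_mult lookup_0_mult lookup_add p0 q0
        by (simp add: field_simps)
      then show ?thesis using m_h[of 0] by (simp add: \<kappa>_def Const_add h_add h_0 a_minus_def B.r_neg)
    qed
    show "\<kappa> (r \<otimes>\<^bsub>B\<^esub> a) \<ominus>\<^bsub>B\<^esub> (r \<otimes>\<^bsub>B\<^esub> \<kappa> a) \<in> m" if r: "r \<in> carrier B" and a: "a \<in> m" for r a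
    proof -
      obtain p s where ps: "outside s" "a \<otimes>\<^bsub>B\<^esub> h s = h p" using h_fraction[OF mB[OF a]] by blast
      obtain q e where qe: "outside e" "r \<otimes>\<^bsub>B\<^esub> h e = h q" using h_fraction[OF r] by blast
      have p0: "Poly_Mapping.lookup p 0 = 0" using m_iff[OF mB[OF a] ps] a by simp
      have ra: "r \<otimes>\<^bsub>B\<^esub> a \<in> m" using ideal.I_l_closed[OF ideal_m a r] .
      have o: "outside (e * s)" using ps qe by (simp add: out lookup_0_mult)
      have eq: "(r \<otimes>\<^bsub>B\<^esub> a) \<otimes>\<^bsub>B\<^esub> h (e * s) = h (q * p)"
        using mB[OF a] r by (simp add: h_mult B.m_ac flip: ps(2) qe(2))
      have T: "t (r \<otimes>\<^bsub>B\<^esub> a) * Poly_Mapping.lookup e 0 = Poly_Mapping.lookup q 0 * t a"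
        using ps(1) qe(1) wi unfolding t[OF a ps] t[OF ra o eq] out lincoeff_mult lookup_0_mult p0
        by (simp add: field_simps)
      have "(\<kappa> (r \<otimes>\<^bsub>B\<^esub> a) \<ominus>\<^bsub>B\<^esub> (r \<otimes>\<^bsub>B\<^esub> \<kappa> a)) \<otimes>\<^bsub>B\<^esub> h e =
          \<kappa> (r \<otimes>\<^bsub>B\<^esub> a) \<otimes>\<^bsub>B\<^esub> h e \<ominus>\<^bsub>B\<^esub> (r \<otimes>\<^bsub>B\<^esub> h e) \<otimes>\<^bsub>B\<^esub> \<kappa> a"
        using r h_closed[of e] h_closed[of "Const (t a)"] h_closed[of "Const (t (r \<otimes>\<^bsub>B\<^esub> a))"] unfolding \<kappa>_def by algebra
      also have "\<dots> = h (Const (t (r \<otimes>\<^bsub>B\<^esub> a)) * e - q * Const (t a))"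
        unfolding qe(2) \<kappa>_def by (simp add: h_diff h_mult)
      finally have "(\<kappa> (r \<otimes>\<^bsub>B\<^esub> a) \<ominus>\<^bsub>B\<^esub> (r \<otimes>\<^bsub>B\<^esub> \<kappa> a)) \<otimes>\<^bsub>B\<^esub> h e = h (Const (t (r \<otimes>\<^bsub>B\<^esub> a)) * e - q * Const (t a))" .
      then show ?thesis
        using m_iff[of "\<kappa> (r \<otimes>\<^bsub>B\<^esub> a) \<ominus>\<^bsub>B\<^esub> (r \<otimes>\<^bsub>B\<^esub> \<kappa> a)" e] qe(1) r T
        by (simp add: \<kappa>_def lookup_minus lookup_0_mult)
    qed
  qed
  then obtain b where b: "b \<in> carrier B" and bm: "\<And>a. a \<in> m \<Longrightarrow> a \<otimes>\<^bsub>B\<^esub> b = \<kappa> a \<otimes>\<^bsub>B\<^esub> h w" by blast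
  \<comment> \<open>The contradiction: \<open>b\<close> fixes \<open>w\<close>, so its numerator and
    denominator agree at the origin and \<open>b\<close> is a unit. But \<open>t\<close> vanishes at
    \<open>x\<^sub>j\<close>, so \<open>b\<close> also annihilates \<open>x\<^sub>j\<close>, which
    is nonzero in the localization since it is linear.\<close>
  obtain q e where qe: "outside e" "b \<otimes>\<^bsub>B\<^esub> h e = h q" using h_fraction[OF b] by blast
  have hw: "h w \<in> m" by (simp add: m_h w0)
  have "t (h w) = 1" using t[OF hw, of 1 w] wi by (simp add: out h_1)
  then have "h w \<otimes>\<^bsub>B\<^esub> b = h w" using bm[OF hw] by (simp add: \<kappa>_def h_1)
  then have "h w \<otimes>\<^bsub>B\<^esub> (b \<otimes>\<^bsub>B\<^esub> h e) = h w \<otimes>\<^bsub>B\<^esub> h e" using b by (metis B.m_assoc h_closed)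
  then have "h (w * q) = h (w * e)" by (simp add: qe(2) h_mult)
  then obtain u where u: "outside u" "u * (w * q - w * e) \<in> I" by (auto simp: h_eq_iff)
  then have q0: "Poly_Mapping.lookup q 0 = Poly_Mapping.lookup e 0"
    using low(2)[OF u(2), of i] wi unfolding lincoeff_mult lookup_0_mult lookup_minus out w0 by simp
  have hv: "h (Var j) \<in> m" by (simp add: m_h)
  have "t (h (Var j)) = 0" using t[OF hv, of 1 "Var j"] ij by (simp add: out h_1 lincoeff_Var[simplified])
  then have "h (Var j) \<otimes>\<^bsub>B\<^esub> b = \<zero>\<^bsub>B\<^esub>" using bm[OF hv] by (simp add: \<kappa>_def h_0)
  then have "h (Var j) \<otimes>\<^bsub>B\<^esub> (b \<otimes>\<^bsub>B\<^esub> h e) = \<zero>\<^bsub>B\<^esub>" using b by (metis B.m_assoc B.l_null h_closed)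
  then have "h (Var j * q) = \<zero>\<^bsub>B\<^esub>" by (simp add: qe(2) h_mult)
  then obtain u' where u': "outside u'" "u' * (Var j * q) \<in> I" by (auto simp: h_eq_0_iff)
  then show False
    using low(2)[OF u'(2), of j] qe(1) q0 unfolding lincoeff_mult lookup_0_mult out by (simp add: lincoeff_Var[simplified])
qed

section \<open>Dual bases of linear forms\<close>

lemma functional_zero_on_quadrics:
  assumes L: "mpoly_functional L" and "\<And>i j. L (Var i * Var j) = 0" and p: "homogeneous 2 p"
  shows "L p = 0"
  using homogeneous_2_span[OF p]
proof (induction rule: mp.span_induct_alt)
  case (step c x y)
  then show ?case using assms(2) by (auto simp: mpoly_functionalD[OF L])
qed (simp add: mpoly_functionalD[OF L])

section \<open>Linear forms and the bilinear form of \<open>L\<close>\<close>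

lemma inj_Var: "inj (Var :: 'n \<Rightarrow> ('n::finite, 'k::field) mpoly)"
proof (rule injI)
  fix i j assume "(Var i :: ('n, 'k) mpoly) = Var j"
  then have "lincoeff i (Var i :: ('n, 'k) mpoly) = lincoeff i (Var j)" by simp
  then show "i = j" by (simp add: lincoeff_Var[simplified] split: if_splits)
qed

lemma independent_Var: "mp.independent (range (Var :: 'n \<Rightarrow> ('n::finite, 'k::field) mpoly))"
proof
  assume "mp.dependent (range (Var :: 'n \<Rightarrow> ('n, 'k) mpoly))"
  then obtain i where i: "(Var i :: ('n, 'k) mpoly) \<in> mp.span (range Var - {Var i})" by (auto simp: mp.dependent_def)
  have "lincoeff i p = 0" if "p \<in> mp.span (range Var - {Var i :: ('n, 'k) mpoly})" for p
    using that
  proof (induction rule: mp.span_induct_alt)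
    case (step c x y)
    then show ?case by (auto simp: lookup_add lookup_Const_mult lincoeff_Var[simplified] split: if_splits)
  qed simp
  from this[OF i] show False by (simp add: lincoeff_Var[simplified])
qed

lemma span_Var: "mp.span (range Var) = {p. homogeneous 1 p}"
proof
  show "mp.span (range Var) \<subseteq> {p. homogeneous 1 p}"
    by (rule mp.span_minimal[OF _ subspace_homogeneous]) auto
  show "{p. homogeneous 1 p} \<subseteq> mp.span (range Var)"
  proof
    fix p assume "p \<in> {p. homogeneous 1 p}"
    then have "p = (\<Sum>i\<in>UNIV. Const (lincoeff i p) * Var i)" using homogeneous_1_eq by blast
    also have "\<dots> \<in> mp.span (range Var)" by (intro mp.span_sum mp.span_scale mp.span_base rangeI)
    finally show "p \<in> mp.span (range Var)" .
  qed
qed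

text \<open>The endomorphism \<open>T\<close> of the space of linear forms has the Gram matrix of
  the bilinear form as its matrix. Nondegeneracy makes it injective, hence surjective, and
  \<open>y j\<close> is a preimage of the variable with index \<open>j\<close>.\<close>

lemma dual_linear_forms:
  fixes L :: "('n::finite, 'k::field) mpoly \<Rightarrow> 'k"
  assumes L: "mpoly_functional L"
    and nondeg: "\<And>w. homogeneous 1 w \<Longrightarrow> (\<And>i. L (Var i * w) = 0) \<Longrightarrow> w = 0"
  shows "\<exists>y. (\<forall>j. homogeneous 1 (y j)) \<and> (\<forall>i j. L (Var i * y j) = (if i = j then 1 else 0))"
proof -
  interpret endo: vector_space_pair "\<lambda>c (p :: ('n, 'k) mpoly). Const c * p" "\<lambda>c (p :: ('n, 'k) mpoly). Const c * p" ..
  define T where "T w = (\<Sum>i\<in>UNIV. Const (L (Var i * w)) * Var i)" for w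
  have linT: "Vector_Spaces.linear (\<lambda>c p. Const c * p) (\<lambda>c p. Const c * p) T"
    unfolding Vector_Spaces.linear_iff
  proof (intro conjI allI mp.vector_space_axioms)
    fix v w c
    show "T (v + w) = T v + T w"
      by (simp add: T_def distrib_left distrib_right mpoly_functionalD[OF L] Const_add sum.distrib)
    have "L (Var i * (Const c * v)) = c * L (Var i * v)" for i
      using mpoly_functionalD(2)[OF L, of c "Var i * v"] by (simp add: mult.left_commute)
    then show "T (Const c * v) = Const c * T v"
      by (simp add: T_def sum_distrib_left)
  qed
  have coef: "lincoeff i (T w) = L (Var i * w)" for i w
    by (simp add: T_def lookup_sum lookup_Const_mult lincoeff_Var[simplified] if_distrib cong: if_cong)
  have inj: "inj_on T (mp.span (range Var))"
  proof (subst endo.linear_inj_on_iff_eq_0[OF linT mp.subspace_span], intro ballI impI)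
    fix w assume "w \<in> mp.span (range (Var :: 'n \<Rightarrow> ('n, 'k) mpoly))" "T w = 0"
    then show "w = 0" using coef[where w = w] by (intro nondeg) (auto simp: span_Var)
  qed
  have "mp.independent (T ` range Var)"
    by (rule endo.linear_independent_injective_image[OF linT independent_Var inj])
  moreover have "T ` range Var \<subseteq> mp.span (range Var)"
    unfolding T_def by (intro image_subsetI mp.span_sum mp.span_scale mp.span_base rangeI)
  moreover have "card (range (Var :: 'n \<Rightarrow> ('n, 'k) mpoly)) \<le> card (T ` range Var)"
    using card_image[OF inj_on_subset[OF inj mp.span_superset]] by simp
  ultimately have "mp.span (range Var) \<subseteq> mp.span (T ` range Var)"
    by (rule independent_spans[OF _ _ finite_imageI[OF finite]])
  also have "\<dots> = T ` mp.span (range Var)" by (rule endo.linear_span_image[OF linT])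
  finally have "\<forall>j. \<exists>v. homogeneous 1 v \<and> Var j = T v"
    using mp.span_base[of "Var _" "range Var"] by (auto simp: span_Var subset_iff image_iff)
  then obtain y where y: "\<And>j. homogeneous 1 (y j)" "\<And>j. Var j = T (y j)" by metis
  have "L (Var i * y j) = (if i = j then 1 else 0)" for i j
    using coef[where i = i and w = "y j"] lincoeff_Var[where i = i and j = j and 'k = 'k] by (simp flip: y(2))
  then show ?thesis using y(1) by blast
qed

text \<open>The products \<open>x\<^sub>i y\<^sub>j\<close> span all quadrics, and modulo the listed
  generators each of them is \<open>L (x\<^sub>i y\<^sub>j)\<close> times the one product
  \<open>Var i1 * y i1\<close>. By linearity a quadric \<open>p\<close> is congruent to
  \<open>L p\<close> times that product, so the kernel of \<open>L\<close> lies in the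
  ideal.\<close>

lemma pairing_ideal_eq:
  fixes L :: "('n::finite, 'k::field) mpoly \<Rightarrow> 'k"
  assumes L: "mpoly_functional L" and y: "\<And>j. homogeneous 1 (y j)"
    and dual: "\<And>i j. L (Var i * y j) = (if i = j then 1 else 0)"
    and sp: "\<And>k. Var k \<in> mp.span (range y)"
  shows "pairing_ideal i1 y = rm.span {p. homogeneous 2 p \<and> L p = 0}"
proof -
  let ?S = "{Var i * y j | i j. i \<noteq> j} \<union> {Var i1 * y i1 - Var j * y j | j. j \<noteq> i1}"
  note LD = mpoly_functionalD[OF L]
  have h2: "homogeneous 2 (Var i * y j)" for i j by (rule homogeneous_1_Var_mult[OF y])
  have S: "pairing_ideal i1 y = rm.span ?S" by (simp add: pairing_ideal_def genideal_mpoly_ring)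
  have diag: "Var j * y j - Var i1 * y i1 \<in> rm.span ?S" for j
  proof (cases "j = i1")
    case False
    then have "- (Var i1 * y i1 - Var j * y j) \<in> rm.span ?S" by (intro rm.span_neg rm.span_base) auto
    then show ?thesis by simp
  qed (simp add: rm.span_zero)
  have 1: "Var i * v - Const (L (Var i * v)) * (Var i1 * y i1) \<in> rm.span ?S" if "v \<in> mp.span (range y)" for i v
    using that
  proof (induction rule: mp.span_induct_alt)
    case base
    then show ?case by (simp add: LD rm.span_zero)
  next
    case (step c x v)
    then obtain j where j: "x = y j" by auto
    have "Var i * y j - Const (L (Var i * y j)) * (Var i1 * y i1) \<in> rm.span ?S"
      using diag[of i] by (cases "i = j") (auto simp: dual intro!: rm.span_base)
    then have "Const c * (Var i * y j - Const (L (Var i * y j)) * (Var i1 * y i1)) +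
        (Var i * v - Const (L (Var i * v)) * (Var i1 * y i1)) \<in> rm.span ?S"
      by (intro rm.span_add rm.span_scale step.IH)
    moreover have "L (Var i * (Const c * x + v)) = c * L (Var i * y j) + L (Var i * v)"
      by (simp add: j distrib_left LD mult.left_commute[of "Var _" "Const _"])
    ultimately show ?case by (simp add: j Const_add Const_mult algebra_simps del: mp.scale_scale)
  qed
  have 2: "p - Const (L p) * (Var i1 * y i1) \<in> rm.span ?S" if "homogeneous 2 p" for p
    using homogeneous_2_span[OF that]
  proof (induction rule: mp.span_induct_alt)
    case base
    then show ?case by (simp add: LD rm.span_zero)
  next
    case (step c x v)
    then have "x - Const (L x) * (Var i1 * y i1) \<in> rm.span ?S" using 1[OF sp] by auto
    then have "Const c * (x - Const (L x) * (Var i1 * y i1)) + (v - Const (L v) * (Var i1 * y i1)) \<in> rm.span ?S"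
      by (intro rm.span_add rm.span_scale step.IH)
    moreover have "Const c * x + v - Const (L (Const c * x + v)) * (Var i1 * y i1) =
        Const c * (x - Const (L x) * (Var i1 * y i1)) + (v - Const (L v) * (Var i1 * y i1))"
      unfolding LD Const_add Const_mult by (simp add: algebra_simps del: mp.scale_scale)
    ultimately show ?case by (simp only:)
  qed
  show ?thesis
    unfolding S
  proof (rule subset_antisym)
    show "rm.span ?S \<subseteq> rm.span {p. homogeneous 2 p \<and> L p = 0}"
      by (rule rm.span_mono) (auto simp: LD dual intro!: h2 homogeneous_diff)
    show "rm.span {p. homogeneous 2 p \<and> L p = 0} \<subseteq> rm.span ?S"
      by (rule rm.span_minimal) (use 2 in \<open>auto, fastforce\<close>)
  qed
qed

lemma gorenstein_imp_pairing_ideal: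
  fixes I :: "('n::finite, 'k::field) mpoly set" and i1 :: 'n
  assumes G: "gorenstein_ideal mpoly_ring I"
    and min: "minimally_generated_by_quadrics (min_gens mpoly_ring (irrelevant_square :: ('n, 'k) mpoly set) - 1) I"
  shows "\<exists>y :: 'n \<Rightarrow> ('n, 'k) mpoly. independent_linear_forms y \<and> I = pairing_ideal i1 y"
proof -
  obtain L p where L: "mpoly_functional L" and p: "homogeneous 2 p" "L p \<noteq> 0"
    and I: "I = rm.span {p. homogeneous 2 p \<and> L p = 0}"
    using hyperplane_of_quadrics[OF min] by blast
  note LD = mpoly_functionalD[OF L]
  have nondeg: "w = 0" if w: "homogeneous 1 w" and rad: "\<And>k. L (Var k * w) = 0" for w
  proof (rule ccontr)
    assume "w \<noteq> 0"
    have "\<exists>i. lincoeff i w \<noteq> 0"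
    proof (rule ccontr)
      assume "\<nexists>i. lincoeff i w \<noteq> 0"
      then have "(\<Sum>i\<in>UNIV. Const (lincoeff i w) * Var i) = 0" by simp
      then show False using homogeneous_1_eq[OF w] \<open>w \<noteq> 0\<close> by simp
    qed
    then obtain i where i: "lincoeff i w \<noteq> 0" ..
    show False
    proof (cases "\<exists>j. i \<noteq> j")
      case True
      then show False using degenerate_not_gorenstein[OF I w i _ rad] G by blast
    next
      \<comment> \<open>With a single variable a degenerate form is zero, so \<open>L\<close> would
        vanish on all quadrics.\<close>
      case False
      then have all: "k = i" for k by metis
      then have "(UNIV :: 'n set) = {i}" by blast
      then have "(\<Sum>l\<in>UNIV. Const (lincoeff l w) * Var l) = (\<Sum>l\<in>{i}. Const (lincoeff l w) * Var l)"
        by (rule sum.cong) (rule refl)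
      then have "(\<Sum>l\<in>UNIV. Const (lincoeff l w) * Var l) = Const (lincoeff i w) * Var i" by simp
      then have "w = Const (lincoeff i w) * Var i" using homogeneous_1_eq[OF w] by (simp only:)
      then have "L (Var i * Var i) = 0" using rad[of i] i LD(2)[of "lincoeff i w" "Var i * Var i"]
        by (metis mult.left_commute mult_eq_0_iff)
      then have "L (Var k * Var l) = 0" for k l using all[of k] all[of l] by simp
      then show False using functional_zero_on_quadrics[OF L _ p(1)] p(2) by blast
    qed
  qed
  obtain y where y: "\<And>j. homogeneous 1 (y j)" and dual: "\<And>i j. L (Var i * y j) = (if i = j then 1 else 0)"
    using dual_linear_forms[OF L nondeg] by blast
  have "independent_linear_forms y"
    unfolding independent_linear_forms_def
  proof (intro conjI allI impI y)
    fix c j assume "(\<Sum>j\<in>UNIV. Const (c j) * y j) = 0"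
    then have "0 = L (Var j * (\<Sum>j\<in>UNIV. Const (c j) * y j))" by (simp add: LD)
    also have "\<dots> = (\<Sum>k\<in>UNIV. L (Const (c k) * (Var j * y k)))"
      by (simp add: sum_distrib_left LD(6) mult.left_commute)
    also have "\<dots> = c j" by (simp add: LD(2) dual if_distrib cong: if_cong)
    finally show "c j = 0" by simp
  qed
  moreover have "Var k \<in> mp.span (range y)" for k
  proof -
    \<comment> \<open>The difference between a variable and its expected expansion in the dual
      basis; it pairs to zero with every variable, so nondegeneracy removes it.\<close>
    define u where "u = Var k - (\<Sum>j\<in>UNIV. Const (L (Var k * Var j)) * y j)"
    have "u = 0"
    proof (rule nondeg)
      show "homogeneous 1 u"
        unfolding u_def by (intro homogeneous_diff homogeneous_sum homogeneous_Const_mult y) simp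
      fix i
      have "L (Var i * (\<Sum>j\<in>UNIV. Const (L (Var k * Var j)) * y j)) =
          (\<Sum>j\<in>UNIV. L (Const (L (Var k * Var j)) * (Var i * y j)))"
        by (simp add: sum_distrib_left LD(6) mult.left_commute)
      also have "\<dots> = L (Var k * Var i)" by (simp add: LD(2) dual if_distrib cong: if_cong)
      finally show "L (Var i * u) = 0" by (simp add: u_def right_diff_distrib LD mult.commute)
    qed
    then have "Var k = (\<Sum>j\<in>UNIV. Const (L (Var k * Var j)) * y j)" by (simp add: u_def)
    also have "\<dots> \<in> mp.span (range y)" by (intro mp.span_sum mp.span_scale mp.span_base rangeI)
    finally show ?thesis .
  qed
  ultimately show ?thesis using pairing_ideal_eq[OF L y dual] I by metis
qed

text \<open>There are as many forms as variables. Since independence in \<open>mp\<close> concerns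
  sets, distinctness of the \<open>y j\<close> has to be shown as well: an equality would give the
  relation with coefficients \<open>1\<close> and \<open>-1\<close>.\<close>

lemma independent_linear_forms_span:
  fixes y :: "'n::finite \<Rightarrow> ('n, 'k::field) mpoly"
  assumes y: "independent_linear_forms y"
  shows "Var k \<in> mp.span (range y)"
proof -
  have ind: "c j = 0" if "(\<Sum>j\<in>UNIV. Const (c j) * y j) = 0" for c :: "'n \<Rightarrow> 'k" and j
    using y that by (simp add: independent_linear_forms_def)
  have inj: "inj y"
  proof (rule injI)
    fix i j assume eq: "y i = y j"
    show "i = j"
    proof (rule ccontr)
      assume ij: "i \<noteq> j"
      define c where "c k = (if k = i then 1 else 0) - (if k = j then 1 else (0::'k))" for k
      have "Const (c k) * y k = (if k = i then y i else 0) - (if k = j then y j else 0)" for k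
        using ij by (auto simp: c_def Const_def single_uminus)
      then have "(\<Sum>k\<in>UNIV. Const (c k) * y k) = 0" by (simp add: sum_subtractf eq)
      then have "c i = 0" by (rule ind)
      then show False using ij by (simp add: c_def)
    qed
  qed
  have "mp.independent (range y)"
  proof (rule mp.independent_if_scalars_zero)
    fix f x assume f: "(\<Sum>x\<in>range y. Const (f x) * x) = 0" and x: "x \<in> range y"
    then have "(\<Sum>j\<in>UNIV. Const (f (y j)) * y j) = 0" by (simp add: sum.reindex[OF inj])
    then have "f (y j) = 0" for j by (rule ind[of "\<lambda>j. f (y j)"])
    then show "f x = 0" using x by auto
  qed simp
  moreover have "range y \<subseteq> mp.span (range Var)"
    using y by (auto simp: span_Var independent_linear_forms_def)
  moreover have "card (range (Var :: 'n \<Rightarrow> ('n, 'k) mpoly)) \<le> card (range y)"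
    by (subst (1 2) card_image) (simp_all add: inj inj_Var)
  ultimately have "mp.span (range Var) \<subseteq> mp.span (range y)" 
    by (rule independent_spans[OF _ _ finite_imageI[OF finite]])
  then show ?thesis using mp.span_base[of "Var k" "range Var"] by blast
qed

text \<open>The generator count supplies some functional \<open>L\<close> that defines the ideal. It
  kills the generators, hence the mixed products, and takes a common value \<open>c\<close> on all
  \<open>x\<^sub>j y\<^sub>j\<close>. If \<open>c\<close> were zero, \<open>L\<close> would vanish
  on every quadric; so dividing by \<open>c\<close> gives the duality.\<close>

lemma pairing_ideal_functional:
  fixes y :: "'n::finite \<Rightarrow> ('n, 'k::field) mpoly"
  assumes y: "independent_linear_forms y"
    and min: "minimally_generated_by_quadrics
      (min_gens mpoly_ring (irrelevant_square :: ('n, 'k) mpoly set) - 1) (pairing_ideal i1 y)"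
  shows "\<exists>L. mpoly_functional L \<and> (\<forall>i j. L (Var i * y j) = (if i = j then 1 else 0))"
proof -
  obtain L p where L: "mpoly_functional L" and p: "homogeneous 2 p" "L p \<noteq> 0"
    and I: "pairing_ideal i1 y = rm.span {p. homogeneous 2 p \<and> L p = 0}"
    using hyperplane_of_quadrics[OF min] by blast
  note LD = mpoly_functionalD[OF L]
  have y1: "homogeneous 1 (y j)" for j using y by (simp add: independent_linear_forms_def)
  have h2: "homogeneous 2 (Var i * y j)" for i j by (rule homogeneous_1_Var_mult[OF y1])
  \<comment> \<open>The quadratic part of an element of the ideal is a linear combination of
    generating quadrics, so the ideal contains no quadric outside the kernel of
    \<open>L\<close>.\<close>
  have LI: "L q = 0" if "q \<in> pairing_ideal i1 y" "homogeneous 2 q" for q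
  proof -
    have sub: "mp.subspace {p. homogeneous 2 p \<and> L p = 0}"
      by (rule mp.subspaceI) (auto simp: LD intro: homogeneous_add homogeneous_Const_mult)
    have "hc 2 q \<in> mp.span {p. homogeneous 2 p \<and> L p = 0}"
      using genideal_quadrics_le[of "{p. homogeneous 2 p \<and> L p = 0}" q] that(1) by (simp add: I)
    then have "hc 2 q \<in> {p. homogeneous 2 p \<and> L p = 0}" using mp.span_minimal[OF subset_refl sub] by blast
    then show ?thesis using hc_homogeneous[OF that(2)] by simp
  qed
  define c where "c = L (Var i1 * y i1)"
  have gen: "Var i * y j \<in> pairing_ideal i1 y" if "i \<noteq> j" for i j
    unfolding pairing_ideal_def genideal_mpoly_ring using that by (intro rm.span_base) auto
  have gen2: "Var i1 * y i1 - Var j * y j \<in> pairing_ideal i1 y" if "j \<noteq> i1" for j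
    unfolding pairing_ideal_def genideal_mpoly_ring using that by (intro rm.span_base) auto
  have off: "L (Var i * y j) = 0" if "i \<noteq> j" for i j
    using LI[OF gen[OF that] h2] .
  have dia: "L (Var j * y j) = c" for j
  proof (cases "j = i1")
    case False
    then show ?thesis using LI[OF gen2[OF False] homogeneous_diff[OF h2 h2]] by (simp add: LD c_def)
  qed (simp add: c_def)
  have "c \<noteq> 0"
  proof
    assume "c = 0"
    then have z: "L (Var i * y j) = 0" for i j using off dia by (cases "i = j") auto
    have "L (Var i * v) = 0" if "v \<in> mp.span (range y)" for i v
      using that
    proof (induction rule: mp.span_induct_alt)
      case (step a x v)
      then show ?case using z by (auto simp: distrib_left LD mult.left_commute[of "Var _" "Const _"])
    qed (simp add: LD)
    then have "L (Var i * Var j) = 0" for i j using independent_linear_forms_span[OF y] by blast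
    then show False using functional_zero_on_quadrics[OF L _ p(1)] p(2) by blast
  qed
  define L' where "L' q = L q / c" for q
  have "mpoly_functional L'"
    using L unfolding Vector_Spaces.linear_iff by (simp add: L'_def add_divide_distrib)
  moreover have "L' (Var i * y j) = (if i = j then 1 else 0)" for i j
    using off dia \<open>c \<noteq> 0\<close> by (simp add: L'_def)
  ultimately show ?thesis by blast
qed

section \<open>The Frobenius case\<close>

lemma subspace_coset_preimage:
  assumes I: "rm.subspace I" and J: "ideal J (mpoly_ring Quot I)"
  shows "rm.subspace {p. I +>\<^bsub>mpoly_ring\<^esub> p \<in> J}"
proof -
  interpret J: ideal J "mpoly_ring Quot I" by (rule J)
  show ?thesis
  proof (rule rm.subspaceI)
    show "0 \<in> {p. I +>\<^bsub>mpoly_ring\<^esub> p \<in> J}"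
      using additive_subgroup.zero_closed[OF J.additive_subgroup_axioms] by (simp add: mpoly_quotient_simps[OF I])
    fix p q assume "p \<in> {p. I +>\<^bsub>mpoly_ring\<^esub> p \<in> J}" "q \<in> {p. I +>\<^bsub>mpoly_ring\<^esub> p \<in> J}"
    then show "p + q \<in> {p. I +>\<^bsub>mpoly_ring\<^esub> p \<in> J}"
      using J.a_closed by (simp flip: mpoly_quotient_simps(2)[OF I])
  next
    fix r p assume p: "p \<in> {p. I +>\<^bsub>mpoly_ring\<^esub> p \<in> J}"
    have "I +>\<^bsub>mpoly_ring\<^esub> r \<in> carrier (mpoly_ring Quot I)" by (simp add: carrier_mpoly_quotient)
    then show "r * p \<in> {p. I +>\<^bsub>mpoly_ring\<^esub> p \<in> J}"
      using J.I_l_closed p by (simp flip: mpoly_quotient_simps(1)[OF I])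
  qed
qed

text \<open>Ideals of the quotient correspond to ideals \<open>S\<close> containing
  \<open>I\<close>, so it is enough that each such \<open>S\<close> be finitely generated modulo
  \<open>I\<close>.\<close>

lemma noetherian_mpoly_quotient:
  assumes I: "rm.subspace I"
    and fg: "\<And>S. rm.subspace S \<Longrightarrow> I \<subseteq> S \<Longrightarrow> \<exists>F. finite F \<and> F \<subseteq> S \<and> S \<subseteq> rm.span (F \<union> I)"
  shows "noetherian_ring (mpoly_ring Quot I)"
proof -
  interpret A: cring "mpoly_ring Quot I" by (rule cring_mpoly_quotient[OF I])
  have zero: "I +>\<^bsub>mpoly_ring\<^esub> p \<in> J" if "p \<in> I" "ideal J (mpoly_ring Quot I)" for p J
  proof -
    have "I +>\<^bsub>mpoly_ring\<^esub> p = \<zero>\<^bsub>mpoly_ring Quot I\<^esub>" using that(1) by (simp add: mpoly_quotient_simps[OF I] coset_eq_iff[OF I])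
    then show ?thesis using additive_subgroup.zero_closed[OF ideal.axioms(1)[OF that(2)]] by simp
  qed
  show ?thesis
  proof (rule A.noetherian_ringI)
    fix J assume J: "ideal J (mpoly_ring Quot I)"
    define S where "S = {p. I +>\<^bsub>mpoly_ring\<^esub> p \<in> J}"
    obtain F where F: "finite F" "F \<subseteq> S" "S \<subseteq> rm.span (F \<union> I)"
      using fg[of S] subspace_coset_preimage[OF I J] zero[OF _ J] by (auto simp: S_def)
    define C where "C = (\<lambda>p. I +>\<^bsub>mpoly_ring\<^esub> p) ` F"
    have CA: "C \<subseteq> carrier (mpoly_ring Quot I)" by (auto simp: C_def carrier_mpoly_quotient)
    have idl: "ideal (Idl\<^bsub>mpoly_ring Quot I\<^esub> C) (mpoly_ring Quot I)" by (rule A.genideal_ideal[OF CA])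
    have "rm.span (F \<union> I) \<subseteq> {p. I +>\<^bsub>mpoly_ring\<^esub> p \<in> Idl\<^bsub>mpoly_ring Quot I\<^esub> C}"
      using A.genideal_self[OF CA] zero[OF _ idl]
      by (intro rm.span_minimal subspace_coset_preimage[OF I idl]) (auto simp: C_def)
    then have SC: "I +>\<^bsub>mpoly_ring\<^esub> p \<in> Idl\<^bsub>mpoly_ring Quot I\<^esub> C" if "p \<in> S" for p
      using F(3) that by blast
    have "J = Idl\<^bsub>mpoly_ring Quot I\<^esub> C"
    proof
      show "J \<subseteq> Idl\<^bsub>mpoly_ring Quot I\<^esub> C"
      proof
        fix x assume x: "x \<in> J"
        then have "x \<in> carrier (mpoly_ring Quot I)" using additive_subgroup.a_subset[OF ideal.axioms(1)[OF J]] by blast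
        then obtain p where "x = I +>\<^bsub>mpoly_ring\<^esub> p" by (auto simp: carrier_mpoly_quotient)
        then show "x \<in> Idl\<^bsub>mpoly_ring Quot I\<^esub> C" using SC x by (simp add: S_def)
      qed
      show "Idl\<^bsub>mpoly_ring Quot I\<^esub> C \<subseteq> J"
        by (rule A.genideal_minimal[OF J]) (use F(2) in \<open>auto simp: C_def S_def\<close>)
    qed
    then show "\<exists>C\<subseteq>carrier (mpoly_ring Quot I). finite C \<and> J = Idl\<^bsub>mpoly_ring Quot I\<^esub> C"
      using CA F(1) by (auto simp: C_def)
  qed
qed

lemma homogeneous_Const: "homogeneous 0 (Const c)"
  by (simp add: homogeneous_iff_hc hc_0)

lemma hc_Const_mult: "hc n (Const c * p) = Const c * hc n (p :: ('n::finite, 'k::field) mpoly)"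
  by (rule poly_mapping_eqI) (simp add: lookup_hc lookup_Const_mult)

text \<open>The index \<open>i0\<close> serves twice: with \<open>j0\<close> it witnesses the
  presence of two variables, and \<open>Var i0 * y i0\<close>, on which \<open>L\<close> is one,
  represents the socle of the quotient.\<close>

locale dual_quadrics =
  fixes L :: "('n::finite, 'k::field) mpoly \<Rightarrow> 'k" and y :: "'n \<Rightarrow> ('n, 'k) mpoly"
    and I :: "('n, 'k) mpoly set" and i0 j0 :: 'n
  assumes L: "mpoly_functional L" and y: "\<And>j. homogeneous 1 (y j)"
    and dual: "\<And>i j. L (Var i * y j) = (if i = j then 1 else 0)"
    and sp: "\<And>k. Var k \<in> mp.span (range y)"
    and I_eq: "I = rm.span {p. homogeneous 2 p \<and> L p = 0}"
    and two_vars: "i0 \<noteq> j0"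
begin

lemmas LD = mpoly_functionalD[OF L]

lemma h2: "homogeneous 2 (Var i * y j)" by (rule homogeneous_1_Var_mult[OF y])

lemma subspace_I: "rm.subspace I" by (simp add: I_eq)

lemma quadric_in_I: "homogeneous 2 q \<Longrightarrow> L q = 0 \<Longrightarrow> q \<in> I"
  unfolding I_eq by (rule rm.span_base) simp

text \<open>All cubics lie in \<open>I\<close>: the monomial \<open>x\<^sub>a y\<^sub>a x\<^sub>c\<close> is in \<open>I\<close> if \<open>c \<noteq> a\<close>, and for \<open>c = a\<close> it is
  congruent to \<open>x\<^sub>k y\<^sub>k x\<^sub>a\<close> with \<open>k \<noteq> a\<close>.\<close>

lemma cubic_in_I: "Var a * Var c * y j \<in> I"
proof -
  have off: "Var a * Var c * y j \<in> I" if "c \<noteq> j" for a c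
  proof -
    have "Var c * y j \<in> I" by (rule quadric_in_I[OF h2]) (use that in \<open>simp add: dual\<close>)
    then show ?thesis using rm.subspace_scale[OF subspace_I, of "Var c * y j" "Var a"] by (simp add: mult.assoc)
  qed
  consider "c \<noteq> j" | "a \<noteq> j" | "a = j" "c = j" by blast
  then show ?thesis
  proof cases
    case 2
    then show ?thesis using off[of a c] by (simp add: mult.commute)
  next
    case 3
    obtain k where k: "k \<noteq> j" using two_vars by metis
    have "Var j * y j - Var k * y k \<in> I"
      by (rule quadric_in_I[OF homogeneous_diff[OF h2 h2]]) (simp add: LD dual)
    then have 1: "Var j * (Var j * y j - Var k * y k) \<in> I" by (rule rm.subspace_scale[OF subspace_I])
    have "Var j * y k \<in> I" by (rule quadric_in_I[OF h2]) (use k in \<open>simp add: dual\<close>)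
    then have 2: "Var k * (Var j * y k) \<in> I" by (rule rm.subspace_scale[OF subspace_I])
    have "Var a * Var c * y j = Var j * (Var j * y j - Var k * y k) + Var k * (Var j * y k)"
      by (simp add: 3 algebra_simps)
    then show ?thesis using rm.subspace_add[OF subspace_I 1 2] by simp
  qed (rule off)
qed

lemma Var_cubic_in_I: "Var a * Var c * Var b \<in> I"
proof -
  have "Var a * Var c * v \<in> I" if "v \<in> mp.span (range y)" for v
    using that
  proof (induction rule: mp.span_induct_alt)
    case base
    then show ?case by (simp add: rm.subspace_0[OF subspace_I])
  next
    case (step d x v)
    then obtain j where "x = y j" by auto
    then have "Var a * Var c * (Const d * x + v) = Const d * (Var a * Var c * y j) + Var a * Var c * v"
      by (simp add: algebra_simps)
    then show ?case
      using rm.subspace_add[OF subspace_I rm.subspace_scale[OF subspace_I cubic_in_I] step.IH] by simp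
  qed
  then show ?thesis using sp by blast
qed

lemma high_monomial_in_I:
  assumes "mdeg m \<ge> 3"
  shows "Poly_Mapping.single m c \<in> I"
proof -
  obtain n where "mdeg m = Suc (Suc (Suc n))" using assms by (metis add_2_eq_Suc add_Suc numeral_3_eq_3 le_Suc_ex numeral_2_eq_2 Suc_eq_plus1 add.commute)
  then obtain i m1 where 1: "m = Poly_Mapping.single i 1 + m1" "mdeg m1 = Suc (Suc n)" by (rule mdeg_SucE)
  from 1(2) obtain j m2 where 2: "m1 = Poly_Mapping.single j 1 + m2" "mdeg m2 = Suc n" by (rule mdeg_SucE)
  from 2(2) obtain k m3 where 3: "m2 = Poly_Mapping.single k 1 + m3" "mdeg m3 = n" by (rule mdeg_SucE)
  have "Poly_Mapping.single m c = Poly_Mapping.single m3 c * (Var i * Var j * Var k)"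
    unfolding 1 2 3 single_add_Var by (simp add: mult_ac)
  then show ?thesis using rm.subspace_scale[OF subspace_I Var_cubic_in_I] by simp
qed

text \<open>Once everything of degree at least three is known to lie in \<open>I\<close>, membership
  is decided by components of degree at most two. In particular \<open>L (hc 2 p)\<close> descends
  to the quotient; it is the trace form.\<close>

lemma I_iff: "p \<in> I \<longleftrightarrow> hc 0 p = 0 \<and> hc 1 p = 0 \<and> L (hc 2 p) = 0"
proof
  assume p: "p \<in> I"
  have "I \<subseteq> {p. hc 0 p = 0 \<and> hc 1 p = 0 \<and> hc 2 p \<in> {q. L q = 0}}"
    unfolding I_eq
  proof (rule rm.span_minimal)
    show "rm.subspace {p. hc 0 p = 0 \<and> hc 1 p = 0 \<and> hc 2 p \<in> {q. L q = 0}}"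
      by (rule ideal_of_quadric_subspace, rule mp.subspaceI) (simp_all add: LD)
  qed (auto simp: hc_homogeneous)
  then show "hc 0 p = 0 \<and> hc 1 p = 0 \<and> L (hc 2 p) = 0" using p by blast
next
  assume p: "hc 0 p = 0 \<and> hc 1 p = 0 \<and> L (hc 2 p) = 0"
  define r where "r = p - hc 2 p"
  have "Poly_Mapping.single m (Poly_Mapping.lookup r m) \<in> I" if m: "m \<in> Poly_Mapping.keys r" for m
  proof (rule high_monomial_in_I)
    have r0: "Poly_Mapping.lookup r m \<noteq> 0" using m by (simp add: in_keys_iff)
    have "Poly_Mapping.lookup p m = 0" if "mdeg m = 0 \<or> mdeg m = 1"
      using that p lookup_hc[of 0 p m] lookup_hc[of 1 p m] by auto
    then have "mdeg m \<noteq> 0 \<and> mdeg m \<noteq> 1 \<and> mdeg m \<noteq> 2"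
      using r0 by (auto simp: r_def lookup_minus lookup_hc)
    then show "3 \<le> mdeg m" by linarith
  qed
  then have "r \<in> I" by (subst mpoly_sum_single) (rule rm.subspace_sum[OF subspace_I])
  moreover have "hc 2 p \<in> I" using p by (intro quadric_in_I) simp_all
  moreover have "p = r + hc 2 p" by (simp add: r_def)
  ultimately show "p \<in> I" using rm.subspace_add[OF subspace_I, of r "hc 2 p"] by simp
qed

text \<open>The quotient is the sum of the constants, the linear forms and the line of
  \<open>Var i0 * y i0\<close>, since that product has value one under \<open>L\<close>.\<close>

lemma decomposition:
  "p - (Const (Poly_Mapping.lookup p 0) + hc 1 p + Const (L (hc 2 p)) * (Var i0 * y i0)) \<in> I"
proof -
  let ?c = "Const (Poly_Mapping.lookup p 0)" and ?s = "Const (L (hc 2 p)) * (Var i0 * y i0)"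
  have s: "homogeneous 2 ?s" by (rule homogeneous_Const_mult[OF h2])
  have "hc 0 (p - (?c + hc 1 p + ?s)) = 0" "hc 1 (p - (?c + hc 1 p + ?s)) = 0"
    unfolding hc_diff hc_add hc_hc hc_homogeneous[OF s] hc_homogeneous[OF homogeneous_Const]
    by (simp_all add: hc_0)
  moreover have "hc 2 (p - (?c + hc 1 p + ?s)) = hc 2 p - ?s"
    unfolding hc_diff hc_add hc_hc hc_homogeneous[OF s] hc_homogeneous[OF homogeneous_Const] by simp
  then have "L (hc 2 (p - (?c + hc 1 p + ?s))) = 0" by (simp add: LD dual)
  ultimately show ?thesis unfolding I_iff by simp
qed

text \<open>Pairing \<open>d\<close> with \<open>Var i0 * y i0\<close>, with the \<open>y j\<close>
  and with one isolates in turn its constant term, its linear coefficients and the trace of its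
  quadratic part.\<close>

lemma pairing_nondegenerate:
  assumes "\<And>r. L (hc 2 (r * d)) = 0"
  shows "d \<in> I"
proof -
  have "hc 2 (Var i0 * y i0 * d) = Var i0 * y i0 * hc 0 d"
    unfolding hc_2_mult[of "Var i0 * y i0" d] by (simp add: hc_homogeneous[OF h2] del: One_nat_def)
  then have "L (Const (Poly_Mapping.lookup d 0) * (Var i0 * y i0)) = 0"
    using assms[of "Var i0 * y i0"] by (simp add: hc_0 mult.commute)
  then have d0: "Poly_Mapping.lookup d 0 = 0" unfolding LD(2) by (simp add: dual)
  have "lincoeff j d = 0" for j
  proof -
    have "hc 2 (y j * d) = y j * hc 1 d"
      unfolding hc_2_mult using d0 by (simp add: hc_homogeneous[OF y] hc_0 del: One_nat_def)
    also have "\<dots> = (\<Sum>k\<in>UNIV. Const (lincoeff k d) * (Var k * y j))"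
      unfolding hc_1 by (simp add: sum_distrib_left mult_ac)
    finally have "L (hc 2 (y j * d)) = (\<Sum>k\<in>UNIV. lincoeff k d * (if k = j then 1 else 0))"
      unfolding LD(6) LD(2) dual by (simp add: LD(6) LD(2) dual del: mp.scale_scale)
    also have "\<dots> = lincoeff j d" by (simp add: if_distrib cong: if_cong)
    finally show ?thesis using assms by simp
  qed
  then have "hc 1 d = 0" unfolding hc_1 by simp
  moreover have "L (hc 2 d) = 0" using assms[of 1] by simp
  ultimately show ?thesis using d0 by (simp add: I_iff hc_0)
qed

text \<open>Under the trace pairing the basis consisting of one, the variables and
  \<open>Var i0 * y i0\<close> has the dual basis \<open>Var i0 * y i0\<close>, the
  \<open>y j\<close> and one, up to terms that do not affect the result. The element
  \<open>e\<close> is the combination of these dual elements with the values of \<open>g\<close> as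
  coefficients.\<close>

lemma functional_representation:
  assumes g: "mpoly_functional g" and gI: "\<And>p. p \<in> I \<Longrightarrow> g p = 0"
  shows "\<exists>e. \<forall>p. g p = L (hc 2 (e * p))"
proof -
  note gD = mpoly_functionalD[OF g]
  let ?s = "Var i0 * y i0"
  define e1 where "e1 = (\<Sum>j\<in>UNIV. Const (g (Var j)) * y j)"
  define e where "e = Const (g ?s) + e1 + Const (g 1) * ?s"
  have h1: "homogeneous 1 e1" unfolding e1_def by (intro homogeneous_sum homogeneous_Const_mult y)
  have hs: "homogeneous 2 (Const (g 1) * ?s)" by (rule homogeneous_Const_mult[OF h2])
  note hce = hc_add hc_homogeneous[OF hs] hc_homogeneous[OF h1] hc_homogeneous[OF homogeneous_Const]
  have e: "hc 0 e = Const (g ?s)" "hc 1 e = e1" "hc 2 e = Const (g 1) * ?s"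
    unfolding e_def hce by simp_all
  have gV: "L (e1 * Var k) = g (Var k)" for k
  proof -
    have "e1 * Var k = (\<Sum>j\<in>UNIV. Const (g (Var j)) * (Var k * y j))"
      unfolding e1_def sum_distrib_right by (simp add: mult_ac)
    then have "L (e1 * Var k) = (\<Sum>j\<in>UNIV. g (Var j) * (if k = j then 1 else 0))"
      by (simp add: LD(6) LD(2) dual)
    then show ?thesis by (simp add: if_distrib cong: if_cong)
  qed
  have "g p = L (hc 2 (e * p))" for p
  proof -
    have "g p = g (Const (Poly_Mapping.lookup p 0) * 1 + hc 1 p + Const (L (hc 2 p)) * ?s)"
      using gI[OF decomposition[of p]] by (simp add: gD(5))
    also have "\<dots> = Poly_Mapping.lookup p 0 * g 1 + g (hc 1 p) + L (hc 2 p) * g ?s"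
      unfolding gD(1,2) ..
    also have "g (hc 1 p) = (\<Sum>k\<in>UNIV. lincoeff k p * g (Var k))"
      unfolding hc_1 gD(6) gD(2) ..
    finally have 1: "g p = Poly_Mapping.lookup p 0 * g 1 + (\<Sum>k\<in>UNIV. lincoeff k p * g (Var k)) + L (hc 2 p) * g ?s" .
    have "e1 * hc 1 p = (\<Sum>k\<in>UNIV. Const (lincoeff k p) * (e1 * Var k))"
      unfolding hc_1 sum_distrib_left by (simp add: mult_ac)
    then have 2: "L (e1 * hc 1 p) = (\<Sum>k\<in>UNIV. lincoeff k p * g (Var k))"
      by (simp only: LD(6) LD(2) gV)
    have 3: "L (Const (g 1) * ?s * hc 0 p) = Poly_Mapping.lookup p 0 * g 1"
    proof -
      have "Const (g 1) * ?s * hc 0 p = Const (Poly_Mapping.lookup p 0) * (Const (g 1) * ?s)"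
        by (simp add: hc_0 mult_ac)
      then show ?thesis by (simp only: LD(2) dual) simp
    qed
    have "hc 2 (e * p) = Const (g ?s) * hc 2 p + e1 * hc 1 p + Const (g 1) * ?s * hc 0 p"
      unfolding hc_2_mult e ..
    then have "L (hc 2 (e * p)) = g ?s * L (hc 2 p) + L (e1 * hc 1 p) + L (Const (g 1) * ?s * hc 0 p)"
      by (simp only: LD(1) LD(2))
    then show ?thesis unfolding 1 2 3 by simp
  qed
  then show ?thesis by blast
qed

lemma nilpotent:
  assumes "Poly_Mapping.lookup s 0 = 0"
  shows "s * s * s \<in> I"
proof -
  have 0: "hc 0 s = 0" using assms by (simp add: hc_0)
  have 1: "hc 0 (s * s) = 0" "hc 1 (s * s) = 0" unfolding hc_0_mult hc_1_mult 0 by simp_all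
  show ?thesis unfolding I_iff hc_0_mult hc_1_mult hc_2_mult 0 by (simp add: LD)
qed

text \<open>After scaling, \<open>s\<close> is one minus a nilpotent \<open>n\<close>, and the
  geometric series \<open>1 + n + n * n\<close> inverts it modulo \<open>I\<close>.\<close>

lemma inverse_mod_I:
  assumes "Poly_Mapping.lookup s 0 \<noteq> 0"
  shows "\<exists>v. s * v - 1 \<in> I"
proof -
  define c :: "('n, 'k) mpoly" where "c = Const (1 / Poly_Mapping.lookup s 0)"
  define n where "n = 1 - c * s"
  have "Poly_Mapping.lookup n 0 = 0"
    using assms by (simp add: n_def c_def lookup_minus lookup_Const_mult lookup_one)
  then have "n * n * n \<in> I" by (rule nilpotent)
  moreover have "s * (c * (1 + n + n * n)) - 1 = - (n * n * n)"
  proof -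
    have "s * c = 1 - n" by (simp add: n_def mult.commute)
    then have "s * (c * (1 + n + n * n)) = (1 - n) * (1 + n + n * n)" by (simp add: mult.assoc[symmetric])
    then show ?thesis by (simp add: algebra_simps)
  qed
  ultimately show ?thesis using rm.subspace_neg[OF subspace_I] by metis
qed

text \<open>Denominators are already units modulo \<open>I\<close>, so the localization is the
  quotient itself. For Baer's criterion a homomorphism \<open>\<phi>\<close> into the ring is
  replaced by its trace, a functional with values in the field; this extends to the whole ring by
  linear algebra, is represented by an element \<open>e\<close>, and nondegeneracy recovers
  \<open>\<phi>\<close> from its trace.\<close>

lemma finite_self_injective_dimension_localization:
  assumes P: "primeideal P (mpoly_ring Quot I)"
  shows "finite_self_injective_dimension (localization (mpoly_ring Quot I) P)"
proof -
  interpret mpoly_quotient_localization I P by (intro mpoly_quotient_localization.intro subspace_I P)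
  interpret P: primeideal P "mpoly_ring Quot I" by (rule P)
  have zP: "I +>\<^bsub>mpoly_ring\<^esub> p \<in> P" if "p \<in> I" for p
  proof -
    have "I +>\<^bsub>mpoly_ring\<^esub> p = \<zero>\<^bsub>mpoly_ring Quot I\<^esub>"
      using that by (simp add: mpoly_quotient_simps[OF subspace_I] coset_eq_iff[OF subspace_I])
    then show ?thesis using additive_subgroup.zero_closed[OF P.additive_subgroup_axioms] by simp
  qed
  \<comment> \<open>A polynomial without constant term is nilpotent modulo \<open>I\<close> and
    hence lies in every prime.\<close>
  have out0: "Poly_Mapping.lookup s 0 \<noteq> 0" if "outside s" for s
  proof
    assume "Poly_Mapping.lookup s 0 = 0"
    then have "I +>\<^bsub>mpoly_ring\<^esub> (s * s * s) \<in> P" by (intro zP nilpotent)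
    then have "I +>\<^bsub>mpoly_ring\<^esub> s \<in> P"
      using P.I_prime coset_in_carrier unfolding mpoly_quotient_simps(1)[OF subspace_I, symmetric]
      by (metis P.m_closed)
    then show False using that by (simp add: outside_def)
  qed
  have inv: "\<exists>v. s * v - 1 \<in> I" if "outside s" for s using inverse_mod_I[OF out0[OF that]] .
  have "outside 1"
    using P.one_imp_carrier P.I_notcarr by (auto simp: outside_def simp flip: mpoly_quotient_simps(3)[OF subspace_I])
  have h0: "h p = \<zero>\<^bsub>B\<^esub> \<longleftrightarrow> p \<in> I" for p
  proof
    assume "h p = \<zero>\<^bsub>B\<^esub>"
    then obtain u where u: "outside u" "u * p \<in> I" by (auto simp: h_eq_0_iff)
    obtain v where v: "u * v - 1 \<in> I" using inv[OF u(1)] by blast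
    have "v * (u * p) \<in> I" "p * (u * v - 1) \<in> I"
      using rm.subspace_scale[OF subspace_I] u(2) v by blast+
    then have "v * (u * p) - p * (u * v - 1) \<in> I" by (rule rm.subspace_diff[OF subspace_I])
    then show "p \<in> I" by (simp add: algebra_simps)
  qed (use \<open>outside 1\<close> in \<open>auto simp: h_eq_0_iff intro!: exI[of _ 1]\<close>)
  have h_eq: "h p = h q \<longleftrightarrow> p - q \<in> I" for p q
    by (simp add: h0[symmetric] h_diff)
  have surj: "\<exists>p. b = h p" if b: "b \<in> carrier B" for b
  proof -
    obtain p s where ps: "outside s" "b \<otimes>\<^bsub>B\<^esub> h s = h p" using h_fraction[OF b] by blast
    obtain v where v: "s * v - 1 \<in> I" using inv[OF ps(1)] by blast
    then have "h s \<otimes>\<^bsub>B\<^esub> h v = \<one>\<^bsub>B\<^esub>" using h_eq[of "s * v" 1] by (simp add: h_mult h_1)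
    then have "b = b \<otimes>\<^bsub>B\<^esub> (h s \<otimes>\<^bsub>B\<^esub> h v)" using b by simp
    also have "\<dots> = h (p * v)" using b ps(2) by (simp add: B.m_assoc[symmetric] h_mult)
    finally show ?thesis by blast
  qed
  have lam: "L (hc 2 p) = L (hc 2 q)" if "h p = h q" for p q
    using that by (simp add: h_eq I_iff hc_diff LD)
  have "baer B (ring_as_module B)"
  proof (rule baerI)
    fix J \<phi> assume J: "ideal J B" and \<phi>1: "\<And>a. a \<in> J \<Longrightarrow> \<phi> a \<in> carrier (ring_as_module B)"
      and \<phi>2: "\<And>a b. a \<in> J \<Longrightarrow> b \<in> J \<Longrightarrow> \<phi> (a \<oplus>\<^bsub>B\<^esub> b) = \<phi> a \<oplus>\<^bsub>ring_as_module B\<^esub> \<phi> b"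
      and \<phi>3: "\<And>r a. r \<in> carrier B \<Longrightarrow> a \<in> J \<Longrightarrow> \<phi> (r \<otimes>\<^bsub>B\<^esub> a) = r \<odot>\<^bsub>ring_as_module B\<^esub> \<phi> a"
    interpret J: ideal J B by (rule J)
    define S where "S = {p. h p \<in> J}"
    have S0: "0 \<in> S" using additive_subgroup.zero_closed[OF J.additive_subgroup_axioms] by (simp add: S_def h_0)
    have S_add: "p + q \<in> S" if "p \<in> S" "q \<in> S" for p q using that J.a_closed by (simp add: S_def h_add)
    have S_mult: "r * p \<in> S" if "p \<in> S" for r p using that J.I_l_closed by (simp add: S_def h_mult)
    define \<psi> where "\<psi> p = (SOME q. h q = \<phi> (h p))" for p
    have \<psi>: "h (\<psi> p) = \<phi> (h p)" if "p \<in> S" for p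
    proof -
      have "\<exists>q. h q = \<phi> (h p)" using surj \<phi>1[of "h p"] that by (auto simp: S_def) metis
      then show ?thesis unfolding \<psi>_def by (rule someI_ex)
    qed
    have \<psi>_mult: "h (\<psi> (r * p)) = h (r * \<psi> p)" if "p \<in> S" for r p
      using that S_mult[OF that] \<phi>3[of "h r" "h p"] by (simp add: \<psi> h_mult) (simp add: S_def)
    have \<psi>_add: "h (\<psi> (p + q)) = h (\<psi> p + \<psi> q)" if "p \<in> S" "q \<in> S" for p q
      using that S_add[OF that] \<phi>2[of "h p" "h q"] by (simp add: \<psi> h_add) (simp add: S_def)
    define g0 where "g0 p = L (hc 2 (\<psi> p))" for p
    have g0_add: "g0 (p + q) = g0 p + g0 q" if "p \<in> S" "q \<in> S" for p q
      using lam[OF \<psi>_add[OF that]] by (simp add: g0_def hc_add LD)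
    have g0_mult: "g0 (r * p) = L (hc 2 (r * \<psi> p))" if "p \<in> S" for r p
      using lam[OF \<psi>_mult[OF that]] by (simp add: g0_def)
    \<comment> \<open>The choice \<open>\<psi> p\<close> depends only on \<open>h p\<close>, so for
      \<open>p\<close> in \<open>I\<close> the argument may be replaced by \<open>0 * 0\<close>,
      where linearity applies.\<close>
    have g0_I: "g0 p = 0" if "p \<in> I" for p
    proof -
      have hp: "h p = h 0" using that by (simp add: h_eq)
      have "h (\<psi> p) = h (\<psi> (0 * 0))" using hp by (simp add: \<psi>_def)
      also have "\<dots> = h (0 * \<psi> 0)" by (rule \<psi>_mult[OF S0])
      finally show ?thesis using lam[of "\<psi> p" 0] by (simp add: g0_def LD)
    qed
    \<comment> \<open>A vector space basis of the ideal \<open>S\<close>. A functional prescribed as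
      \<open>g0\<close> on \<open>C\<close> exists on all polynomials, and linearity of
      \<open>g0\<close> on \<open>S\<close> makes the two agree on the whole of
      \<open>S\<close>.\<close>
    obtain C where C: "C \<subseteq> S" "mp.independent C" "S \<subseteq> mp.span C"
      by (rule mp.maximal_independent_subset[of S]) (erule (2) that)
    obtain g where g: "mpoly_functional g" "\<And>x. x \<in> C \<Longrightarrow> g x = g0 x"
      using mpk.linear_independent_extend[OF C(2), of g0] by blast
    note gD = mpoly_functionalD[OF g(1)]
    have "p \<in> S \<and> g p = g0 p" if "p \<in> mp.span C" for p
      using that
    proof (induction rule: mp.span_induct_alt)
      case base
      then show ?case using S0 g0_I[OF rm.subspace_0[OF subspace_I]] by (simp add: gD)
    next
      case (step c x v)
      have x: "x \<in> S" using step C(1) by blast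
      have "g0 (Const c * x + v) = c * g0 x + g0 v"
        using g0_add[OF S_mult[OF x]] step.IH g0_mult[OF x, of "Const c"] by (simp add: hc_Const_mult LD g0_def)
      then show ?case using S_add[OF S_mult[OF x]] step g(2)[of x] by (simp add: gD)
    qed
    then have gS: "g p = g0 p" if "p \<in> S" for p using C(3) that by blast
    have IS: "p \<in> S" if "p \<in> I" for p
      using S0 that h_eq[of p 0] by (simp add: S_def)
    obtain e where e: "\<And>p. g p = L (hc 2 (e * p))"
      using functional_representation[OF g(1)] gS[OF IS] g0_I by metis
    have "\<phi> a = a \<otimes>\<^bsub>B\<^esub> h e" if a: "a \<in> J" for a
    proof -
      obtain p where p: "a = h p" using surj a J.a_subset by blast
      have pS: "p \<in> S" using a p by (simp add: S_def)
      \<comment> \<open>For every \<open>r\<close>, both \<open>r * \<psi> p\<close> and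
        \<open>r * (e * p)\<close> have trace \<open>g0 (r * p)\<close>; so the difference is
        orthogonal to everything.\<close>
      have "\<psi> p - e * p \<in> I"
      proof (rule pairing_nondegenerate)
        fix r
        have "L (hc 2 (r * \<psi> p)) = L (hc 2 (e * (r * p)))"
          using g0_mult[OF pS] gS[OF S_mult[OF pS]] e by metis
        moreover have "r * (\<psi> p - e * p) = r * \<psi> p - e * (r * p)" by (simp add: algebra_simps)
        ultimately show "L (hc 2 (r * (\<psi> p - e * p))) = 0" by (simp only: hc_diff LD) simp
      qed
      then have "\<phi> a = h (e * p)" using \<psi>[OF pS] p by (simp add: h_eq[symmetric])
      then show ?thesis by (simp add: p h_mult B.m_comm)
    qed
    then show "\<exists>e\<in>carrier (ring_as_module B). \<forall>a\<in>J. \<phi> a = a \<odot>\<^bsub>ring_as_module B\<^esub> e"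
      by (intro bexI[of _ "h e"]) simp_all
  qed
  then show ?thesis by (rule baer_self_imp_finite_self_injective_dimension[OF B.cring_axioms])
qed

text \<open>\<open>I\<close> has finite codimension: the finite set \<open>G\<close> spans a
  complement up to \<open>I\<close>. An ideal containing \<open>I\<close> is therefore generated
  over \<open>I\<close> by a vector space basis of its intersection with the span of
  \<open>G\<close>.\<close>

lemma noetherian: "noetherian_ring (mpoly_ring Quot I)"
proof (rule noetherian_mpoly_quotient[OF subspace_I])
  fix S assume S: "rm.subspace S" and IS: "I \<subseteq> S"
  define G where "G = insert 1 (insert (Var i0 * y i0) (range Var))"
  obtain F where F: "F \<subseteq> S \<inter> mp.span G" "mp.independent F" "S \<inter> mp.span G \<subseteq> mp.span F"
    by (rule mp.maximal_independent_subset[of "S \<inter> mp.span G"]) (erule (2) that)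
  have "finite F" using mp.independent_span_bound[of G F] F by (auto simp: G_def)
  moreover have "S \<subseteq> rm.span (F \<union> I)"
  proof
    fix p assume p: "p \<in> S"
    define q where "q = Const (Poly_Mapping.lookup p 0) * 1 + hc 1 p + Const (L (hc 2 p)) * (Var i0 * y i0)"
    have pq: "p - q \<in> I" using decomposition[of p] by (simp add: q_def)
    have "p - (p - q) \<in> S" using rm.subspace_diff[OF S p, of "p - q"] pq IS by blast
    then have "q \<in> S" by simp
    moreover have "hc 1 p \<in> mp.span (range Var)" by (simp add: span_Var)
    then have "hc 1 p \<in> mp.span G" using mp.span_mono[of "range Var" G] by (auto simp: G_def)
    then have "q \<in> mp.span G" unfolding q_def
      by (intro mp.span_add mp.span_scale) (auto simp: G_def intro: mp.span_base)
    ultimately have "q \<in> rm.span F" using F(3) span_le_genideal[of F] by blast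
    then have "q \<in> rm.span (F \<union> I)" using rm.span_mono[of F "F \<union> I"] by blast
    moreover have "p - q \<in> rm.span (F \<union> I)" using pq by (intro rm.span_base) simp
    ultimately have "(p - q) + q \<in> rm.span (F \<union> I)" using rm.span_add by blast
    then show "p \<in> rm.span (F \<union> I)" by simp
  qed
  ultimately show "\<exists>F. finite F \<and> F \<subseteq> S \<and> S \<subseteq> rm.span (F \<union> I)" using F(1) by blast
qed

lemma gorenstein: "gorenstein_ideal mpoly_ring I"
  unfolding gorenstein_ideal_def gorenstein_ring_def
  using subspace_I cring_mpoly_quotient[OF subspace_I] noetherian finite_self_injective_dimension_localization
  by (simp add: ideal_mpoly_ring_iff)

end

section \<open>The case of one variable\<close>

text \<open>Substitutes one indeterminate for every variable. This is a ring homomorphism for any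
  index type and an isomorphism for a single variable, where it transports division with remainder
  from univariate polynomials.\<close>

definition uni_eval :: "('n::finite, 'k::field) mpoly \<Rightarrow> 'k Polynomial.poly" where
  "uni_eval p = (\<Sum>m\<in>Poly_Mapping.keys p. Polynomial.monom (Poly_Mapping.lookup p m) (mdeg m))"

lemma uni_eval_superset:
  assumes "finite S" "Poly_Mapping.keys p \<subseteq> S"
  shows "uni_eval p = (\<Sum>m\<in>S. Polynomial.monom (Poly_Mapping.lookup p m) (mdeg m))"
  unfolding uni_eval_def using assms by (intro sum.mono_neutral_left) (auto simp: in_keys_iff)

lemma uni_eval_add: "uni_eval (p + q) = uni_eval p + uni_eval q"
proof -
  let ?S = "Poly_Mapping.keys p \<union> Poly_Mapping.keys q"
  have "uni_eval (p + q) = (\<Sum>m\<in>?S. Polynomial.monom (Poly_Mapping.lookup (p + q) m) (mdeg m))"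
    by (rule uni_eval_superset) (use keys_add[of p q] in auto)
  moreover have "uni_eval p = (\<Sum>m\<in>?S. Polynomial.monom (Poly_Mapping.lookup p m) (mdeg m))"
    by (rule uni_eval_superset) auto
  moreover have "uni_eval q = (\<Sum>m\<in>?S. Polynomial.monom (Poly_Mapping.lookup q m) (mdeg m))"
    by (rule uni_eval_superset) auto
  ultimately show ?thesis by (simp add: lookup_add sum.distrib flip: add_monom)
qed

lemma uni_eval_0 [simp]: "uni_eval 0 = 0"
  by (simp add: uni_eval_def)

lemma uni_eval_single: "uni_eval (Poly_Mapping.single m c) = Polynomial.monom c (mdeg m)"
  by (cases "c = 0") (simp_all add: uni_eval_def)

lemma uni_eval_1 [simp]: "uni_eval 1 = 1"
proof -
  have "uni_eval (Poly_Mapping.single 0 1) = 1" unfolding uni_eval_single by simp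
  then show ?thesis by simp
qed

lemma uni_eval_mult: "uni_eval (p * q) = uni_eval p * uni_eval q"
proof (induction p rule: mpoly_induct)
  case (add p p')
  then show ?case by (simp add: uni_eval_add distrib_right)
next
  case (single m a)
  show ?case
    by (induction q rule: mpoly_induct)
      (simp_all add: uni_eval_add distrib_left mult_single uni_eval_single mult_monom mdeg_add)
qed simp

lemma uni_eval_uminus: "uni_eval (- p) = - uni_eval p"
proof -
  have "uni_eval p + uni_eval (- p) = 0" by (simp flip: uni_eval_add)
  then show ?thesis by (simp add: eq_neg_iff_add_eq_0 add.commute)
qed

lemma uni_eval_diff: "uni_eval (p - q) = uni_eval p - uni_eval q"
  using uni_eval_add[of p "- q"] by (simp add: uni_eval_uminus)

lemma uni_eval_sum: "uni_eval (sum f S) = (\<Sum>x\<in>S. uni_eval (f x))"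
  by (induction S rule: infinite_finite_induct) (simp_all add: uni_eval_add)

lemma uni_eval_surj: "\<exists>p :: ('n::finite, 'k::field) mpoly. uni_eval p = q"
proof -
  have "uni_eval (\<Sum>i\<le>Polynomial.degree q. Poly_Mapping.single (Poly_Mapping.single (undefined :: 'n) i) (Polynomial.coeff q i)) = q"
    by (simp add: uni_eval_sum uni_eval_single poly_as_sum_of_monoms)
  then show ?thesis by blast
qed

text \<open>The parameter of type \<open>itself\<close> fixes the coefficient field, which the
  assumption on the index type does not mention.\<close>

locale one_variable =
  fixes i1 :: "'n::finite" and type_of_field :: "'k::field itself"
  assumes one_var: "\<And>k :: 'n. k = i1"
begin

lemma uni_eval_eq_0_iff: "uni_eval (p :: ('n, 'k) mpoly) = 0 \<longleftrightarrow> p = 0"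
proof
  assume u: "uni_eval p = 0"
  have inj: "mdeg m = mdeg m' \<longleftrightarrow> m = m'" for m m' :: "'n \<Rightarrow>\<^sub>0 nat"
  proof -
    have U: "(UNIV :: 'n set) = {i1}" using one_var by blast
    have "mdeg m = Poly_Mapping.lookup m i1" for m :: "'n \<Rightarrow>\<^sub>0 nat"
      unfolding mdeg_def by (subst sum.cong[OF U refl]) simp
    moreover have "m = m'" if "Poly_Mapping.lookup m i1 = Poly_Mapping.lookup m' i1"
      by (rule poly_mapping_eqI) (use that one_var in metis)
    ultimately show ?thesis by auto
  qed
  show "p = 0"
  proof (rule poly_mapping_eqI)
    fix m
    have "Polynomial.coeff (uni_eval p) (mdeg m) =
        (\<Sum>m'\<in>Poly_Mapping.keys p. if m' = m then Poly_Mapping.lookup p m else 0)"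
      unfolding uni_eval_def Polynomial.coeff_sum by (rule sum.cong) (auto simp: inj)
    then show "Poly_Mapping.lookup p m = Poly_Mapping.lookup 0 m"
      by (simp add: u in_keys_iff split: if_splits)
  qed
qed simp

lemma uni_eval_inj: "uni_eval (p :: ('n, 'k) mpoly) = uni_eval q \<longleftrightarrow> p = q"
  using uni_eval_eq_0_iff[of "p - q"] by (simp add: uni_eval_diff)

text \<open>Division with remainder: a nonzero element of least degree divides all others, as the
  remainder stays in \<open>S\<close>.\<close>

lemma principal:
  fixes S :: "('n, 'k) mpoly set"
  assumes S: "rm.subspace S"
  shows "\<exists>g\<in>S. \<forall>p\<in>S. \<exists>q. p = q * g"
proof (cases "S \<subseteq> {0}")
  case True
  then show ?thesis using rm.subspace_0[OF S] by (intro bexI[of _ 0]) auto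
next
  case False
  then obtain p0 where "p0 \<in> S \<and> p0 \<noteq> 0" by blast
  then obtain g where g: "g \<in> S \<and> g \<noteq> 0"
    and min: "\<And>p. p \<in> S \<and> p \<noteq> 0 \<Longrightarrow> Polynomial.degree (uni_eval g) \<le> Polynomial.degree (uni_eval p)"
    using ex_has_least_nat[of "\<lambda>p. p \<in> S \<and> p \<noteq> 0" p0 "\<lambda>p. Polynomial.degree (uni_eval p)"] by blast
  have "\<exists>q. p = q * g" if p: "p \<in> S" for p
  proof -
    obtain q :: "('n, 'k) mpoly" where q: "uni_eval q = uni_eval p div uni_eval g" using uni_eval_surj by blast
    have "p - q * g \<in> S" by (rule rm.subspace_diff[OF S p rm.subspace_scale[OF S]]) (use g in blast)
    moreover have u: "uni_eval (p - q * g) = uni_eval p mod uni_eval g"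
      unfolding uni_eval_diff uni_eval_mult q by (rule minus_div_mult_eq_mod)
    moreover have "uni_eval g \<noteq> 0" using g by (simp add: uni_eval_eq_0_iff)
    ultimately have "p - q * g = 0"
      using min[of "p - q * g"] Polynomial.degree_mod_less'[of "uni_eval g" "uni_eval p"]
      by (metis linorder_not_less uni_eval_eq_0_iff)
    then show ?thesis by (intro exI[of _ q]) simp
  qed
  then show ?thesis using g by blast
qed

lemma finite_self_injective_dimension_localization:
  assumes P: "primeideal P (mpoly_ring Quot ({0} :: ('n, 'k) mpoly set))"
  shows "finite_self_injective_dimension (localization (mpoly_ring Quot ({0} :: ('n, 'k) mpoly set)) P)"
proof -
  interpret mpoly_quotient_localization "{0} :: ('n, 'k) mpoly set" P
    by (intro mpoly_quotient_localization.intro P) simp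
  interpret P: primeideal P "mpoly_ring Quot ({0} :: ('n, 'k) mpoly set)" by (rule P)
  have nz: "uni_eval u \<noteq> 0" if "outside u" for u
  proof
    assume "uni_eval u = 0"
    then have "u = 0" by (simp add: uni_eval_eq_0_iff)
    then show False
      using that additive_subgroup.zero_closed[OF P.additive_subgroup_axioms]
      by (simp add: outside_def mpoly_quotient_simps[OF I])
  qed
  have out1: "outside 1"
    using P.one_imp_carrier P.I_notcarr by (auto simp: outside_def simp flip: mpoly_quotient_simps(3)[OF I])
  have out_mult: "outside (s * r)" if "outside s" "outside r" for s r
    using that P.I_prime coset_in_carrier unfolding outside_def mpoly_quotient_simps(1)[OF I, symmetric] by metis
  have h_inj: "h p = h q \<longleftrightarrow> p = q" for p q
  proof
    assume "h p = h q"
    then obtain u where u: "outside u" "u * (p - q) = 0" by (auto simp: h_eq_iff)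
    then have "uni_eval u * uni_eval (p - q) = 0" by (simp flip: uni_eval_mult)
    then show "p = q" using nz[OF u(1)] uni_eval_eq_0_iff[of "p - q"] by simp
  qed simp
  \<comment> \<open>The embedding of the localization into the field of fractions, sending
    \<open>p / s\<close> to the fraction of the univariate images.\<close>
  define \<theta> where "\<theta> b = (SOME f. \<exists>p s. outside s \<and> b \<otimes>\<^bsub>B\<^esub> h s = h p \<and> f = Fract (uni_eval p) (uni_eval s))" for b
  have \<theta>: "\<theta> b = Fract (uni_eval p) (uni_eval s)"
    if b: "b \<in> carrier B" and s: "outside s" and eq: "b \<otimes>\<^bsub>B\<^esub> h s = h p" for b p s
    unfolding \<theta>_def
  proof (rule some_equality)
    show "\<exists>p' s'. outside s' \<and> b \<otimes>\<^bsub>B\<^esub> h s' = h p' \<and> Fract (uni_eval p) (uni_eval s) = Fract (uni_eval p') (uni_eval s')"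
      using s eq by blast
    fix f assume "\<exists>p' s'. outside s' \<and> b \<otimes>\<^bsub>B\<^esub> h s' = h p' \<and> f = Fract (uni_eval p') (uni_eval s')"
    then obtain p' s' where s': "outside s'" and eq': "b \<otimes>\<^bsub>B\<^esub> h s' = h p'" and f: "f = Fract (uni_eval p') (uni_eval s')"
      by blast
    have "h (p * s') = h (p' * s)"
      using b by (simp add: h_mult B.m_ac flip: eq eq')
    then have "uni_eval p * uni_eval s' = uni_eval p' * uni_eval s" by (simp add: h_inj flip: uni_eval_mult)
    then show "f = Fract (uni_eval p) (uni_eval s)" unfolding f using nz[OF s] nz[OF s'] by (simp add: eq_fract)
  qed
  \<comment> \<open>The modules of the resolution must be carried by sets over the type of elements
    of the localization, so fractions have to be coded in that type. A fraction is coded by the set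
    of all its representations, each polynomial being wrapped into a singleton to fit the type of
    cosets.\<close>
  define j :: "'k Polynomial.poly fract \<Rightarrow> (('n, 'k) mpoly set \<times> ('n, 'k) mpoly set) set" where
    "j f = {({p}, {s}) | p s. uni_eval s \<noteq> 0 \<and> f = Fract (uni_eval p) (uni_eval s)}" for f
  have "inj j"
  proof (rule injI)
    fix f f' assume eq: "j f = j f'"
    obtain a b where ab: "f = Fract a b" "b \<noteq> 0" by (cases f) auto
    obtain p s :: "('n, 'k) mpoly" where ps: "uni_eval p = a" "uni_eval s = b" using uni_eval_surj by metis
    have "({p}, {s}) \<in> j f" using ab ps by (auto simp: j_def)
    then have "({p}, {s}) \<in> j f'" using eq by simp
    then show "f = f'" using ab ps by (auto simp: j_def)
  qed
  show ?thesis
  proof (rule finite_self_injective_dimension_in_field[OF B.cring_axioms \<open>inj j\<close>, of \<theta>])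
    fix a b assume a: "a \<in> carrier B" and b: "b \<in> carrier B"
    obtain p s where ps: "outside s" "a \<otimes>\<^bsub>B\<^esub> h s = h p" using h_fraction[OF a] by blast
    obtain q r where qr: "outside r" "b \<otimes>\<^bsub>B\<^esub> h r = h q" using h_fraction[OF b] by blast
    have sr: "outside (s * r)" by (rule out_mult[OF ps(1) qr(1)])
    have "(a \<oplus>\<^bsub>B\<^esub> b) \<otimes>\<^bsub>B\<^esub> h (s * r) = h (p * r + q * s)"
      using a b by (simp add: h_mult h_add B.l_distr B.r_distr B.m_ac flip: ps(2) qr(2))
    then have "\<theta> (a \<oplus>\<^bsub>B\<^esub> b) = Fract (uni_eval (p * r + q * s)) (uni_eval (s * r))"
      using a b by (intro \<theta> sr) simp_all
    then show "\<theta> (a \<oplus>\<^bsub>B\<^esub> b) = \<theta> a + \<theta> b"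
      unfolding \<theta>[OF a ps] \<theta>[OF b qr] using nz[OF ps(1)] nz[OF qr(1)] by (simp add: uni_eval_add uni_eval_mult)
    have "(a \<otimes>\<^bsub>B\<^esub> b) \<otimes>\<^bsub>B\<^esub> h (s * r) = h (p * q)"
      using a b by (simp add: h_mult B.m_ac flip: ps(2) qr(2))
    then have "\<theta> (a \<otimes>\<^bsub>B\<^esub> b) = Fract (uni_eval (p * q)) (uni_eval (s * r))"
      using a b by (intro \<theta> sr) simp_all
    then show "\<theta> (a \<otimes>\<^bsub>B\<^esub> b) = \<theta> a * \<theta> b"
      unfolding \<theta>[OF a ps] \<theta>[OF b qr] by (simp add: uni_eval_mult)
  next
    have "\<theta> \<one>\<^bsub>B\<^esub> = Fract (uni_eval (1 :: ('n, 'k) mpoly)) (uni_eval (1 :: ('n, 'k) mpoly))"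
      by (rule \<theta>) (simp_all add: out1 h_1)
    then show "\<theta> \<one>\<^bsub>B\<^esub> = 1" by (simp add: One_fract_def)
    show "inj_on \<theta> (carrier B)"
    proof (rule inj_onI)
      fix a b assume a: "a \<in> carrier B" and b: "b \<in> carrier B" and eq: "\<theta> a = \<theta> b"
      obtain p s where ps: "outside s" "a \<otimes>\<^bsub>B\<^esub> h s = h p" using h_fraction[OF a] by blast
      obtain q r where qr: "outside r" "b \<otimes>\<^bsub>B\<^esub> h r = h q" using h_fraction[OF b] by blast
      have "uni_eval (p * r) = uni_eval (q * s)"
        using eq nz[OF ps(1)] nz[OF qr(1)] unfolding \<theta>[OF a ps] \<theta>[OF b qr] by (simp add: eq_fract uni_eval_mult)
      then have "p * r = q * s" by (simp add: uni_eval_inj)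
      then have "h (s * r) \<otimes>\<^bsub>B\<^esub> a = h (s * r) \<otimes>\<^bsub>B\<^esub> b"
      proof -
        have "h (s * r) \<otimes>\<^bsub>B\<^esub> a = h (p * r)" using a by (simp add: h_mult B.m_ac flip: ps(2))
        also have "\<dots> = h (q * s)" using \<open>p * r = q * s\<close> by simp
        also have "\<dots> = h (s * r) \<otimes>\<^bsub>B\<^esub> b" using b by (simp add: h_mult B.m_ac flip: qr(2))
        finally show ?thesis .
      qed
      then show "a = b" using B.Units_l_cancel[OF h_Units[OF out_mult[OF ps(1) qr(1)]] a b] by simp
    qed
  next
    fix J assume J: "ideal J B"
    interpret J: ideal J B by (rule J)
    define S where "S = {p. h p \<in> J}"
    have "rm.subspace S"
    proof (rule rm.subspaceI)
      show "0 \<in> S" using additive_subgroup.zero_closed[OF J.additive_subgroup_axioms] by (simp add: S_def h_0)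
      show "p + q \<in> S" if "p \<in> S" "q \<in> S" for p q using that J.a_closed by (simp add: S_def h_add)
      show "r * p \<in> S" if "p \<in> S" for r p using that J.I_l_closed by (simp add: S_def h_mult)
    qed
    then obtain g where g: "g \<in> S" "\<And>p. p \<in> S \<Longrightarrow> \<exists>q. p = q * g" using principal by blast
    show "\<exists>b\<in>J. \<forall>a\<in>J. \<exists>r\<in>carrier B. a = r \<otimes>\<^bsub>B\<^esub> b"
    proof (rule bexI[of _ "h g"], rule ballI)
      show "h g \<in> J" using g(1) by (simp add: S_def)
      fix a assume a: "a \<in> J"
      then have aB: "a \<in> carrier B" using J.a_subset by blast
      obtain p s where ps: "outside s" "a \<otimes>\<^bsub>B\<^esub> h s = h p" using h_fraction[OF aB] by blast
      have "p \<in> S" using J.I_r_closed[OF a h_closed, of s] ps(2) by (simp add: S_def)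
      then obtain q where q: "p = q * g" using g(2) by blast
      \<comment> \<open>The numerator of an element of \<open>J\<close> is again in the preimage
        \<open>S\<close>, as it differs from the element by the unit \<open>h s\<close>; so a
        generator of \<open>S\<close> also generates \<open>J\<close>.\<close>
      have U: "h s \<in> Units B" by (rule h_Units[OF ps(1)])
      have "h s \<otimes>\<^bsub>B\<^esub> a = h s \<otimes>\<^bsub>B\<^esub> ((inv\<^bsub>B\<^esub> h s \<otimes>\<^bsub>B\<^esub> h q) \<otimes>\<^bsub>B\<^esub> h g)"
      proof -
        have "h s \<otimes>\<^bsub>B\<^esub> a = h q \<otimes>\<^bsub>B\<^esub> h g" using aB ps(2) q by (simp add: B.m_comm h_mult)
        also have "\<dots> = (h s \<otimes>\<^bsub>B\<^esub> inv\<^bsub>B\<^esub> h s) \<otimes>\<^bsub>B\<^esub> (h q \<otimes>\<^bsub>B\<^esub> h g)" using U by simp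
        also have "\<dots> = h s \<otimes>\<^bsub>B\<^esub> ((inv\<^bsub>B\<^esub> h s \<otimes>\<^bsub>B\<^esub> h q) \<otimes>\<^bsub>B\<^esub> h g)"
          using U by (simp add: B.m_assoc del: B.Units_r_inv)
        finally show ?thesis .
      qed
      then have "a = (inv\<^bsub>B\<^esub> h s \<otimes>\<^bsub>B\<^esub> h q) \<otimes>\<^bsub>B\<^esub> h g" using B.Units_l_cancel[OF U aB] U by simp
      then show "\<exists>r\<in>carrier B. a = r \<otimes>\<^bsub>B\<^esub> h g" using U by (intro bexI[of _ "inv\<^bsub>B\<^esub> h s \<otimes>\<^bsub>B\<^esub> h q"]) simp_all
    qed
  qed
qed

lemma gorenstein: "gorenstein_ideal mpoly_ring ({0} :: ('n, 'k) mpoly set)"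
proof -
  have I: "rm.subspace ({0} :: ('n, 'k) mpoly set)" by simp
  have "noetherian_ring (mpoly_ring Quot ({0} :: ('n, 'k) mpoly set))"
  proof (rule noetherian_mpoly_quotient[OF I])
    fix S :: "('n, 'k) mpoly set" assume "rm.subspace S"
    then obtain g where g: "g \<in> S" "\<And>p. p \<in> S \<Longrightarrow> \<exists>q. p = q * g" using principal by blast
    have "S \<subseteq> rm.span ({g} \<union> {0})"
    proof
      fix p assume "p \<in> S"
      then obtain q where "p = q * g" using g(2) by blast
      then show "p \<in> rm.span ({g} \<union> {0})" by (simp only:) (intro rm.span_scale rm.span_base, simp)
    qed
    then show "\<exists>F. finite F \<and> F \<subseteq> S \<and> S \<subseteq> rm.span (F \<union> {0})" using g(1) by (intro exI[of _ "{g}"]) simp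
  qed
  then show ?thesis
    unfolding gorenstein_ideal_def gorenstein_ring_def
    using I cring_mpoly_quotient[OF I] finite_self_injective_dimension_localization
    by (simp add: ideal_mpoly_ring_iff)
qed

end

lemma pairing_ideal_gorenstein:
  fixes y :: "'n::finite \<Rightarrow> ('n, 'k::field) mpoly"
  assumes y: "independent_linear_forms y"
    and min: "minimally_generated_by_quadrics
      (min_gens mpoly_ring (irrelevant_square :: ('n, 'k) mpoly set) - 1) (pairing_ideal i1 y)"
  shows "gorenstein_ideal mpoly_ring (pairing_ideal i1 y)"
proof (cases "\<exists>j. j \<noteq> i1")
  case True
  then obtain j where j: "i1 \<noteq> j" by metis
  obtain L where L: "mpoly_functional L" and dual: "\<And>i j. L (Var i * y j) = (if i = j then 1 else 0)"
    using pairing_ideal_functional[OF y min] by blast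
  have y1: "homogeneous 1 (y j)" for j using y by (simp add: independent_linear_forms_def)
  note sp = independent_linear_forms_span[OF y]
  interpret dual_quadrics L y "pairing_ideal i1 y" i1 j
    by (intro dual_quadrics.intro L y1 dual sp pairing_ideal_eq[OF L y1 dual sp] j)
  show ?thesis by (rule gorenstein)
next
  case False
  then have one: "k = i1" for k by metis
  interpret one_variable i1 "TYPE('k)" by unfold_locales (rule one)
  have "{Var i * y j | i j. i \<noteq> j} \<union> {Var i1 * y i1 - Var j * y j | j. j \<noteq> i1} = {}"
    using one by auto metis
  then have "pairing_ideal i1 y = rm.span {}" unfolding pairing_ideal_def genideal_mpoly_ring by (simp only:)
  then show ?thesis using gorenstein by simp
qed

theorem theorem3p6:
  fixes i1 :: "'n::finite"
  shows
    "(\<forall>I :: ('n, 'k::field) mpoly set.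
        gorenstein_ideal mpoly_ring I \<and>
        codimension mpoly_ring I = enat (card (UNIV :: 'n set)) \<and>
        minimally_generated_by_quadrics
          (min_gens mpoly_ring (irrelevant_ideal \<cdot>\<^bsub>mpoly_ring\<^esub> irrelevant_ideal :: ('n, 'k) mpoly set) - 1) I
        \<longrightarrow> (\<exists>y :: 'n \<Rightarrow> ('n, 'k) mpoly. independent_linear_forms y \<and> I = pairing_ideal i1 y)) \<and>
     (\<forall>(I :: ('n, 'k) mpoly set) (y :: 'n \<Rightarrow> ('n, 'k) mpoly).
        independent_linear_forms y \<and> I = pairing_ideal i1 y \<and>
        minimally_generated_by_quadrics
          (min_gens mpoly_ring (irrelevant_ideal \<cdot>\<^bsub>mpoly_ring\<^esub> irrelevant_ideal :: ('n, 'k) mpoly set) - 1) I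
        \<longrightarrow> gorenstein_ideal mpoly_ring I)"
  using gorenstein_imp_pairing_ideal pairing_ideal_gorenstein by blast

end
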